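(* Consider the problem $\min_{x\in\mathbb{R}^d} f(x)=\frac1n\sum_{i=1}^n f_i(x)$ and the Decentralized Stochastic AGD algorithm described in the context. Let $\varepsilon>0$ be the desired accuracy. Set $$T_k=T=\frac{\tau}{2\lambda}\log\frac{D}{\delta'},\qquad \delta'=\frac{n\varepsilon}{32}\,\frac{\mu_g^{3/2}}{L_g^{1/2}L_l^2},\qquad r=\frac{2\sigma_g^2}{\varepsilon\sqrt{L_g\mu_g}}$$ (when the communication graph is static, $T_k=T=\sqrt{\chi}\log\frac{D}{\delta'}$ instead), where $$\sqrt D=\Big(\frac{2L_l}{\sqrt{L_g\mu_g}}+1\Big)\sqrt{\delta'}+\frac{2nM_\xi}{\sqrt{L_g\mu_g}}+\frac{2L_l}{\mu_g}\sqrt n\,\Big(\|\overline u^0-x^*\|^2+\frac{2}{\sqrt{L_g\mu_g}}\Big(\frac{\sigma_g^2}{4nL_g r^2}+\delta\Big)\Big)^{1/2},$$ $$\delta=\frac1{2n}\Big(\frac{L_l^2}{L_g}+\frac{2L_l^2}{\mu_g}+L_l-\mu_l\Big)\delta'.$$ Then, to yield $\mathbf{x}^N$ such that $$\mathbb{E} f(\overline x^N)-f(x^* )\le\varepsilon,\qquad \mathbb{E}\|\mathbf{x}^N-\overline{\mathbf{x}}^N\|^2\le\delta'=O(\varepsilon),$$ the algorithm requires no more than $$N_{\mathrm{orcl}}=N\cdot r=\frac{6\sigma_g^2}{n\mu_g\varepsilon}\log\Big(\frac{4L_g\|\overline u^0-x^*\|^2}{\varepsilon}\Big)$$ stochastic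 oracle calls at each node and no more than $$N_{\mathrm{comm}}=3\sqrt{\frac{L_g}{\mu_g}}\;\kappa\,\log\Big(\frac{4L_g\|\overline u^0-x^*\|^2}{\varepsilon}\Big)\log\frac{D}{\delta'}$$ communication rounds, where $\kappa=\frac{\tau}{2\lambda}$ under the mixing assumption stated in the context (time-varying graph, parameters $\tau,\lambda$), and $\kappa=\sqrt{\chi}$ when the communication graph is static.
   Context: Norms: $\|\cdot\|$ is the Euclidean norm (Frobenius norm for matrices in $\mathbb{R}^{n\times d}$). Problem. $f_i(x)=\mathbb{E}_{\xi_i\sim\mathcal{D}_i}\mathbf{f}_i(x,\xi_i)$, $i=1,\dots,n$. Each $f_i$ is $\mu_i$-strongly convex with $\mu_i>0$; almost surely in $\xi_i$, $\mathbf{f}_i(\cdot,\xi_i)$ has an $L_i(\xi_i)$-Lipschitz gradient, with $\sqrt{\mathbb{E}_{\xi_i} L_i(\xi_i)^2}\le L_i<\infty$; under these assumptions $\mathbb{E}_{\xi_i}\nabla\mathbf{f}_i(x,\xi_i)=\nabla f_i(x)$ and $f_i$ is $L_i$-smooth. For all $x$ and $i$, $\mathbb{E}_{\xi_i}\|\nabla\mathbf{f}_i(x,\xi_i)-\nabla f_i(x)\|^2\le\sigma_i^2$. Let $x^*=\arg\min_x f(x)$. Constants: $\mu_l=\min_i\mu_i$, $L_l=\max_iL_i$, $\mu_g=\frac1n\sum_i\mu_i$, $L_g=\frac1n\sum_iL_i$, $\sigma_g^2=\frac1n\sum_i\sigma_i^2$, $L_\xi=\max_i\max_\xi L_i(\xi)$,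 $M_\xi=\max_i\max_\xi\|\nabla\mathbf{f}_i(x^*,\xi)\|$; the last two are assumed finite. Matrix notation. $\mathbf{x}=(x_1,\dots,x_n)^\top\in\mathbb{R}^{n\times d}$ stores the local copy $x_i\in\mathbb{R}^d$ of node $i$ in row $i$; $\overline x=\frac1n\sum_ix_i$ and $\overline{\mathbf{x}}=\mathbf{1}_n\overline x^\top$ (similarly for $\mathbf{u},\mathbf{v},\mathbf{y}$); $\mathcal{C}=\{\mathbf{x}:x_1=\dots=x_n\}$; $F(\mathbf{x})=\sum_{i=1}^nf_i(x_i)$. The batched stochastic gradient $\nabla^rF(\mathbf{x})\in\mathbb{R}^{n\times d}$ has $i$-th row $\frac1r\sum_{\ell=1}^r\nabla\mathbf{f}_i(x_i,\xi_i^\ell)$, with independent samples $\xi_i^\ell\sim\mathcal{D}_i$; evaluating it costs $r$ stochastic oracle calls at each node. Network. The nodes $1,\dots,n$ communicate over undirected graphs $\mathcal{G}^k=(V,E^k)$, $k\ge0$, with mixing matrices $\mathbf{W}^k$. Mixing assumption: (i) $[\mathbf{W}^k]_{ij}=0$ whenever $i\neq j$ and $(i,j)\notin E^k$; (ii) $\mathbf{W}^k\mathbf{1}_n=\mathbf{1}_n$ and $\mathbf{1}_n^\top\mathbf{W}^k=\mathbf{1}_n^\top$; (iii) there are $\tau\in\{1,2,\dots\}$ and $\lambda\in(0,1)$ such that for every $k\ge\tau-1$ and every $\mathbf{x}$, $\|\mathbf{W}^k\mathbf{W}^{k-1}\cdots\mathbf{W}^{k-\tau+1}\mathbf{x}-\overline{\mathbf{x}}\|\le(1-\lambda)\|\mathbf{x}-\overline{\mathbf{x}}\|$.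 Consensus procedure. $\mathrm{Consensus}(\mathbf{v},T)$ performs $T$ communication rounds; each round multiplies the current matrix by the mixing matrix of that round ($\mathbf{x}\mapsto\mathbf{W}^t\mathbf{x}$), starting from $\mathbf{v}$. If the graph is static with fixed mixing matrix $\mathbf{W}$ (Metropolis weights: $[\mathbf{W}]_{ij}=1/(1+\max\{d_i,d_j\})$ for edges, $d_i$ the degree of node $i$, zero for non-edges, diagonal chosen so that rows sum to 1), let $\rho=\lambda_2(\mathbf{W})<1$ be its second largest eigenvalue and $\chi=\frac1{1-\rho}$; then Chebyshev-accelerated consensus is used: $\mathrm{Consensus}(\mathbf{v},T)=P_T(\mathbf{W})\mathbf{v}$, computed in $T$ communication rounds, where $P_T$ is the Chebyshev polynomial of degree $T$ scaled so that $P_T(1)=1$, for which $\|P_T(\mathbf{W})\mathbf{x}-\overline{\mathbf{x}}\|\le(1-\sqrt{1-\rho})^T\|\mathbf{x}-\overline{\mathbf{x}}\|$. Algorithm (Decentralized Stochastic AGD). Coefficients: $\alpha^0=A^0=0$; $\alpha^{k+1}$ is the greater root of $(A^k+\alpha^{k+1})(1+A^k\mu_g/2)=2L_g(\alpha^{k+1})^2$; $A^{k+1}=A^k+\alpha^{k+1}$. Start from $\mathbf{u}^0=\mathbf{x}^0\in\mathcal{C}$ and for $k=0,1,2,\dots$ set $$\mathbf{y}^{k+1}=\frac{\alpha^{k+1}\mathbf{u}^k+A^k\mathbf{x}^k}{A^{k+1}},\qquad \mathbf{v}^{k+1}=\frac{(\alpha^{k+1}\mu_g/2)\mathbf{y}^{k+1}+(1+A^k\mu_g/2)\mathbf{u}^k-\alpha^{k+1}\nabla^rF(\mathbf{y}^{k+1})}{1+A^{k+1}\mu_g/2},$$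 $$\mathbf{u}^{k+1}=\mathrm{Consensus}(\mathbf{v}^{k+1},T_k),\qquad \mathbf{x}^{k+1}=\frac{\alpha^{k+1}\mathbf{u}^{k+1}+A^k\mathbf{x}^k}{A^{k+1}}.$$ Here $N$ is the number of outer iterations, $r$ the batch size and $T_k$ the number of consensus steps in iteration $k$; $r$, $T$, $N$ are treated as positive integers (rounding is ignored).
   Formalization: The printed r and N_orcl disagree by a factor n; proved instead: r as printed with N·r at most n times the printed N_orcl, or r divided by n with N_orcl as printed. For time-varying graphs T is taken to be a multiple of τ, since the claim can fail otherwise. *)

theory Defs
  imports
    "HOL-Probability.Probability"
    "HOL-Computational_Algebra.Polynomial"
    "HOL-Library.Landau_Symbols"
begin

section \<open>Objective functions\<close>

definition gradient :: "('a::real_inner \<Rightarrow> real) \<Rightarrow> 'a \<Rightarrow> 'a" where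
  "gradient f x = (THE g. GDERIV f x :> g)"

definition strongly_convex :: "real \<Rightarrow> ('a::real_inner \<Rightarrow> real) \<Rightarrow> bool" where
  "strongly_convex m f \<longleftrightarrow>
     (\<forall>x y. \<forall>t\<in>{0..1}. f (t *\<^sub>R x + (1 - t) *\<^sub>R y)
        \<le> t * f x + (1 - t) * f y - m / 2 * t * (1 - t) * (norm (x - y))\<^sup>2)"

definition avg :: "('n::finite \<Rightarrow> real) \<Rightarrow> real" where
  "avg c = (\<Sum>i\<in>UNIV. c i) / real CARD('n)"

definition local_obj :: "('n \<Rightarrow> 's measure) \<Rightarrow> ('n \<Rightarrow> 'a \<Rightarrow> 's \<Rightarrow> real) \<Rightarrow> 'n \<Rightarrow> 'a \<Rightarrow> real" where
  "local_obj D ff i x = (\<integral>s. ff i x s \<partial>D i)"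

definition global_obj :: "('n::finite \<Rightarrow> 's measure) \<Rightarrow> ('n \<Rightarrow> 'a \<Rightarrow> 's \<Rightarrow> real) \<Rightarrow> 'a \<Rightarrow> real" where
  "global_obj D ff x = avg (\<lambda>i. local_obj D ff i x)"

text \<open>
  \<open>ff i x s\<close> is the stochastic function of node \<open>i\<close>, \<open>Lxi i s\<close> the Lipschitz constant of its
  gradient, \<open>L i\<close> the bound on the root mean square of that constant.  The product measurability
  in \<open>gradient_measurable\<close> is the usual tacit requirement under which the iterates of a stochastic
  gradient method are random variables.  Unbiasedness of the stochastic gradient and
  \<open>L i\<close>-smoothness of the local objectives are consequences and are not assumed.
\<close>

locale stochastic_problem =
  fixes D :: "'n::finite \<Rightarrow> 's measure"
    and ff :: "'n \<Rightarrow> 'a::euclidean_space \<Rightarrow> 's \<Rightarrow> real"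
    and Lxi :: "'n \<Rightarrow> 's \<Rightarrow> real"
    and mu L sigma :: "'n \<Rightarrow> real"
    and xs :: 'a
  assumes prob: "prob_space (D i)"
    and integrable_ff: "integrable (D i) (ff i x)"
    and mu_pos: "0 < mu i"
    and strongly_convex: "strongly_convex (mu i) (local_obj D ff i)"
    and differentiable: "AE s in D i. \<forall>x. \<exists>g. GDERIV (\<lambda>y. ff i y s) x :> g"
    and lipschitz: "AE s in D i. (Lxi i s)-lipschitz_on UNIV (gradient (\<lambda>y. ff i y s))"
    and gradient_measurable:
      "(\<lambda>(x, s). gradient (\<lambda>y. ff i y s) x) \<in> borel_measurable (borel \<Otimes>\<^sub>M D i)"
    and Lxi_measurable: "Lxi i \<in> borel_measurable (D i)"
    and Lxi_square_integrable: "integrable (D i) (\<lambda>s. (Lxi i s)\<^sup>2)"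
    and Lxi_bound: "sqrt (\<integral>s. (Lxi i s)\<^sup>2 \<partial>D i) \<le> L i"
    and variance_integrable:
      "integrable (D i) (\<lambda>s. (norm (gradient (\<lambda>y. ff i y s) x - gradient (local_obj D ff i) x))\<^sup>2)"
    and variance_bound:
      "(\<integral>s. (norm (gradient (\<lambda>y. ff i y s) x - gradient (local_obj D ff i) x))\<^sup>2 \<partial>D i)
         \<le> (sigma i)\<^sup>2"
    and minimizer: "is_arg_min (global_obj D ff) (\<lambda>_. True) xs"
    and Lxi_bounded: "bdd_above (Lxi i ` space (D i))"
    and gradient_at_minimizer_bounded:
      "bdd_above ((\<lambda>s. norm (gradient (\<lambda>y. ff i y s) xs)) ` space (D i))"

definition M_xi ::
  "('n::finite \<Rightarrow> 's measure) \<Rightarrow> ('n \<Rightarrow> 'a::real_inner \<Rightarrow> 's \<Rightarrow> real) \<Rightarrow> 'a \<Rightarrow> real" where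
  "M_xi D ff xs = Max (range (\<lambda>i. SUP s\<in>space (D i). norm (gradient (\<lambda>y. ff i y s) xs)))"


section \<open>Stacked copies and sampling\<close>

text \<open>Row \<open>i\<close> of \<open>X :: real^'d^'n\<close> is the copy of node \<open>i\<close>; \<open>norm X\<close> is the Frobenius norm.\<close>

definition row_mean :: "real^'d^'n \<Rightarrow> real^'d" where
  "row_mean X = (1 / real CARD('n)) *\<^sub>R (\<Sum>i\<in>UNIV. X $ i)"

definition mean_matrix :: "real^'d^'n \<Rightarrow> real^'d^'n" where
  "mean_matrix X = (\<chi> i. row_mean X)"

definition consensual :: "real^'d^'n \<Rightarrow> bool" where
  "consensual X \<longleftrightarrow> (\<forall>i j. X $ i = X $ j)"

definition batch_gradient ::
  "('n::finite \<Rightarrow> real^'d \<Rightarrow> 's \<Rightarrow> real) \<Rightarrow> nat \<Rightarrow> ('n \<Rightarrow> nat \<Rightarrow> 's) \<Rightarrow> real^'d^'n \<Rightarrow> real^'d^'n" where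
  "batch_gradient ff r z Y =
     (\<chi> i. (1 / real r) *\<^sub>R (\<Sum>l<r. gradient (\<lambda>y. ff i y (z i l)) (Y $ i)))"

text \<open>\<open>\<xi> k i l\<close> is the \<open>l\<close>-th sample drawn by node \<open>i\<close> in iteration \<open>k\<close>.\<close>

definition independent_samples ::
  "'w measure \<Rightarrow> ('n \<Rightarrow> 's measure) \<Rightarrow> (nat \<Rightarrow> 'n \<Rightarrow> nat \<Rightarrow> 'w \<Rightarrow> 's) \<Rightarrow> bool" where
  "independent_samples M D \<xi> \<longleftrightarrow>
     prob_space M \<and>
     prob_space.indep_vars M (\<lambda>(k, i, l). D i) (\<lambda>(k, i, l). \<xi> k i l) UNIV \<and>
     (\<forall>k i l. distr M (D i) (\<xi> k i l) = D i)"


section \<open>Communication\<close>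

definition mixing_matrices ::
  "'d::finite itself \<Rightarrow> (nat \<Rightarrow> ('n::finite \<times> 'n) set) \<Rightarrow> (nat \<Rightarrow> real^'n^'n) \<Rightarrow> nat \<Rightarrow> real \<Rightarrow> bool" where
  "mixing_matrices _ E W \<tau> lam \<longleftrightarrow>
     (\<forall>k. sym (E k) \<and> irrefl (E k)) \<and>
     (\<forall>k i j. i \<noteq> j \<and> (i, j) \<notin> E k \<longrightarrow> W k $ i $ j = 0) \<and>
     (\<forall>k. W k *v 1 = 1 \<and> 1 v* W k = 1) \<and>
     1 \<le> \<tau> \<and> 0 < lam \<and> lam < 1 \<and>
     (\<forall>k \<ge> \<tau> - 1. \<forall>X :: real^'d^'n.
        norm (fold (\<lambda>t Y. W t ** Y) [k + 1 - \<tau>..<k + 1] X - mean_matrix X)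
          \<le> (1 - lam) * norm (X - mean_matrix X))"

text \<open>
  Communication rounds are numbered consecutively through the whole run, so with \<open>T\<close> rounds per
  iteration the ones of iteration \<open>k\<close> are \<open>k * T, \<dots>, k * T + T - 1\<close>.
\<close>

definition time_varying_consensus ::
  "(nat \<Rightarrow> real^'n^'n) \<Rightarrow> nat \<Rightarrow> nat \<Rightarrow> real^'d^'n \<Rightarrow> real^'d^'n" where
  "time_varying_consensus W T k V = fold (\<lambda>t Y. W t ** Y) [k * T..<k * T + T] V"

definition degree_in :: "('n \<times> 'n) set \<Rightarrow> 'n \<Rightarrow> nat" where
  "degree_in G i = card {j. (i, j) \<in> G}"

definition metropolis :: "('n::finite \<times> 'n) set \<Rightarrow> real^'n^'n" where
  "metropolis G =
     (let w = (\<lambda>i j. if (i, j) \<in> G then 1 / (1 + real (max (degree_in G i) (degree_in G j))) else 0)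
      in (\<chi> i j. if i = j then 1 - (\<Sum>k\<in>UNIV - {i}. w i k) else w i j))"

definition eigenvalues :: "real^'n^'n \<Rightarrow> real set" where
  "eigenvalues W = {l. \<exists>x. x \<noteq> 0 \<and> W *v x = l *\<^sub>R x}"

text \<open>
  Multiplicities are counted: \<open>l\<close> qualifies when the eigenvalues that are at least \<open>l\<close> have
  total multiplicity at least 2.  The matrices are symmetric, so the geometric multiplicity
  is the right one.
\<close>

definition second_eigenvalue :: "real^'n^'n \<Rightarrow> real" where
  "second_eigenvalue W =
     Max {l \<in> eigenvalues W. 2 \<le> (\<Sum>m | m \<in> eigenvalues W \<and> l \<le> m. dim {x. W *v x = m *\<^sub>R x})}"

definition chi :: "real^'n^'n \<Rightarrow> real" where
  "chi W = 1 / (1 - second_eigenvalue W)"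

definition static_graph :: "('n::finite \<times> 'n) set \<Rightarrow> bool" where
  "static_graph G \<longleftrightarrow>
     2 \<le> CARD('n) \<and> sym G \<and> irrefl G \<and> second_eigenvalue (metropolis G) < 1"

fun chebyshev :: "nat \<Rightarrow> real poly" where
  "chebyshev 0 = 1"
| "chebyshev (Suc 0) = [:0, 1:]"
| "chebyshev (Suc (Suc k)) = [:0, 2:] * chebyshev (Suc k) - chebyshev k"

text \<open>
  The Chebyshev polynomial of degree \<open>T\<close> transplanted from \<open>[-1, 1]\<close> to \<open>[a, b]\<close> and normalised to
  the value 1 at 1.  For \<open>a = b\<close> (as for the complete graph, where all eigenvalues but the
  largest coincide) the definition takes the limit of these polynomials as the interval shrinks.
\<close>

definition scaled_chebyshev :: "real \<Rightarrow> real \<Rightarrow> nat \<Rightarrow> real poly" where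
  "scaled_chebyshev a b T =
     (let p = (if a < b then chebyshev T \<circ>\<^sub>p [: - (a + b) / (b - a), 2 / (b - a) :] else [: -b, 1 :] ^ T)
      in smult (1 / poly p 1) p)"

text \<open>\<open>p(W) V\<close>; every application of \<open>W\<close> is one communication round.\<close>

definition poly_apply :: "real poly \<Rightarrow> real^'n^'n \<Rightarrow> real^'d^'n \<Rightarrow> real^'d^'n" where
  "poly_apply p W V = (\<Sum>j\<le>degree p. coeff p j *\<^sub>R ((\<lambda>Y. W ** Y) ^^ j) V)"

text \<open>
  The interval is the range of the eigenvalues of \<open>W\<close> other than the simple eigenvalue 1.
  No contraction factor is assumed for this operator.
\<close>

definition static_consensus :: "real^'n^'n \<Rightarrow> nat \<Rightarrow> nat \<Rightarrow> real^'d^'n \<Rightarrow> real^'d^'n" where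
  "static_consensus W T k V =
     poly_apply (scaled_chebyshev (Min (eigenvalues W)) (second_eigenvalue W) T) W V"


section \<open>The algorithm\<close>

definition next_alpha :: "real \<Rightarrow> real \<Rightarrow> real \<Rightarrow> real" where
  "next_alpha mu_g L_g A = Max {a. (A + a) * (1 + A * mu_g / 2) = 2 * L_g * a\<^sup>2}"

primrec coeff_A :: "real \<Rightarrow> real \<Rightarrow> nat \<Rightarrow> real" where
  "coeff_A mu_g L_g 0 = 0"
| "coeff_A mu_g L_g (Suc k) = coeff_A mu_g L_g k + next_alpha mu_g L_g (coeff_A mu_g L_g k)"

text \<open>
  The state is the pair of \<open>x\<close> and \<open>u\<close>; \<open>cons k\<close> and \<open>grad k\<close> are the consensus operator and
  the stochastic gradient oracle used in the step from \<open>k\<close> to \<open>Suc k\<close>.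
\<close>

primrec dsagd ::
  "real \<Rightarrow> real \<Rightarrow> (nat \<Rightarrow> real^'d^'n \<Rightarrow> real^'d^'n) \<Rightarrow> (nat \<Rightarrow> real^'d^'n \<Rightarrow> real^'d^'n) \<Rightarrow>
     real^'d^'n \<Rightarrow> nat \<Rightarrow> (real^'d^'n) \<times> (real^'d^'n)" where
  "dsagd mu_g L_g cons grad x0 0 = (x0, x0)"
| "dsagd mu_g L_g cons grad x0 (Suc k) =
     (let (x, u) = dsagd mu_g L_g cons grad x0 k;
          A = coeff_A mu_g L_g k;
          a = next_alpha mu_g L_g A;
          A' = coeff_A mu_g L_g (Suc k);
          y = (1 / A') *\<^sub>R (a *\<^sub>R u + A *\<^sub>R x);
          v = (1 / (1 + A' * mu_g / 2)) *\<^sub>R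
                ((a * mu_g / 2) *\<^sub>R y + (1 + A * mu_g / 2) *\<^sub>R u - a *\<^sub>R grad k y);
          u' = cons k v;
          x' = (1 / A') *\<^sub>R (a *\<^sub>R u' + A *\<^sub>R x)
      in (x', u'))"


section \<open>Parameters\<close>

definition consensus_tol :: "nat \<Rightarrow> real \<Rightarrow> real \<Rightarrow> real \<Rightarrow> real \<Rightarrow> real" where
  "consensus_tol n mu_g L_g L_l eps =
     real n * eps / 32 * (mu_g powr (3/2) / (L_g powr (1/2) * L_l\<^sup>2))"

text \<open>
  The batch size \<open>r = 2 \<sigma>\<^sub>g\<^sup>2 / (\<epsilon> \<surd>(L\<^sub>g \<mu>\<^sub>g))\<close> and the iteration number
  \<open>N = 3 \<surd>(L\<^sub>g / \<mu>\<^sub>g) log (\<dots>)\<close> multiply to \<open>6 \<sigma>\<^sub>g\<^sup>2 / (\<mu>\<^sub>g \<epsilon>) log (\<dots>)\<close>, which differs by the factor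
  \<open>n\<close> from the oracle complexity \<open>6 \<sigma>\<^sub>g\<^sup>2 / (n \<mu>\<^sub>g \<epsilon>) log (\<dots>)\<close>.  The parameter \<open>s\<close> selects between
  the two consistent pairs: \<open>s = 1\<close> is the former batch size with its cost, \<open>s = n\<close> the latter
  cost with the batch size that attains it.
\<close>

definition batch_size :: "real \<Rightarrow> real \<Rightarrow> real \<Rightarrow> real \<Rightarrow> real \<Rightarrow> real" where
  "batch_size s sigma_g2 mu_g L_g eps = 2 * sigma_g2 / (s * eps * sqrt (L_g * mu_g))"

definition oracle_calls :: "real \<Rightarrow> real \<Rightarrow> real \<Rightarrow> real \<Rightarrow> real \<Rightarrow> real \<Rightarrow> real" where
  "oracle_calls s sigma_g2 mu_g L_g eps R2 =
     6 * sigma_g2 / (s * mu_g * eps) * ln (4 * L_g * R2 / eps)"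

end

(*
  The row averages of the iterates perform an accelerated gradient method for f whose gradient is
  perturbed twice: by the sampling noise, and by the disagreement of the nodes, since the local
  gradients are evaluated at the y_i and not at their average.  Per unit of the weight A^k, the
  disagreement costs O(L_l^2 / (n mu_g)) times its square and the noise 3 / (8 L_g) times its
  variance; the weights grow by the factor 1 + sqrt(mu_g / L_g) / 2 in each step, and their
  partial sums stay below (1 + 2 sqrt(L_g / mu_g)) A^k.

  The disagreement of v^{k+1} is controlled through the second moment of the stochastic
  gradient, which depends on the distance of the averages to x*.  The potential of the
  accelerated method bounds that distance by a multiple of the initial one as long as k is less
  than the number N of iterations; this uses that N itself is bounded in terms of the initial
  distance.  Hence consensus after each step and decrease of the potential are proved by one
  simultaneous induction.

  In the time-varying case the contraction of T rounds is a product of blocks of length tau.  In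
  the static case it is read off from an orthonormal eigenbasis of the complement of the
  constant vectors; Chebyshev polynomials contract by 2 exp(- T sqrt(1 - rho)), and the factor 2
  is harmless because D is at least 9 delta'.
*)

theory Submission
  imports Defs
begin

section \<open>Smooth and strongly convex functions\<close>

text \<open>The step equation carries \<open>2 * L\<close> and the algorithm uses only half of the
  strong convexity. With \<open>q = sqrt (mu_g / L_g)\<close>, a step costs at most
  \<open>15 / 64 * \<epsilon> * q\<close> times its new weight: 3/64 for the disagreement and 3/8 *
  1/2 = 12/64 for the noise. As \<open>q \<le> 1\<close>, the bound on the partial sums turns this
  into 45/64 of \<open>\<epsilon>\<close>; from two steps on, the initial distance adds at most
  272/1000. The total stays below 1 although the number of steps is rounded down. The obstacle is a
  circle: the tolerance after consensus needs bounded second moments of the oracle, these need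
  nearness to \<open>xs\<close>, and nearness needs the tolerance in all earlier steps. It can be
  broken because the bound on the distance is the same for all steps. The number
  \<open>sqrt_D\<close> bounds the root mean square disagreement before consensus, so
  \<open>D / \<delta>'\<close> is the factor by which the squared disagreement must shrink. No
  conditional expectations are formed; Fubini for the law of the past and one fresh sample replaces
  them.\<close>

lemma gradient_eqI:
  assumes "GDERIV f x :> g"
  shows "gradient f x = g"
  unfolding gradient_def
proof (rule the_equality[where P = "\<lambda>g. GDERIV f x :> g", OF assms])
  fix g' assume "GDERIV f x :> g'"
  then have "(\<lambda>h. inner h g') = (\<lambda>h. inner h g)"
    using assms unfolding gderiv_def by (rule has_derivative_unique)
  then show "g' = g"
    by (metis vector_eq_ldot inner_commute)
qed

lemma GDERIV_along_line:
  assumes "GDERIV f (x + t *\<^sub>R h) :> g"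
  shows "((\<lambda>t. f (x + t *\<^sub>R h)) has_real_derivative inner g h) (at t)"
proof -
  have 1: "((\<lambda>t. x + t *\<^sub>R h) has_derivative (\<lambda>s. s *\<^sub>R h)) (at t)"
    by (auto intro!: derivative_eq_intros)
  have "((\<lambda>t. f (x + t *\<^sub>R h)) has_derivative (\<lambda>s. inner (s *\<^sub>R h) g)) (at t)"
    using has_derivative_compose[OF 1] assms unfolding gderiv_def by blast
  then show ?thesis
    by (simp add: has_field_derivative_def inner_commute mult_commute_abs)
qed

lemma smooth_upper_bound:
  fixes f :: "'a::real_inner \<Rightarrow> real"
  assumes d: "\<And>z. GDERIV f z :> g z" and lip: "C-lipschitz_on UNIV g"
  shows "f y \<le> f x + inner (g x) (y - x) + C / 2 * (norm (y - x))\<^sup>2"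
proof -
  define h where "h = y - x"
  \<comment> \<open>Up to the constant \<open>f x\<close>, this is the upper model minus
    \<open>f\<close> along the segment. Its monotonicity between 0 and 1 is therefore the
    claim.\<close>
  define \<phi> where "\<phi> t = C / 2 * t\<^sup>2 * (norm h)\<^sup>2 + t * inner (g x) h - f (x + t *\<^sub>R h)" for t :: real
  have "\<phi> 0 \<le> \<phi> 1"
  proof (rule DERIV_nonneg_imp_nondecreasing[where f = \<phi>])
    fix t :: real assume t: "0 \<le> t" "t \<le> 1"
    have "(\<phi> has_real_derivative C * t * (norm h)\<^sup>2 + inner (g x) h - inner (g (x + t *\<^sub>R h)) h) (at t)"
      unfolding \<phi>_def
      by (auto intro!: derivative_eq_intros GDERIV_along_line d)
    moreover have "inner (g (x + t *\<^sub>R h)) h - inner (g x) h \<le> C * t * (norm h)\<^sup>2"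
    proof -
      have "inner (g (x + t *\<^sub>R h)) h - inner (g x) h \<le> norm (g (x + t *\<^sub>R h) - g x) * norm h"
        by (metis inner_diff_left norm_cauchy_schwarz)
      also have "\<dots> \<le> (C * norm (t *\<^sub>R h)) * norm h"
        using lipschitz_on_normD[OF lip, of "x + t *\<^sub>R h" x] by (intro mult_right_mono) auto
      finally show ?thesis using t by (simp add: power2_eq_square mult.assoc)
    qed
    ultimately show "\<exists>y. (\<phi> has_real_derivative y) (at t) \<and> 0 \<le> y"
      by (intro exI[of _ "C * t * (norm h)\<^sup>2 + inner (g x) h - inner (g (x + t *\<^sub>R h)) h"]) simp
  qed simp
  then show ?thesis by (simp add: \<phi>_def h_def algebra_simps)
qed

lemma smooth_quadratic_gap:
  fixes f :: "'a::real_inner \<Rightarrow> real"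
  assumes d: "\<And>z. GDERIV f z :> g z" and lip: "C-lipschitz_on UNIV g"
  shows "\<bar>f y - f x - inner (g x) (y - x)\<bar> \<le> C / 2 * (norm (y - x))\<^sup>2"
proof -
  have "C-lipschitz_on UNIV (\<lambda>x. - g x)"
    using lip by (simp add: lipschitz_on_minus)
  with smooth_upper_bound[OF GDERIV_minus[OF d], of C y x] smooth_upper_bound[OF d lip, of y x]
  show ?thesis
    by (auto simp: abs_if)
qed

text \<open>A converse of the previous lemma. A quadratic gap survives integration over samples, so
  the expectation can be differentiated without a dominated convergence argument.\<close>

lemma GDERIV_from_quadratic_gap:
  fixes f :: "'a::real_inner \<Rightarrow> real"
  assumes gap: "\<And>y. \<bar>f y - f x - inner g (y - x)\<bar> \<le> K * (norm (y - x))\<^sup>2"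
  shows "GDERIV f x :> g"
  unfolding gderiv_def has_derivative_iff_norm
proof (intro conjI)
  show "bounded_linear (\<lambda>h. inner h g)" by (rule bounded_linear_inner_left)
  have "((\<lambda>y. K * norm (y - x)) \<longlongrightarrow> K * norm (x - x)) (at x)"
    by (intro tendsto_intros)
  then have lim: "((\<lambda>y. K * norm (y - x)) \<longlongrightarrow> 0) (at x)" by simp
  show "((\<lambda>y. norm (f y - f x - inner (y - x) g) / norm (y - x)) \<longlongrightarrow> 0) (at x)"
  proof (rule Lim_null_comparison[OF _ lim], rule always_eventually, rule allI)
    fix y
    show "norm (norm (f y - f x - inner (y - x) g) / norm (y - x)) \<le> K * norm (y - x)"
    proof (cases "y = x")
      case False
      then show ?thesis
        using gap[of y] by (simp add: inner_commute divide_le_eq power2_eq_square mult.assoc)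
    qed simp
  qed
qed

lemma strongly_convex_first_order:
  assumes sc: "strongly_convex m f" and d: "GDERIV f y :> g"
  shows "f y + inner g (z - y) + m / 2 * (norm (z - y))\<^sup>2 \<le> f z"
proof -
  define h where "h = z - y"
  have "((\<lambda>t. f (y + t *\<^sub>R h)) has_real_derivative inner g h) (at 0)"
    by (rule GDERIV_along_line) (use d in simp)
  then have "((\<lambda>t. (f (y + t *\<^sub>R h) - f y) / t) \<longlongrightarrow> inner g h) (at 0)"
    by (simp add: has_field_derivative_iff)
  \<comment> \<open>Strong convexity controls the difference quotient only for
    \<open>0 < t < 1\<close>, hence the one-sided limit.\<close>
  then have l1: "((\<lambda>t. (f (y + t *\<^sub>R h) - f y) / t) \<longlongrightarrow> inner g h) (at_right 0)"
    by (rule filterlim_mono) (auto simp: at_le)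
  have "((\<lambda>t. f z - f y - m / 2 * (1 - t) * (norm h)\<^sup>2) \<longlongrightarrow> f z - f y - m / 2 * (1 - 0) * (norm h)\<^sup>2)
     (at_right 0)"
    by (intro tendsto_intros)
  then have l2: "((\<lambda>t. f z - f y - m / 2 * (1 - t) * (norm h)\<^sup>2) \<longlongrightarrow> f z - f y - m / 2 * (norm h)\<^sup>2)
     (at_right 0)" by simp
  have "\<forall>\<^sub>F t in at_right (0::real). t < 1 \<and> 0 < t"
    by (subst eventually_at_right[of 0 1]) (auto intro: exI[of _ 1])
  then have ev: "\<forall>\<^sub>F t in at_right 0.
     (f (y + t *\<^sub>R h) - f y) / t \<le> f z - f y - m / 2 * (1 - t) * (norm h)\<^sup>2"
  proof (rule eventually_mono)
    fix t :: real assume t: "t < 1 \<and> 0 < t"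
    have "t *\<^sub>R z + (1 - t) *\<^sub>R y = y + t *\<^sub>R h"
      by (simp add: h_def algebra_simps)
    then have "f (y + t *\<^sub>R h) \<le> t * f z + (1 - t) * f y - m / 2 * t * (1 - t) * (norm h)\<^sup>2"
      using sc[unfolded strongly_convex_def, rule_format, of t z y] t by (simp add: h_def)
    then have "f (y + t *\<^sub>R h) - f y \<le> (f z - f y - m / 2 * (1 - t) * (norm h)\<^sup>2) * t"
      by (simp add: algebra_simps)
    then show "(f (y + t *\<^sub>R h) - f y) / t \<le> f z - f y - m / 2 * (1 - t) * (norm h)\<^sup>2"
      using t by (subst pos_divide_le_eq) auto
  qed
  have "inner g h \<le> f z - f y - m / 2 * (norm h)\<^sup>2"
    by (rule tendsto_le[OF _ l2 l1 ev]) simp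
  then show ?thesis by (simp add: h_def)
qed

text \<open>The lower and the upper quadratic model at 0 have the same linear part; comparing them
  at one unit vector leaves the two constants.\<close>

lemma strongly_convex_smooth_le:
  fixes f :: "'a::euclidean_space \<Rightarrow> real"
  assumes "strongly_convex m f" and d: "\<And>z. GDERIV f z :> g z" and "C-lipschitz_on UNIV g"
  shows "m \<le> C"
proof -
  obtain b :: 'a where b: "b \<in> Basis" using nonempty_Basis by blast
  have "m / 2 * (norm (b - 0))\<^sup>2 \<le> C / 2 * (norm (b - 0))\<^sup>2"
    using strongly_convex_first_order[OF assms(1) d, of 0 b] smooth_upper_bound[OF assms(2,3), of b 0]
    by linarith
  then show ?thesis using b by simp
qed

lemma sqrt_second_moment_ge_mean:
  fixes X :: "'s \<Rightarrow> real"
  assumes "prob_space M" "X \<in> borel_measurable M" and sq: "integrable M (\<lambda>s. (X s)\<^sup>2)"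
  shows "integrable M X" "(\<integral>s. X s \<partial>M) \<le> sqrt (\<integral>s. (X s)\<^sup>2 \<partial>M)"
proof -
  interpret prob_space M by fact
  show int: "integrable M X"
    using assms(2) sq by (rule square_integrable_imp_integrable)
  have "0 \<le> (\<integral>s. (X s - (\<integral>s. X s \<partial>M))\<^sup>2 \<partial>M)" by (rule integral_nonneg_AE) simp
  then have "(\<integral>s. X s \<partial>M)\<^sup>2 \<le> (\<integral>s. (X s)\<^sup>2 \<partial>M)"
    using variance_eq[OF int sq] by simp
  then show "(\<integral>s. X s \<partial>M) \<le> sqrt (\<integral>s. (X s)\<^sup>2 \<partial>M)"
    by (rule real_le_rsqrt)
qed

lemma integrable_norm_sq_imp_integrable:
  fixes X :: "'s \<Rightarrow> 'a::euclidean_space"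
  assumes "finite_measure M" "X \<in> borel_measurable M" "integrable M (\<lambda>s. (norm (X s))\<^sup>2)"
  shows "integrable M X"
proof -
  interpret finite_measure M by fact
  have "integrable M (\<lambda>s. norm (X s))"
    by (rule square_integrable_imp_integrable) (use assms in simp_all)
  then show ?thesis using assms(2) by (simp add: integrable_norm_iff)
qed

section \<open>The stochastic problem\<close>

context stochastic_problem
begin

abbreviation (input) "G \<equiv> \<lambda>i x s. gradient (\<lambda>y. ff i y s) x"
abbreviation (input) "g \<equiv> \<lambda>i. gradient (local_obj D ff i)"

section \<open>Differentiability, unbiasedness and smoothness of the local objectives\<close>

lemma gradient_section_measurable: "(\<lambda>s. G i x s) \<in> borel_measurable (D i)"
proof -
  have "(\<lambda>s. (x, s)) \<in> measurable (D i) (borel \<Otimes>\<^sub>M D i)" by simp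
  from measurable_compose[OF this gradient_measurable[of i]] show ?thesis by simp
qed

text \<open>Differentiability of the local objective is not yet known here, so \<open>g i x\<close>
  is a definite description of unknown value. It enters merely as a constant that is subtracted and
  added again.\<close>

lemma gradient_section_integrable: "integrable (D i) (\<lambda>s. G i x s)"
proof -
  interpret prob_space "D i" by (rule prob)
  have "integrable (D i) (\<lambda>s. G i x s - g i x)"
    by (rule integrable_norm_sq_imp_integrable[OF finite_measure_axioms _ variance_integrable])
      (use gradient_section_measurable in measurable)
  then have "integrable (D i) (\<lambda>s. (G i x s - g i x) + g i x)"
    by (rule Bochner_Integration.integrable_add) simp
  then show ?thesis by simp
qed

lemma Lxi_integrable: "integrable (D i) (Lxi i)"
  and Lxi_mean: "(\<integral>s. Lxi i s \<partial>D i) \<le> L i"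
  using sqrt_second_moment_ge_mean[OF prob Lxi_measurable Lxi_square_integrable, of i] Lxi_bound[of i]
  by auto

lemma L_nonneg: "0 \<le> L i"
  by (rule order_trans[OF real_sqrt_ge_zero Lxi_bound]) (rule integral_nonneg_AE, simp)

text \<open>The quantifiers over points stand inside \<open>AE\<close>: one null set of samples
  serves all points.\<close>

lemma sample_GDERIV:
  "AE s in D i. (\<forall>x. GDERIV (\<lambda>y. ff i y s) x :> G i x s) \<and> 0 \<le> Lxi i s \<and>
     (\<forall>x y. norm (G i x s - G i y s) \<le> Lxi i s * norm (x - y)) \<and>
     (\<forall>x y. \<bar>ff i y s - ff i x s - inner (G i x s) (y - x)\<bar> \<le> Lxi i s / 2 * (norm (y - x))\<^sup>2)"
  using differentiable[of i] lipschitz[of i]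
proof eventually_elim
  case (elim s)
  then have d: "\<forall>x. GDERIV (\<lambda>y. ff i y s) x :> G i x s"
    by (metis gradient_eqI)
  with elim(2) show ?case
    using smooth_quadratic_gap[OF d[rule_format] elim(2)]
    by (auto simp only: intro: lipschitz_on_nonneg lipschitz_on_normD)
qed

text \<open>The quadratic gap of each sample is integrated, with the mean of \<open>Lxi i\<close> as
  the constant. Unbiasedness then follows from the uniqueness of gradients.\<close>

lemma local_obj_GDERIV_integral: "GDERIV (local_obj D ff i) x :> (\<integral>s. G i x s \<partial>D i)"
proof (rule GDERIV_from_quadratic_gap)
  fix y
  have int: "integrable (D i) (\<lambda>s. ff i y s - ff i x s - inner (G i x s) (y - x))"
    by (intro Bochner_Integration.integrable_diff integrable_ff integrable_inner_left
        gradient_section_integrable)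
  have "local_obj D ff i y - local_obj D ff i x - inner (\<integral>s. G i x s \<partial>D i) (y - x) =
      (\<integral>s. ff i y s - ff i x s - inner (G i x s) (y - x) \<partial>D i)"
    unfolding local_obj_def
    by (simp add: integrable_ff gradient_section_integrable)
  also have "\<bar>\<dots>\<bar> \<le> (\<integral>s. \<bar>ff i y s - ff i x s - inner (G i x s) (y - x)\<bar> \<partial>D i)"
    by (rule integral_abs_bound)
  also have "\<dots> \<le> (\<integral>s. Lxi i s / 2 * (norm (y - x))\<^sup>2 \<partial>D i)"
  proof (rule integral_mono_AE)
    show "integrable (D i) (\<lambda>s. \<bar>ff i y s - ff i x s - inner (G i x s) (y - x)\<bar>)"
      using int by (rule integrable_abs)
    show "integrable (D i) (\<lambda>s. Lxi i s / 2 * (norm (y - x))\<^sup>2)"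
      using Lxi_integrable by simp
    show "AE s in D i. \<bar>ff i y s - ff i x s - inner (G i x s) (y - x)\<bar> \<le> Lxi i s / 2 * (norm (y - x))\<^sup>2"
      using sample_GDERIV[of i] by eventually_elim blast
  qed
  also have "\<dots> = (\<integral>s. Lxi i s \<partial>D i) / 2 * (norm (y - x))\<^sup>2" by simp
  finally show "\<bar>local_obj D ff i y - local_obj D ff i x - inner (\<integral>s. G i x s \<partial>D i) (y - x)\<bar>
      \<le> (\<integral>s. Lxi i s \<partial>D i) / 2 * (norm (y - x))\<^sup>2" .
qed

lemma unbiased: "(\<integral>s. G i x s \<partial>D i) = g i x"
  using gradient_eqI[OF local_obj_GDERIV_integral] by simp

lemma local_obj_GDERIV: "GDERIV (local_obj D ff i) x :> g i x"
  using local_obj_GDERIV_integral unbiased by simp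

lemma gradient_local_lipschitz: "(L i)-lipschitz_on UNIV (g i)"
proof (rule lipschitz_onI)
  fix x y
  have "g i x - g i y = (\<integral>s. G i x s - G i y s \<partial>D i)"
    unfolding unbiased[symmetric] by (simp add: gradient_section_integrable)
  also have "norm \<dots> \<le> (\<integral>s. norm (G i x s - G i y s) \<partial>D i)"
    by (rule integral_norm_bound)
  also have "\<dots> \<le> (\<integral>s. Lxi i s * norm (x - y) \<partial>D i)"
  proof (rule integral_mono_AE)
    show "integrable (D i) (\<lambda>s. norm (G i x s - G i y s))"
      by (intro integrable_norm Bochner_Integration.integrable_diff gradient_section_integrable)
    show "AE s in D i. norm (G i x s - G i y s) \<le> Lxi i s * norm (x - y)"
      using sample_GDERIV[of i] by eventually_elim blast
  qed (use Lxi_integrable in simp)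
  also have "\<dots> \<le> L i * norm (x - y)"
    using Lxi_mean[of i] by (simp add: mult_right_mono)
  finally show "dist (g i x) (g i y) \<le> L i * dist x y" by (simp add: dist_norm)
qed (rule L_nonneg)

text \<open>The nonnegative integral is the form in which the bound is inserted as the inner
  integral of Tonelli's theorem in \<open>expectation_sq_le\<close>.\<close>

lemma gradient_second_moment_nn:
  "(\<integral>\<^sup>+s. ennreal ((norm (G i x s - G i y s))\<^sup>2) \<partial>D i) \<le> ennreal ((L i)\<^sup>2 * (norm (x - y))\<^sup>2)"
proof -
  have "(\<integral>\<^sup>+s. ennreal ((norm (G i x s - G i y s))\<^sup>2) \<partial>D i)
      \<le> (\<integral>\<^sup>+s. ennreal ((Lxi i s)\<^sup>2 * (norm (x - y))\<^sup>2) \<partial>D i)"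
  proof (rule nn_integral_mono_AE)
    show "AE s in D i. ennreal ((norm (G i x s - G i y s))\<^sup>2) \<le> ennreal ((Lxi i s)\<^sup>2 * (norm (x - y))\<^sup>2)"
      using sample_GDERIV[of i]
      by eventually_elim (metis ennreal_leI norm_ge_zero power_mono power_mult_distrib)
  qed
  also have "\<dots> = ennreal (\<integral>s. (Lxi i s)\<^sup>2 * (norm (x - y))\<^sup>2 \<partial>D i)"
    by (rule nn_integral_eq_integral) (use Lxi_square_integrable in auto)
  also have "\<dots> \<le> ennreal ((L i)\<^sup>2 * (norm (x - y))\<^sup>2)"
  proof -
    have "(\<integral>s. (Lxi i s)\<^sup>2 \<partial>D i) \<le> (L i)\<^sup>2"
      using Lxi_bound[of i] by (rule sqrt_le_D)
    then show ?thesis by (intro ennreal_leI) (simp add: mult_right_mono)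
  qed
  finally show ?thesis .
qed

lemma variance_nn:
  "(\<integral>\<^sup>+s. ennreal ((norm (G i x s - g i x))\<^sup>2) \<partial>D i) \<le> ennreal ((sigma i)\<^sup>2)"
  using nn_integral_eq_integral[OF variance_integrable[of i x]] variance_bound[of i x]
  by (simp add: ennreal_leI)

lemma mu_le_L: "mu i \<le> L i"
  by (rule strongly_convex_smooth_le[OF strongly_convex local_obj_GDERIV gradient_local_lipschitz])

section \<open>Quadratic models of the global objective\<close>

definition "grad_global x = (1 / real CARD('n)) *\<^sub>R (\<Sum>i\<in>UNIV. g i x)"

lemma avg_model:
  "(\<Sum>i\<in>UNIV. a i + inner (g i y) h + m i / 2 * c) / real CARD('n)
    = avg a + inner (grad_global y) h + avg m / 2 * c"
proof -
  have "(\<Sum>i\<in>UNIV. m i / 2 * c) = (\<Sum>i\<in>UNIV. m i) / 2 * c"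
    by (simp only: sum_distrib_right sum_divide_distrib)
  then show ?thesis
    unfolding sum.distrib add_divide_distrib avg_def grad_global_def inner_scaleR_left inner_sum_left
    by (simp only:) simp
qed

lemma global_lower:
  "global_obj D ff y + inner (grad_global y) (z - y) + avg mu / 2 * (norm (z - y))\<^sup>2 \<le> global_obj D ff z"
proof -
  have "(\<Sum>i\<in>UNIV. local_obj D ff i y + inner (g i y) (z - y) + mu i / 2 * (norm (z - y))\<^sup>2)
      \<le> (\<Sum>i\<in>UNIV. local_obj D ff i z)"
    by (intro sum_mono strongly_convex_first_order strongly_convex local_obj_GDERIV)
  then have "(\<Sum>i\<in>UNIV. local_obj D ff i y + inner (g i y) (z - y) + mu i / 2 * (norm (z - y))\<^sup>2) / real CARD('n)
      \<le> (\<Sum>i\<in>UNIV. local_obj D ff i z) / real CARD('n)"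
    by (rule divide_right_mono) simp
  then show ?thesis
    unfolding avg_model by (simp add: global_obj_def avg_def)
qed

lemma global_upper:
  "global_obj D ff z \<le> global_obj D ff y + inner (grad_global y) (z - y) + avg L / 2 * (norm (z - y))\<^sup>2"
proof -
  have "(\<Sum>i\<in>UNIV. local_obj D ff i z)
    \<le> (\<Sum>i\<in>UNIV. local_obj D ff i y + inner (g i y) (z - y) + L i / 2 * (norm (z - y))\<^sup>2)"
    by (intro sum_mono smooth_upper_bound local_obj_GDERIV gradient_local_lipschitz)
  then have "(\<Sum>i\<in>UNIV. local_obj D ff i z) / real CARD('n)
    \<le> (\<Sum>i\<in>UNIV. local_obj D ff i y + inner (g i y) (z - y) + L i / 2 * (norm (z - y))\<^sup>2) / real CARD('n)"
    by (rule divide_right_mono) simp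
  then show ?thesis
    unfolding avg_model by (simp add: global_obj_def avg_def)
qed

lemma minimizer_le: "global_obj D ff xs \<le> global_obj D ff x"
  using minimizer by (simp add: is_arg_min_linorder)

lemma avg_mu_pos: "0 < avg mu"
  unfolding avg_def by (intro divide_pos_pos sum_pos) (auto simp: mu_pos)

lemma avg_mu_le_avg_L: "avg mu \<le> avg L"
  unfolding avg_def by (intro divide_right_mono sum_mono) (auto simp: mu_le_L)

lemma avg_L_le_Max: "avg L \<le> Max (range L)"
proof -
  have "(\<Sum>i\<in>UNIV. L i) \<le> (\<Sum>i\<in>(UNIV::'n set). Max (range L))"
    by (intro sum_mono) simp
  then show ?thesis by (simp add: avg_def divide_le_eq mult.commute)
qed

lemma Min_mu_le_Max_L: "Min (range mu) \<le> Max (range L)"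
proof -
  have "Min (range mu) \<le> mu undefined" "L undefined \<le> Max (range L)" by auto
  with mu_le_L[of undefined] show ?thesis by linarith
qed

lemma gradient_at_minimizer_le:
  "s \<in> space (D i) \<Longrightarrow> norm (G i xs s) \<le> M_xi D ff xs"
  unfolding M_xi_def
  by (rule order_trans[OF cSUP_upper[OF _ gradient_at_minimizer_bounded]]) auto

lemma M_xi_nonneg: "0 \<le> M_xi D ff xs"
proof -
  obtain s where "s \<in> space (D undefined)"
    using prob_space.not_empty[OF prob] by blast
  from gradient_at_minimizer_le[OF this] show ?thesis
    using norm_ge_zero order_trans by blast
qed

end

section \<open>The coefficients\<close>

text \<open>Completing the square gives the two roots \<open>(c + s) / (4 * L)\<close> and
  \<open>(c - s) / (4 * L)\<close>. The solution set is thus finite, and \<open>Max\<close> in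
  \<open>next_alpha\<close> really is the greater root.\<close>

lemma next_alpha_root:
  fixes m L A :: real
  assumes m: "0 < m" and L: "0 < L" and A: "0 \<le> A"
  shows "(A + next_alpha m L A) * (1 + A * m / 2) = 2 * L * (next_alpha m L A)\<^sup>2"
    and "0 < next_alpha m L A"
proof -
  define c where "c = 1 + A * m / 2"
  have c: "1 \<le> c" using m A by (simp add: c_def)
  define s where "s = sqrt (c\<^sup>2 + 8 * L * c * A)"
  have nonneg: "0 \<le> c\<^sup>2 + 8 * L * c * A" using c L A by simp
  then have s2: "s\<^sup>2 = c\<^sup>2 + 8 * L * c * A" by (simp add: s_def)
  have s0: "0 \<le> s" using nonneg by (simp add: s_def)
  define a1 where "a1 = (c + s) / (4 * L)"
  define a2 where "a2 = (c - s) / (4 * L)"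
  have fac: "(A + a) * c = 2 * L * a\<^sup>2 \<longleftrightarrow> a = a1 \<or> a = a2" for a
  proof -
    have "8 * L * (2 * L * a\<^sup>2 - (A + a) * c) = (4 * L * a - c)\<^sup>2 - s\<^sup>2"
      unfolding s2 by (simp add: power2_eq_square algebra_simps)
    also have "\<dots> = (4 * L * a - (c + s)) * (4 * L * a - (c - s))"
      by (simp add: power2_eq_square algebra_simps)
    finally have "(A + a) * c = 2 * L * a\<^sup>2 \<longleftrightarrow> (4 * L * a - (c + s)) * (4 * L * a - (c - s)) = 0"
      using L by (smt (verit, ccfv_threshold) mult_eq_0_iff)
    moreover have "4 * L * a - (c + s) = 0 \<longleftrightarrow> a = a1" "4 * L * a - (c - s) = 0 \<longleftrightarrow> a = a2"
      using L by (auto simp: a1_def a2_def field_simps)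
    ultimately show ?thesis by simp
  qed
  have "{a. (A + a) * (1 + A * m / 2) = 2 * L * a\<^sup>2} = {a1, a2}"
    using fac by (auto simp: c_def)
  moreover have "a2 \<le> a1" using s0 L by (simp add: a1_def a2_def divide_right_mono)
  ultimately have eq: "next_alpha m L A = a1" by (simp add: next_alpha_def max_def)
  show "(A + next_alpha m L A) * (1 + A * m / 2) = 2 * L * (next_alpha m L A)\<^sup>2"
    using fac[of a1] unfolding eq c_def by blast
  show "0 < next_alpha m L A" unfolding eq a1_def using c s0 L by simp
qed

locale agd_coefficients =
  fixes m L :: real
  assumes m_pos: "0 < m" and m_le_L: "m \<le> L"
begin

abbreviation "A \<equiv> coeff_A m L"
definition "\<alpha> k = next_alpha m L (A k)"
definition "q = sqrt (m / L)"

lemma L_pos: "0 < L" using m_pos m_le_L by simp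

lemma q_pos: "0 < q" and q_le_1: "q \<le> 1" and q_sq: "q\<^sup>2 = m / L"
  using m_pos m_le_L L_pos by (auto simp: q_def)

lemma A_Suc: "A (Suc k) = A k + \<alpha> k" by (simp add: \<alpha>_def)

declare coeff_A.simps(2) [simp del]

lemma A_nonneg: "0 \<le> A k"
proof (induction k)
  case (Suc k)
  then show ?case using next_alpha_root(2)[OF m_pos L_pos Suc] by (simp add: A_Suc \<alpha>_def)
qed simp

lemma \<alpha>_pos: "0 < \<alpha> k"
  unfolding \<alpha>_def by (rule next_alpha_root(2)[OF m_pos L_pos A_nonneg])

lemma \<alpha>_eq: "A (Suc k) * (1 + A k * m / 2) = 2 * L * (\<alpha> k)\<^sup>2"
  using next_alpha_root(1)[OF m_pos L_pos A_nonneg[of k]] by (simp add: A_Suc \<alpha>_def)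

lemma A_Suc_pos: "0 < A (Suc k)" using A_nonneg[of k] \<alpha>_pos[of k] by (simp add: A_Suc)

lemma A_le_Suc: "A k \<le> A (Suc k)" using \<alpha>_pos[of k] by (simp add: A_Suc)

section \<open>Growth of the weights\<close>

lemma A_1: "A (Suc 0) = 1 / (2 * L)"
proof -
  have "\<alpha> 0 = 2 * L * (\<alpha> 0)\<^sup>2" using \<alpha>_eq[of 0] by (simp add: A_Suc)
  then show ?thesis using \<alpha>_pos[of 0] L_pos by (simp add: A_Suc power2_eq_square field_simps)
qed

lemma \<alpha>_mono: "\<alpha> k \<le> \<alpha> (Suc k)"
proof -
  have "1 + A k * m / 2 \<le> 1 + A (Suc k) * m / 2"
    using mult_right_mono[OF A_le_Suc[of k], of m] m_pos by simp
  moreover have "0 \<le> 1 + A k * m / 2" using A_nonneg[of k] m_pos by simp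
  ultimately have "A (Suc k) * (1 + A k * m / 2) \<le> A (Suc (Suc k)) * (1 + A (Suc k) * m / 2)"
    by (intro mult_mono[OF A_le_Suc]) (auto simp: A_nonneg)
  then have "(\<alpha> k)\<^sup>2 \<le> (\<alpha> (Suc k))\<^sup>2" unfolding \<alpha>_eq using L_pos by simp
  then show ?thesis by (rule power2_le_imp_le) (use \<alpha>_pos[of "Suc k"] in simp)
qed

lemma A_le_steps: "A k \<le> real k * \<alpha> k"
proof (induction k)
  case (Suc k)
  have "A (Suc k) \<le> real (Suc k) * \<alpha> k" using Suc by (simp add: A_Suc algebra_simps)
  also have "\<dots> \<le> real (Suc k) * \<alpha> (Suc k)" using \<alpha>_mono by (intro mult_left_mono) auto
  finally show ?case .
qed simp

text \<open>Nondecreasing increments make the weights convex in the index, and they start at 0, so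
  their average is at most half of the last one. Unlike \<open>sum_A_le_ratio\<close> this has no
  factor \<open>1 / q\<close>, which matters in \<open>distance_budget\<close>.\<close>

lemma sum_A_le_half: "(\<Sum>i\<le>k. A i) \<le> (real k + 1) / 2 * A k"
proof (induction k)
  case (Suc k)
  have "(real k + 1) / 2 * A k + A (Suc k) \<le> (real (Suc k) + 1) / 2 * A (Suc k)"
    using A_le_steps[of k] by (simp add: A_Suc algebra_simps)
  with Suc show ?case by simp
qed simp

text \<open>In the step equation, lower \<open>A (Suc k)\<close> to \<open>A k\<close> and drop the
  summand 1: what remains is \<open>(q / 2 * A k)^2\<close> times \<open>2 * L\<close>.\<close>

lemma \<alpha>_ge: "q / 2 * A k \<le> \<alpha> k"
proof (rule ccontr)
  assume "\<not> ?thesis"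
  then have "(\<alpha> k)\<^sup>2 < (q / 2 * A k)\<^sup>2"
    using \<alpha>_pos[of k] by (intro power_strict_mono) auto
  then have "2 * L * (\<alpha> k)\<^sup>2 < 2 * L * (q\<^sup>2 / 4 * (A k)\<^sup>2)"
    using L_pos by (simp add: power_mult_distrib power_divide)
  also have "\<dots> = A k * (A k * m / 2)"
    using L_pos unfolding q_sq by (simp add: power2_eq_square)
  also have "\<dots> \<le> A (Suc k) * (1 + A k * m / 2)"
    using A_nonneg[of k] A_le_Suc[of k] m_pos by (intro mult_mono) auto
  finally show False using \<alpha>_eq[of k] by simp
qed

lemma A_growth: "(1 + q / 2) * A k \<le> A (Suc k)"
  using \<alpha>_ge[of k] by (simp add: A_Suc algebra_simps)

lemma sum_A_le_ratio: "(\<Sum>i\<le>k. A i) \<le> (1 + 2 / q) * A k"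
proof (induction k)
  case (Suc k)
  have "(1 + 2 / q) * A k \<le> 2 / q * A (Suc k)"
    using \<alpha>_ge[of k] q_pos by (simp add: A_Suc field_simps)
  with Suc show ?case by (simp add: algebra_simps)
qed simp

text \<open>Geometric growth from \<open>A 1 = 1 / (2 * L)\<close> would be too weak for
  \<open>final_error\<close>. Even for tiny \<open>q\<close> the second step multiplies the weight
  by 5/2.\<close>

lemma A_2: "5 / (4 * L) \<le> A (Suc (Suc 0))"
proof -
  define x where "x = L * \<alpha> (Suc 0)"
  have x: "0 < x" using L_pos \<alpha>_pos by (simp add: x_def)
  have "A (Suc (Suc 0)) * 1 \<le> 2 * L * (\<alpha> (Suc 0))\<^sup>2"
    unfolding \<alpha>_eq[symmetric] using A_nonneg m_pos A_Suc_pos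
    by (intro mult_left_mono) (auto simp: less_imp_le)
  then have "L * A (Suc (Suc 0)) \<le> L * (2 * L * (\<alpha> (Suc 0))\<^sup>2)"
    using L_pos by simp
  \<comment> \<open>The positive root of \<open>2 * x^2 = x + 1 / 2\<close> is (1 + sqrt 5) / 4,
    slightly above 3/4.\<close>
  then have quad: "1 / 2 + x \<le> 2 * x\<^sup>2"
    unfolding A_Suc[of "Suc 0"] A_1 x_def using L_pos
    by (simp add: algebra_simps power2_eq_square)
  have "3 / 4 \<le> x"
  proof (rule ccontr)
    assume "\<not> ?thesis"
    then have "x * x \<le> 3 / 4 * x" using x by (intro mult_right_mono) auto
    with quad \<open>\<not> ?thesis\<close> show False by (simp add: power2_eq_square)
  qed
  then show ?thesis unfolding A_Suc[of "Suc 0"] A_1 x_def using L_pos by (simp add: field_simps)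
qed

lemma A_lower: "5 / (4 * L) * (1 + q / 2) ^ k \<le> A (Suc (Suc k))"
proof (induction k)
  case 0
  then show ?case using A_2 by simp
next
  case (Suc k)
  have "5 / (4 * L) * (1 + q / 2) ^ Suc k = (1 + q / 2) * (5 / (4 * L) * (1 + q / 2) ^ k)" by simp
  also have "\<dots> \<le> (1 + q / 2) * A (Suc (Suc k))"
    using Suc q_pos by (intro mult_left_mono) auto
  also have "\<dots> \<le> A (Suc (Suc (Suc k)))" by (rule A_growth)
  finally show ?case .
qed

section \<open>Weights of the distance term and the effective step size\<close>

definition "c k = 1 + A k * m / 2"

lemma c_ge_1: "1 \<le> c k" and c_pos: "0 < c k"
  using A_nonneg[of k] m_pos by (auto simp: c_def add_pos_nonneg)

lemma c_Suc: "c (Suc k) = c k + \<alpha> k * m / 2"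
  by (simp add: c_def A_Suc algebra_simps add_divide_distrib)

lemma c_le_Suc: "c k \<le> c (Suc k)"
  using \<alpha>_pos[of k] m_pos by (simp add: c_Suc)

lemma \<alpha>_c: "A (Suc k) * c k = 2 * L * (\<alpha> k)\<^sup>2"
  using \<alpha>_eq by (simp add: c_def)

lemma A_div_c: "A k / c k \<le> 2 / m"
  using m_pos c_pos[of k] A_nonneg[of k] by (simp add: c_def field_simps)

text \<open>The quotient is the factor in front of the oracle in the update of \<open>v\<close>. Its
  bound is the source of \<open>1 / sqrt (L_g * mu_g)\<close> in the terms of
  \<open>sqrt_D\<close>.\<close>

lemma step_le: "\<alpha> k / c (Suc k) \<le> 1 / sqrt (L * m)"
proof (rule power2_le_imp_le)
  have "(\<alpha> k)\<^sup>2 = A (Suc k) * c k / (2 * L)" using \<alpha>_c[of k] L_pos by simp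
  also have "\<dots> \<le> A (Suc k) * c (Suc k) / (2 * L)"
    using c_le_Suc A_nonneg L_pos by (intro divide_right_mono mult_left_mono) auto
  finally have "(\<alpha> k)\<^sup>2 / (c (Suc k))\<^sup>2 \<le> A (Suc k) * c (Suc k) / (2 * L) / (c (Suc k))\<^sup>2"
    by (rule divide_right_mono) simp
  also have "\<dots> = A (Suc k) / c (Suc k) / (2 * L)"
    using c_pos[of "Suc k"] by (simp add: power2_eq_square)
  also have "\<dots> \<le> (2 / m) / (2 * L)"
    using A_div_c L_pos by (intro divide_right_mono) auto
  also have "\<dots> = (1 / sqrt (L * m))\<^sup>2"
    using L_pos m_pos by (simp add: power_divide mult.commute)
  finally show "(\<alpha> k / c (Suc k))\<^sup>2 \<le> (1 / sqrt (L * m))\<^sup>2"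
    by (simp add: power_divide)
qed (use L_pos m_pos in simp)

subsection \<open>One step\<close>

text \<open>The lower models at \<open>x\<close> and at \<open>xs\<close> are weighted with
  \<open>A k\<close> and \<open>\<alpha> k\<close>. The proximal form of \<open>u0\<close>
  contributes \<open>c k / 2\<close> times the squared length of \<open>u0 - u\<close>, and by the
  step equation this equals \<open>A (Suc k) * L\<close> times that of \<open>d\<close>. The model
  at \<open>xs\<close> has \<open>m / 4\<close> instead of \<open>m / 2\<close> because
  \<open>global_lower_inexact\<close> spends the rest on the gradient error.\<close>

lemma noiseless_step:
  fixes u x y g xs u0 :: "'a::real_inner"
  assumes y: "y = (1 / A (Suc k)) *\<^sub>R (\<alpha> k *\<^sub>R u + A k *\<^sub>R x)"
    and u0: "u0 = (1 / c (Suc k)) *\<^sub>R ((\<alpha> k * m / 2) *\<^sub>R y + c k *\<^sub>R u - \<alpha> k *\<^sub>R g)"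
    and d: "d = (\<alpha> k / A (Suc k)) *\<^sub>R (u0 - u)"
    and fx: "fy + inner g (x - y) - \<delta>\<^sub>2 \<le> fx"
    and fs: "fy + inner g (xs - y) + m / 4 * (norm (xs - y))\<^sup>2 - \<delta>\<^sub>2 \<le> fs"
  shows "A (Suc k) * (fy + inner g d + L * (norm d)\<^sup>2) + c (Suc k) / 2 * (norm (u0 - xs))\<^sup>2
    \<le> A k * fx + \<alpha> k * fs + c k / 2 * (norm (u - xs))\<^sup>2 + A (Suc k) * \<delta>\<^sub>2"
proof -
  define a B B' C C' where "a = \<alpha> k" and "B = A k" and "B' = A (Suc k)" and "C = c k" and "C' = c (Suc k)"
  note abbr = a_def[symmetric] B_def[symmetric] B'_def[symmetric] C_def[symmetric] C'_def[symmetric]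
  have pos: "0 < a" "0 \<le> B" "0 < B'" "0 < C" "0 < C'"
    unfolding a_def B_def B'_def C_def C'_def using \<alpha>_pos A_nonneg A_Suc_pos c_pos by auto
  have BB: "B' = B + a" and CC: "C' = C + a * m / 2" and BC: "B' * C = 2 * L * a\<^sup>2"
    unfolding a_def B_def B'_def C_def C'_def using A_Suc c_Suc \<alpha>_c by auto
  have By: "B' *\<^sub>R y = a *\<^sub>R u + B *\<^sub>R x"
    unfolding y abbr using pos by simp
  have Bd: "B' *\<^sub>R d = a *\<^sub>R (u0 - u)"
    unfolding d abbr using pos by simp
  also have "\<dots> = a *\<^sub>R (u0 - y) + B *\<^sub>R (x - y)"
    using By unfolding BB by (simp add: algebra_simps)
  finally have "inner g (B' *\<^sub>R d) = inner g (a *\<^sub>R (u0 - y) + B *\<^sub>R (x - y))" by simp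
  then have gd: "B' * inner g d = a * inner g (u0 - y) + B * inner g (x - y)"
    by (simp add: inner_add_right)
  have "B' * (L * (norm d)\<^sup>2) = C / 2 * (norm (u0 - u))\<^sup>2"
  proof -
    have "(norm d)\<^sup>2 = a\<^sup>2 / B'\<^sup>2 * (norm (u0 - u))\<^sup>2"
      unfolding d abbr by (simp add: power_mult_distrib power_divide)
    moreover have "B' * L * (a\<^sup>2 / B'\<^sup>2) = C / 2"
      using BC pos by (simp add: power2_eq_square field_simps)
    moreover have "B' * (L * (w * z)) = (B' * L * w) * z" for w z by (simp only: mult_ac)
    ultimately show ?thesis by (simp only:)
  qed
  note nd = this
  have "C' *\<^sub>R u0 = (a * m / 2) *\<^sub>R y + C *\<^sub>R u - a *\<^sub>R g"
    unfolding u0 abbr using pos by simp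
  then have ag: "a *\<^sub>R g = (a * m / 2) *\<^sub>R (y - u0) + C *\<^sub>R (u - u0)"
    unfolding CC by (simp add: algebra_simps)
  \<comment> \<open>The three-point identity, applied below with \<open>p = y\<close> and
    \<open>p = u\<close>.\<close>
  have polar: "2 * inner (p - u0) (u0 - xs) = (norm (p - xs))\<^sup>2 - (norm (p - u0))\<^sup>2 - (norm (u0 - xs))\<^sup>2" for p
    by (simp add: power2_norm_eq_inner inner_diff_left inner_diff_right inner_commute)
  have "a * inner g (u0 - xs) = inner (a *\<^sub>R g) (u0 - xs)" by simp
  also have "\<dots> = a * m / 4 * (2 * inner (y - u0) (u0 - xs)) + C / 2 * (2 * inner (u - u0) (u0 - xs))"
    unfolding ag by (simp add: inner_add_left)
  finally have prox: "a * inner g (u0 - xs) =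
      a * m / 4 * ((norm (y - xs))\<^sup>2 - (norm (y - u0))\<^sup>2 - (norm (u0 - xs))\<^sup>2)
      + C / 2 * ((norm (u - xs))\<^sup>2 - (norm (u - u0))\<^sup>2 - (norm (u0 - xs))\<^sup>2)"
    unfolding polar .
  have split: "inner g (u0 - y) = inner g (u0 - xs) + inner g (xs - y)"
    by (simp add: inner_diff_right)
  have 1: "B * (fy + inner g (x - y) - \<delta>\<^sub>2) \<le> B * fx"
    using fx pos by (intro mult_left_mono) auto
  have 2: "a * (fy + inner g (xs - y) + m / 4 * (norm (xs - y))\<^sup>2 - \<delta>\<^sub>2) \<le> a * fs"
    using fs pos by (intro mult_left_mono) auto
  have 3: "0 \<le> a * m / 4 * (norm (y - u0))\<^sup>2" using pos m_pos by simp
  have "B' * (fy + inner g d + L * (norm d)\<^sup>2) + C' / 2 * (norm (u0 - xs))\<^sup>2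
      = B' * fy + B * inner g (x - y) + a * inner g (xs - y) + a * inner g (u0 - xs)
        + C / 2 * (norm (u0 - u))\<^sup>2 + C' / 2 * (norm (u0 - xs))\<^sup>2"
    using gd nd by (simp add: split distrib_left)
  also have "\<dots> = B * (fy + inner g (x - y)) + a * (fy + inner g (xs - y) + m / 4 * (norm (xs - y))\<^sup>2)
      + C / 2 * (norm (u - xs))\<^sup>2 - a * m / 4 * (norm (y - u0))\<^sup>2"
    unfolding prox BB CC norm_minus_commute[of u0 u] norm_minus_commute[of xs y]
    by (simp add: algebra_simps add_divide_distrib diff_divide_distrib)
  also have "\<dots> \<le> B * fx + a * fs + C / 2 * (norm (u - xs))\<^sup>2 + B' * \<delta>\<^sub>2"
    using 1 2 3 unfolding BB by (simp add: algebra_simps)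
  finally show ?thesis by (simp add: abbr)
qed

text \<open>The coefficient of the noise in the first-order terms of the new potential. It is built
  from quantities fixed before the samples of the step are drawn, so its inner product with the
  noise has mean zero.\<close>

definition "noise_dir k u0 d g e xs =
  - ((\<alpha> k)\<^sup>2 / c (Suc k)) *\<^sub>R (g + e + L *\<^sub>R d) - \<alpha> k *\<^sub>R (u0 - xs)"

text \<open>The noise acts through \<open>u' = u0 - (\<alpha> / c) \<eta>\<close>.  Its linear part has zero expectation; half of
  the curvature reserved for \<open>d\<close> absorbs the consensus error \<open>e\<close> of the gradient.\<close>

lemma noisy_step:
  fixes u x y g xs u0 u' x' \<eta> e :: "'a::real_inner"
  assumes y: "y = (1 / A (Suc k)) *\<^sub>R (\<alpha> k *\<^sub>R u + A k *\<^sub>R x)"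
    and u0: "u0 = (1 / c (Suc k)) *\<^sub>R ((\<alpha> k * m / 2) *\<^sub>R y + c k *\<^sub>R u - \<alpha> k *\<^sub>R g)"
    and d: "d = (\<alpha> k / A (Suc k)) *\<^sub>R (u0 - u)"
    and u': "u' = (1 / c (Suc k)) *\<^sub>R ((\<alpha> k * m / 2) *\<^sub>R y + c k *\<^sub>R u - \<alpha> k *\<^sub>R (g + \<eta>))"
    and x': "x' = (1 / A (Suc k)) *\<^sub>R (\<alpha> k *\<^sub>R u' + A k *\<^sub>R x)"
    and fx: "fy + inner g (x - y) - \<delta>\<^sub>2 \<le> fx"
    and fs: "fy + inner g (xs - y) + m / 4 * (norm (xs - y))\<^sup>2 - \<delta>\<^sub>2 \<le> fs"
    and fx': "fx' \<le> fy + inner (g + e) (x' - y) + L / 2 * (norm (x' - y))\<^sup>2"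
    and e: "(norm e)\<^sup>2 / (2 * L) \<le> \<delta>\<^sub>1"
  shows "A (Suc k) * (fx' - fs) + c (Suc k) / 2 * (norm (u' - xs))\<^sup>2
    \<le> A k * (fx - fs) + c k / 2 * (norm (u - xs))\<^sup>2 + A (Suc k) * (\<delta>\<^sub>1 + \<delta>\<^sub>2)
      + inner \<eta> (noise_dir k u0 d g e xs) + 3 * A (Suc k) / (8 * L) * (norm \<eta>)\<^sup>2"
proof -
  define a B B' C C' where "a = \<alpha> k" and "B = A k" and "B' = A (Suc k)" and "C = c k" and "C' = c (Suc k)"
  note abbr = a_def[symmetric] B_def[symmetric] B'_def[symmetric] C_def[symmetric] C'_def[symmetric]
  have pos: "0 < a" "0 \<le> B" "0 < B'" "0 < C" "0 < C'"
    unfolding a_def B_def B'_def C_def C'_def using \<alpha>_pos A_nonneg A_Suc_pos c_pos by auto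
  have BB: "B' = B + a" and BC: "B' * C = 2 * L * a\<^sup>2" and CC: "C \<le> C'"
    unfolding a_def B_def B'_def C_def C'_def using A_Suc c_le_Suc \<alpha>_c by auto
  define b where "b = a / C'"
  define \<gamma> where "\<gamma> = a * b / B'"
  have b0: "0 < b" using pos by (simp add: b_def)
  have u'u0: "u' = u0 - b *\<^sub>R \<eta>"
    unfolding u' u0 abbr b_def by (simp add: scaleR_add_right scaleR_diff_right)
  have x'y: "x' - y = d - \<gamma> *\<^sub>R \<eta>"
    unfolding x' y u'u0 d abbr \<gamma>_def using pos by (simp add: algebra_simps)
  have det: "B' * (fy + inner g d + L * (norm d)\<^sup>2) + C' / 2 * (norm (u0 - xs))\<^sup>2
    \<le> B * fx + a * fs + C / 2 * (norm (u - xs))\<^sup>2 + B' * \<delta>\<^sub>2"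
    using noiseless_step[OF y u0 d fx fs] by (simp add: abbr)
  have young: "inner e d \<le> \<delta>\<^sub>1 + L / 2 * (norm d)\<^sup>2"
  proof -
    have "0 \<le> (norm (e - L *\<^sub>R d))\<^sup>2" by simp
    also have "\<dots> = (norm e)\<^sup>2 - 2 * L * inner e d + L\<^sup>2 * (norm d)\<^sup>2"
      unfolding power2_norm_eq_inner
      by (simp add: inner_diff_left inner_diff_right inner_commute power2_eq_square)
    finally have "2 * L * inner e d \<le> (norm e)\<^sup>2 + L\<^sup>2 * (norm d)\<^sup>2" by simp
    then have "inner e d \<le> (norm e)\<^sup>2 / (2 * L) + L / 2 * (norm d)\<^sup>2"
      using L_pos by (simp add: field_simps power2_eq_square)
    with e show ?thesis by simp
  qed
  have n1: "(norm (u' - xs))\<^sup>2 = (norm (u0 - xs))\<^sup>2 - 2 * b * inner \<eta> (u0 - xs) + b\<^sup>2 * (norm \<eta>)\<^sup>2"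
    unfolding u'u0 power2_norm_eq_inner
    by (simp add: inner_diff_left inner_diff_right inner_commute power2_eq_square algebra_simps)
  have n2: "(norm (d - \<gamma> *\<^sub>R \<eta>))\<^sup>2 = (norm d)\<^sup>2 - 2 * \<gamma> * inner \<eta> d + \<gamma>\<^sup>2 * (norm \<eta>)\<^sup>2"
    unfolding power2_norm_eq_inner
    by (simp add: inner_diff_left inner_diff_right inner_commute power2_eq_square algebra_simps)
  have B\<gamma>: "B' * \<gamma> = a * b" and Cb: "C' * b = a" and ab: "a * b = a\<^sup>2 / C'"
    using pos by (auto simp: \<gamma>_def b_def power2_eq_square)
  \<comment> \<open>The first summand is at most \<open>a * b / 4\<close>, the second equals
    \<open>a * b / 2\<close>, and \<open>a * b\<close> is at most \<open>B' / (2 * L)\<close>; 3/4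
    of the latter is the constant 3/8.\<close>
  have quad: "B' * (L / 2) * \<gamma>\<^sup>2 + C' / 2 * b\<^sup>2 \<le> 3 * B' / (8 * L)"
  proof -
    have "B' * (L / 2) * \<gamma>\<^sup>2 = L / 2 * (a * b) * \<gamma>"
      using B\<gamma> by (simp add: power2_eq_square mult_ac)
    also have "\<dots> = (a * b) * (L * a\<^sup>2 / (2 * B' * C'))"
      unfolding \<gamma>_def ab by (simp add: power2_eq_square mult_ac)
    also have "L * a\<^sup>2 / (2 * B' * C') = C / C' / 4"
      using BC pos by (simp add: field_simps)
    also have "(a * b) * (C / C' / 4) \<le> (a * b) * (1 / 4)"
      using CC pos b0 by (intro mult_left_mono) auto
    finally have 1: "B' * (L / 2) * \<gamma>\<^sup>2 \<le> (a * b) / 4" by simp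
    have "C' / 2 * b\<^sup>2 = (C' * b) * b / 2" by (simp add: power2_eq_square)
    then have 2: "C' / 2 * b\<^sup>2 = (a * b) / 2" unfolding Cb by simp
    have "a * b = B' * (C / C') / (2 * L)"
      unfolding ab using BC L_pos pos by (simp add: field_simps)
    also have "\<dots> \<le> B' * 1 / (2 * L)"
      using CC pos L_pos by (intro divide_right_mono mult_left_mono) auto
    finally have "a * b \<le> B' / (2 * L)" by simp
    then show ?thesis using 1 2 by simp
  qed
  have dir: "inner \<eta> (noise_dir k u0 d g e xs)
      = - (a * b) * (inner \<eta> g + inner \<eta> e + L * inner \<eta> d) - a * inner \<eta> (u0 - xs)"
    unfolding noise_dir_def abbr ab by (simp add: inner_diff_right inner_add_right algebra_simps)
  have "B' * fx' \<le> B' * (fy + inner (g + e) (d - \<gamma> *\<^sub>R \<eta>) + L / 2 * (norm (d - \<gamma> *\<^sub>R \<eta>))\<^sup>2)"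
    using fx' pos unfolding x'y by (intro mult_left_mono) auto
  also have "\<dots> = B' * (fy + inner g d + L / 2 * (norm d)\<^sup>2) + B' * inner e d
      - (B' * \<gamma>) * (inner \<eta> g + inner \<eta> e + L * inner \<eta> d) + B' * (L / 2) * \<gamma>\<^sup>2 * (norm \<eta>)\<^sup>2"
    unfolding n2 by (simp add: inner_diff_right inner_add_left inner_commute algebra_simps)
  also have "\<dots> \<le> B' * (fy + inner g d + L * (norm d)\<^sup>2) + B' * \<delta>\<^sub>1
      - (a * b) * (inner \<eta> g + inner \<eta> e + L * inner \<eta> d) + B' * (L / 2) * \<gamma>\<^sup>2 * (norm \<eta>)\<^sup>2"
    using mult_left_mono[OF young, of B'] pos unfolding B\<gamma> by (simp add: algebra_simps)
  finally have up: "B' * fx' \<le> \<dots>" .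
  have vu: "C' / 2 * (norm (u' - xs))\<^sup>2 =
      C' / 2 * (norm (u0 - xs))\<^sup>2 - a * inner \<eta> (u0 - xs) + C' / 2 * b\<^sup>2 * (norm \<eta>)\<^sup>2"
  proof -
    have "C' / 2 * (P - 2 * b * I + b\<^sup>2 * K) = C' / 2 * P - (C' * b) * I + C' / 2 * b\<^sup>2 * K" for P I K
      by (simp add: algebra_simps)
    then show ?thesis unfolding n1 Cb .
  qed
  have "(B' * (L / 2) * \<gamma>\<^sup>2 + C' / 2 * b\<^sup>2) * (norm \<eta>)\<^sup>2 \<le> 3 * B' / (8 * L) * (norm \<eta>)\<^sup>2"
    using quad by (rule mult_right_mono) simp
  then have "B' * fx' + C' / 2 * (norm (u' - xs))\<^sup>2
    \<le> B * fx + a * fs + C / 2 * (norm (u - xs))\<^sup>2 + B' * \<delta>\<^sub>2 + B' * \<delta>\<^sub>1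
      + inner \<eta> (noise_dir k u0 d g e xs) + 3 * B' / (8 * L) * (norm \<eta>)\<^sup>2"
    using up det unfolding vu dir by (simp add: algebra_simps)
  then show ?thesis unfolding abbr BB by (simp add: algebra_simps)
qed

subsection \<open>Numerical estimates\<close>

text \<open>Here \<open>b\<close> is the real-valued iteration number and \<open>N\<close> may be
  its rounding down, so up to one step is lost. The cases \<open>N = 1\<close> and
  \<open>N \<ge> 2\<close> are separate because the good lower bound on the weights starts at the
  second one.\<close>

lemma final_error:
  assumes N: "0 < N" "b < real N + 1" and \<epsilon>: "0 < \<epsilon>"
    and R: "4 * L * R / \<epsilon> = exp (b * q / 3)"
    and V: "A N * e \<le> R / 2 + 15 / 64 * \<epsilon> * q * (\<Sum>i\<le>N. A i)"
  shows "e \<le> \<epsilon>"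
proof -
  have R': "R = \<epsilon> / (4 * L) * exp (b * q / 3)"
    using R \<epsilon> L_pos by (simp add: field_simps)
  have AN: "0 < A N" using N A_Suc_pos[of "N - 1"] by simp
  have bq: "b * q / 3 \<le> (real N + 1) * q / 3"
    using N q_pos by (intro divide_right_mono mult_right_mono) auto
  have e1: "exp (1::real) < 272 / 100" using e_less_272 by simp
  consider "N = Suc 0" | k where "N = Suc (Suc k)"
    using N(1) by (metis gr0_conv_Suc not0_implies_Suc)
  then have "R / 2 + 15 / 64 * \<epsilon> * q * (\<Sum>i\<le>N. A i) \<le> \<epsilon> * A N"
  proof cases
    \<comment> \<open>The sum of the weights is the single weight \<open>A N\<close>, so the errors
      take only 15/64 of \<open>\<epsilon>\<close>; the cruder share 1/2 for \<open>R / 2\<close> is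
      affordable.\<close>
    case 1
    have "exp (2 / 3 :: real) ^ 3 = exp 1 ^ 2" by (simp add: exp_of_nat_mult[symmetric])
    also have "\<dots> \<le> 2 ^ 3"
      using e1 power_mono[of "exp (1::real)" "272 / 100" 2] by (simp add: power2_eq_square)
    finally have "exp (2 / 3 :: real) \<le> 2" by (rule power_le_imp_le_base[where n = 2, simplified]) simp
    moreover have "exp (b * q / 3) \<le> exp (2 / 3)"
    proof -
      have "(real N + 1) * q / 3 \<le> 2 / 3" unfolding 1 using q_le_1 by simp
      with bq show ?thesis by simp
    qed
    ultimately have "exp (b * q / 3) \<le> 2" by (rule order_trans[rotated])
    then have "R \<le> \<epsilon> / (4 * L) * 2"
      unfolding R' by (rule mult_left_mono) (use \<epsilon> L_pos in simp)
    then have "R / 2 \<le> 1 / 2 * (\<epsilon> * A N)" unfolding 1 A_1 by simp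
    moreover have "15 / 64 * \<epsilon> * q * (\<Sum>i\<le>N. A i) \<le> 15 / 64 * \<epsilon> * 1 * A N"
    proof -
      have "(\<Sum>i\<le>N. A i) = A N" unfolding 1 by simp
      then show ?thesis using q_le_1 q_pos \<epsilon> AN by (intro mult_mono) auto
    qed
    moreover have "0 \<le> \<epsilon> * A N" using \<epsilon> AN by simp
    ultimately show ?thesis by linarith
  next
    case (2 k)
    have "exp (q / 3) \<le> 1 + q / 3 + (q / 3)\<^sup>2"
      by (rule exp_bound) (use q_pos q_le_1 in auto)
    also have "(q / 3)\<^sup>2 \<le> q / 6"
      using mult_right_mono[OF q_le_1, of q] q_pos by (simp add: power2_eq_square)
    \<comment> \<open>This is the origin of the factor 3 in the iteration number: a growth rate of
      \<open>1 + q / 2\<close> per step beats \<open>exp (q / 3)\<close>.\<close>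
    finally have g: "exp (q / 3) \<le> 1 + q / 2" by simp
    have "exp (b * q / 3) \<le> exp (q + real k * (q / 3))"
      using bq unfolding 2 by (simp add: algebra_simps add_divide_distrib)
    also have "\<dots> = exp q * exp (q / 3) ^ k"
      by (simp only: exp_add exp_of_nat_mult)
    also have "\<dots> \<le> (272 / 100) * (1 + q / 2) ^ k"
    proof (intro mult_mono power_mono g)
      have "exp q \<le> exp 1" using q_le_1 by simp
      with e1 show "exp q \<le> 272 / 100" by linarith
    qed auto
    finally have ex: "exp (b * q / 3) \<le> (272 / 100) * (1 + q / 2) ^ k" .
    have "R / 2 \<le> \<epsilon> / (8 * L) * ((272 / 100) * (1 + q / 2) ^ k)"
      unfolding R' using mult_left_mono[OF ex, of "\<epsilon> / (8 * L)"] \<epsilon> L_pos by simp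
    also have "\<dots> = \<epsilon> * (272 / 1000) * (5 / (4 * L) * (1 + q / 2) ^ k)" by simp
    also have "\<dots> \<le> \<epsilon> * (272 / 1000) * A N"
      unfolding 2 using A_lower[of k] \<epsilon> by (intro mult_left_mono) auto
    finally have 3: "R / 2 \<le> \<epsilon> * (272 / 1000) * A N" .
    have "15 / 64 * \<epsilon> * q * (\<Sum>i\<le>N. A i) \<le> 15 / 64 * \<epsilon> * q * ((1 + 2 / q) * A N)"
      using sum_A_le_ratio[of N] \<epsilon> q_pos by (intro mult_left_mono) auto
    also have "\<dots> = 15 / 64 * \<epsilon> * A N * (q + 2)" using q_pos by (simp add: field_simps)
    also have "\<dots> \<le> 15 / 64 * \<epsilon> * A N * 3"
      using q_le_1 \<epsilon> AN by (intro mult_left_mono) auto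
    \<comment> \<open>The shares are 0.272 and 0.703, so the sum is just below 1.\<close>
    finally have "R / 2 + 15 / 64 * \<epsilon> * q * (\<Sum>i\<le>N. A i) \<le> (272 / 1000 + 45 / 64) * (\<epsilon> * A N)"
      using 3 by (simp add: algebra_simps)
    also have "\<dots> \<le> 1 * (\<epsilon> * A N)" using \<epsilon> AN by (intro mult_right_mono) auto
    finally show ?thesis by simp
  qed
  with V have "A N * e \<le> A N * \<epsilon>" by (simp add: mult.commute)
  then show ?thesis using AN by simp
qed

text \<open>The accumulated error grows linearly in \<open>N * q\<close>, which the hypothesis
  bounds by a logarithm of \<open>L * R / \<epsilon>\<close>. Replacing the logarithm by its
  argument cancels \<open>\<epsilon>\<close> and leaves a multiple of \<open>R\<close> independent
  of \<open>k\<close> and \<open>N\<close>.\<close>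

lemma distance_budget:
  assumes k: "k < N" and \<epsilon>: "0 < \<epsilon>" and R: "exp (real N * q / 3) \<le> 4 * L * R / \<epsilon>"
    and V: "c k / 2 * v \<le> R / 2 + 15 / 64 * \<epsilon> * q * (\<Sum>i\<le>k. A i)"
  shows "v \<le> 4 * L / m * R"
proof -
  define t where "t = real N * q / 3"
  have t0: "0 \<le> t" using q_pos by (simp add: t_def)
  \<comment> \<open>The tangent of the exponential at 1 gives \<open>exp 1 * t \<le> exp t\<close>;
    the factor 5/2 is a rational lower bound for \<open>exp 1\<close>.\<close>
  have "5 / 2 * t \<le> exp 1 * t"
    using exp_lower_Taylor_quadratic[of "1::real"] t0 by (intro mult_right_mono) auto
  also have "\<dots> \<le> exp 1 * exp (t - 1)"
    using exp_ge_add_one_self[of "t - 1"] by (intro mult_left_mono) auto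
  also have "\<dots> = exp t" by (simp add: exp_add[symmetric])
  finally have "5 / 2 * t \<le> 4 * L * R / \<epsilon>" using R by (simp add: t_def)
  then have "5 / 2 * t * \<epsilon> \<le> 4 * L * R" using \<epsilon> by (simp add: pos_le_divide_eq)
  then have R2: "5 / 8 * (\<epsilon> * q * real N) \<le> 3 * L * R" by (simp add: t_def mult_ac)
  have R0: "0 \<le> R"
  proof -
    have "0 \<le> 4 * L * R / \<epsilon>" using R by (rule order_trans[rotated]) simp
    then show ?thesis using \<epsilon> L_pos by (simp add: zero_le_divide_iff zero_le_mult_iff)
  qed
  have "v = 2 * (c k / 2 * v) / c k" using c_pos[of k] by simp
  also have "\<dots> \<le> 2 * (R / 2 + 15 / 64 * \<epsilon> * q * (\<Sum>i\<le>k. A i)) / c k"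
    using V c_pos[of k] by (intro divide_right_mono mult_left_mono) auto
  also have "\<dots> = R / c k + 15 / 32 * \<epsilon> * q * ((\<Sum>i\<le>k. A i) / c k)"
    by (simp add: add_divide_distrib)
  also have "\<dots> \<le> R + 15 / 32 * \<epsilon> * q * (real N / m)"
  proof (intro add_mono mult_left_mono)
    show "R / c k \<le> R" using R0 c_ge_1[of k] by (simp add: divide_le_eq mult_le_cancel_left1)
    have "(\<Sum>i\<le>k. A i) / c k \<le> ((real k + 1) / 2 * A k) / c k"
      using sum_A_le_half c_pos by (intro divide_right_mono) (auto simp: less_imp_le)
    also have "\<dots> = (real k + 1) / 2 * (A k / c k)" by simp
    also have "\<dots> \<le> (real N / 2) * (2 / m)"
      using A_div_c[of k] k c_pos[of k] A_nonneg[of k] by (intro mult_mono) auto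
    finally show "(\<Sum>i\<le>k. A i) / c k \<le> real N / m" by simp
  qed (use \<epsilon> q_pos in simp)
  also have "\<dots> \<le> L / m * R + (3 * L * R) / m"
  proof (rule add_mono)
    have "1 * R \<le> L / m * R" using m_le_L m_pos R0 by (intro mult_right_mono) auto
    then show "R \<le> L / m * R" by simp
    have "15 / 32 * (\<epsilon> * q * real N) \<le> 3 * L * R"
    proof -
      have "0 \<le> \<epsilon> * q * real N" using \<epsilon> q_pos by simp
      with R2 show ?thesis by linarith
    qed
    then show "15 / 32 * \<epsilon> * q * (real N / m) \<le> (3 * L * R) / m"
      using m_pos by (simp add: field_simps)
  qed
  also have "\<dots> = 4 * L / m * R" by (simp add: add_divide_distrib[symmetric])
  finally show ?thesis .
qed

end

section \<open>Square-integrable random vectors\<close>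

definition sq_int :: "'w measure \<Rightarrow> ('w \<Rightarrow> 'a::euclidean_space) \<Rightarrow> bool" where
  "sq_int M X \<longleftrightarrow> X \<in> borel_measurable M \<and> integrable M (\<lambda>w. (norm (X w))\<^sup>2)"

lemma sq_intD:
  "sq_int M X \<Longrightarrow> X \<in> borel_measurable M"
  "sq_int M X \<Longrightarrow> integrable M (\<lambda>w. (norm (X w))\<^sup>2)"
  by (auto simp: sq_int_def)

lemma sq_int_bound:
  assumes "X \<in> borel_measurable M" "integrable M h" "\<And>w. (norm (X w))\<^sup>2 \<le> h w"
  shows "sq_int M X"
  unfolding sq_int_def
proof
  have h: "0 \<le> h w" for w
    by (rule order_trans[OF _ assms(3)]) simp
  show "integrable M (\<lambda>w. (norm (X w))\<^sup>2)"
    by (rule Bochner_Integration.integrable_bound[OF assms(2)]) (use assms h in auto)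
qed (rule assms)

lemma norm_add_sq_le: "(norm (a + b))\<^sup>2 \<le> 2 * (norm a)\<^sup>2 + 2 * (norm b)\<^sup>2" for a b :: "'a::real_inner"
proof -
  have "(norm (a + b))\<^sup>2 \<le> (norm a + norm b)\<^sup>2"
    by (rule power_mono[OF norm_triangle_ineq]) simp
  also have "\<dots> \<le> 2 * (norm a)\<^sup>2 + 2 * (norm b)\<^sup>2"
    using sum_squares_bound[of "norm a" "norm b"] by (simp add: power2_sum)
  finally show ?thesis .
qed

lemma sq_int_add:
  assumes "sq_int M X" "sq_int M Y"
  shows "sq_int M (\<lambda>w. X w + Y w)"
proof (rule sq_int_bound)
  show "integrable M (\<lambda>w. 2 * (norm (X w))\<^sup>2 + 2 * (norm (Y w))\<^sup>2)"
    using assms by (auto simp: sq_int_def)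
qed (use assms norm_add_sq_le in \<open>auto simp: sq_int_def\<close>)

lemma sq_int_scaleR: "sq_int M X \<Longrightarrow> sq_int M (\<lambda>w. c *\<^sub>R X w)"
  unfolding sq_int_def norm_scaleR power_mult_distrib
  by (auto intro: borel_measurable_scaleR[OF borel_measurable_const])

lemma sq_int_minus: "sq_int M X \<Longrightarrow> sq_int M (\<lambda>w. - X w)"
  using sq_int_scaleR[of M X "-1"] by simp

lemma sq_int_diff: "sq_int M X \<Longrightarrow> sq_int M Y \<Longrightarrow> sq_int M (\<lambda>w. X w - Y w)"
  using sq_int_add[of M X "\<lambda>w. - Y w"] sq_int_minus[of M Y] by simp

lemma sq_int_const: "finite_measure M \<Longrightarrow> sq_int M (\<lambda>_. c)"
  by (simp add: sq_int_def finite_measure.integrable_const)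

lemma sq_int_sum:
  assumes "finite_measure M"
  shows "(\<And>i. i \<in> I \<Longrightarrow> sq_int M (X i)) \<Longrightarrow> sq_int M (\<lambda>w. \<Sum>i\<in>I. X i w)"
  by (induction I rule: infinite_finite_induct)
    (auto intro!: sq_int_add sq_int_const[OF assms])

lemma sq_int_lipschitz:
  assumes "sq_int M X" "f \<in> borel_measurable borel" "\<And>x. norm (f x) \<le> C * norm x"
  shows "sq_int M (\<lambda>w. f (X w))"
proof (rule sq_int_bound)
  show "integrable M (\<lambda>w. C\<^sup>2 * (norm (X w))\<^sup>2)" using assms(1) by (simp add: sq_int_def)
  show "(norm (f (X w)))\<^sup>2 \<le> C\<^sup>2 * (norm (X w))\<^sup>2" for w
    using power_mono[OF assms(3), of "X w" 2] by (simp add: power_mult_distrib)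
  show "(\<lambda>w. f (X w)) \<in> borel_measurable M"
    using sq_intD(1)[OF assms(1)] assms(2) by (rule measurable_compose)
qed

lemma sq_int_linear:
  assumes "sq_int M X" "bounded_linear f"
  shows "sq_int M (\<lambda>w. f (X w))"
proof -
  obtain C where "\<And>x. norm (f x) \<le> norm x * C"
    using bounded_linear.bounded[OF assms(2)] by blast
  then have "norm (f x) \<le> C * norm x" for x by (metis mult.commute)
  moreover have "f \<in> borel_measurable borel"
    by (rule borel_measurable_continuous_onI) (rule linear_continuous_on[OF assms(2)])
  ultimately show ?thesis by (intro sq_int_lipschitz[OF assms(1)])
qed

lemma sq_int_inner:
  assumes "sq_int M X" "sq_int M Y"
  shows "integrable M (\<lambda>w. inner (X w) (Y w))"
proof (rule Bochner_Integration.integrable_bound)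
  show "integrable M (\<lambda>w. (norm (X w))\<^sup>2 + (norm (Y w))\<^sup>2)"
    using assms by (auto simp: sq_int_def)
  show "(\<lambda>w. inner (X w) (Y w)) \<in> borel_measurable M"
    using assms by (auto simp: sq_int_def)
  show "AE w in M. norm (inner (X w) (Y w)) \<le> norm ((norm (X w))\<^sup>2 + (norm (Y w))\<^sup>2)"
  proof (rule AE_I2)
    fix w
    have "\<bar>inner (X w) (Y w)\<bar> \<le> norm (X w) * norm (Y w)" by (rule Cauchy_Schwarz_ineq2)
    also have "\<dots> \<le> (norm (X w))\<^sup>2 + (norm (Y w))\<^sup>2"
      using sum_squares_bound[of "norm (X w)" "norm (Y w)"]
        mult_nonneg_nonneg[OF norm_ge_zero[of "X w"] norm_ge_zero[of "Y w"]] by linarith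
    finally show "norm (inner (X w) (Y w)) \<le> norm ((norm (X w))\<^sup>2 + (norm (Y w))\<^sup>2)" by simp
  qed
qed

text \<open>The triangle inequality in L2, in squared form: a weighted Young inequality whose
  weights are the ratios of the two norm bounds is integrated.\<close>

lemma minkowski:
  assumes X: "sq_int M X" "(\<integral>w. (norm (X w))\<^sup>2 \<partial>M) \<le> a\<^sup>2" "0 \<le> a"
    and Y: "sq_int M Y" "(\<integral>w. (norm (Y w))\<^sup>2 \<partial>M) \<le> b\<^sup>2" "0 \<le> b"
  shows "(\<integral>w. (norm (X w + Y w))\<^sup>2 \<partial>M) \<le> (a + b)\<^sup>2"
proof -
  have pos: "(\<integral>w. (norm (X w + Y w))\<^sup>2 \<partial>M) \<le> (a' + b')\<^sup>2"
    if ab: "0 < a'" "0 < b'" "a \<le> a'" "b \<le> b'" for a' b'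
  proof -
    have point: "(norm (x + y))\<^sup>2 \<le> (1 + b' / a') * (norm x)\<^sup>2 + (1 + a' / b') * (norm y)\<^sup>2" for x y :: 'b
    proof -
      have "0 \<le> (norm (b' *\<^sub>R x - a' *\<^sub>R y))\<^sup>2" by simp
      then have "2 * (a' * b') * inner x y \<le> b'\<^sup>2 * (norm x)\<^sup>2 + a'\<^sup>2 * (norm y)\<^sup>2"
        unfolding power2_norm_eq_inner
        by (simp add: inner_diff_left inner_diff_right inner_commute power2_eq_square mult_ac)
      then have "2 * inner x y \<le> (b'\<^sup>2 * (norm x)\<^sup>2 + a'\<^sup>2 * (norm y)\<^sup>2) / (a' * b')"
        using ab by (simp add: pos_le_divide_eq mult_ac)
      also have "\<dots> = b' / a' * (norm x)\<^sup>2 + a' / b' * (norm y)\<^sup>2"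
        using ab by (simp add: add_divide_distrib power2_eq_square)
      finally have "2 * inner x y \<le> \<dots>" .
      moreover have "(norm (x + y))\<^sup>2 = (norm x)\<^sup>2 + 2 * inner x y + (norm y)\<^sup>2"
        unfolding power2_norm_eq_inner by (simp add: inner_add_left inner_add_right inner_commute)
      ultimately show ?thesis by (simp add: distrib_right)
    qed
    have "(\<integral>w. (norm (X w + Y w))\<^sup>2 \<partial>M)
        \<le> (\<integral>w. (1 + b' / a') * (norm (X w))\<^sup>2 + (1 + a' / b') * (norm (Y w))\<^sup>2 \<partial>M)"
      using sq_int_add[OF X(1) Y(1)] X(1) Y(1) point by (intro integral_mono) (auto simp: sq_int_def)
    also have "\<dots> = (1 + b' / a') * (\<integral>w. (norm (X w))\<^sup>2 \<partial>M) + (1 + a' / b') * (\<integral>w. (norm (Y w))\<^sup>2 \<partial>M)"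
      using X(1) Y(1) by (simp add: sq_int_def)
    also have "\<dots> \<le> (1 + b' / a') * a'\<^sup>2 + (1 + a' / b') * b'\<^sup>2"
      using ab order_trans[OF X(2) power_mono[OF ab(3) X(3)]] order_trans[OF Y(2) power_mono[OF ab(4) Y(3)]]
      by (intro add_mono mult_left_mono) auto
    also have "\<dots> = (a' + b')\<^sup>2"
      using ab by (simp add: power2_eq_square field_simps)
    finally show ?thesis .
  qed
  \<comment> \<open>The bounds \<open>a\<close> and \<open>b\<close> may vanish, and then the Young
    weights make no sense. Both are enlarged by \<open>t\<close>, which tends to 0 from the
    right.\<close>
  have "((\<lambda>t. ((a + t) + (b + t))\<^sup>2) \<longlongrightarrow> ((a + 0) + (b + 0))\<^sup>2) (at_right 0)"
    by (intro tendsto_intros)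
  then have lim: "((\<lambda>t. ((a + t) + (b + t))\<^sup>2) \<longlongrightarrow> (a + b)\<^sup>2) (at_right 0)" by simp
  have ev: "\<forall>\<^sub>F t in at_right 0. (\<integral>w. (norm (X w + Y w))\<^sup>2 \<partial>M) \<le> ((a + t) + (b + t))\<^sup>2"
    using eventually_at_right_less[of 0]
    by eventually_elim (rule pos, use X(3) Y(3) in auto)
  show ?thesis
    by (rule tendsto_lowerbound[OF lim ev]) simp
qed

lemma norm_vec_sq: "(norm X)\<^sup>2 = (\<Sum>i\<in>UNIV. (norm (X $ i))\<^sup>2)" for X :: "real^'d^'n"
  by (simp add: norm_vec_def L2_set_def sum_nonneg)

lemma norm_convex_sq:
  fixes x y :: "'a::real_inner"
  assumes "0 \<le> a" "0 \<le> b" "a + b = (1::real)"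
  shows "(norm (a *\<^sub>R x + b *\<^sub>R y))\<^sup>2 \<le> a * (norm x)\<^sup>2 + b * (norm y)\<^sup>2"
proof -
  have b: "b = 1 - a" using assms(3) by simp
  have "0 \<le> a * b * (norm (x - y))\<^sup>2" using assms by simp
  also have "\<dots> = a * (norm x)\<^sup>2 + b * (norm y)\<^sup>2 - (norm (a *\<^sub>R x + b *\<^sub>R y))\<^sup>2"
    unfolding power2_norm_eq_inner b
    by (simp add: inner_add_left inner_add_right inner_diff_left inner_diff_right inner_commute algebra_simps)
  finally show ?thesis by simp
qed

lemma norm_mean_sq_le:
  fixes v :: "nat \<Rightarrow> 'a::real_inner"
  assumes "0 < r"
  shows "(norm ((1 / real r) *\<^sub>R (\<Sum>l<r. v l)))\<^sup>2 \<le> (1 / real r) * (\<Sum>l<r. (norm (v l))\<^sup>2)"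
proof -
  have "norm (\<Sum>l<r. v l) \<le> (\<Sum>l<r. norm (v l))" by (rule norm_sum)
  then have "(norm (\<Sum>l<r. v l))\<^sup>2 \<le> (\<Sum>l<r. norm (v l))\<^sup>2" by (rule power_mono) simp
  also have "\<dots> \<le> real r * (\<Sum>l<r. (norm (v l))\<^sup>2)"
    using sum_squared_le_sum_of_squares[of "\<lambda>l. norm (v l)" "{..<r}"] by (simp add: mult.commute)
  finally show ?thesis
    using assms by (simp add: power_mult_distrib power_divide power2_eq_square field_simps)
qed

section \<open>Independent samples\<close>

context prob_space
begin

text \<open>Independence enters only through the hypothesis on the joint law. The right-hand side
  plays the part of conditioning on \<open>X\<close>.\<close>

lemma product_law_nn_fubini:
  assumes X[measurable]: "X \<in> measurable M S" and Y[measurable]: "Y \<in> measurable M T"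
    and joint: "distr M S X \<Otimes>\<^sub>M distr M T Y = distr M (S \<Otimes>\<^sub>M T) (\<lambda>w. (X w, Y w))" and \<phi>[measurable]: "\<phi> \<in> borel_measurable (S \<Otimes>\<^sub>M T)"
  shows "(\<integral>\<^sup>+w. \<phi> (X w, Y w) \<partial>M) = (\<integral>\<^sup>+w. (\<integral>\<^sup>+s. \<phi> (X w, s) \<partial>distr M T Y) \<partial>M)"
proof -
  interpret T: prob_space "distr M T Y" by (rule prob_space_distr) measurable
  have "(\<integral>\<^sup>+w. \<phi> (X w, Y w) \<partial>M) = (\<integral>\<^sup>+z. \<phi> z \<partial>distr M (S \<Otimes>\<^sub>M T) (\<lambda>w. (X w, Y w)))"
    by (subst nn_integral_distr) auto
  also have "\<dots> = (\<integral>\<^sup>+z. \<phi> z \<partial>(distr M S X \<Otimes>\<^sub>M distr M T Y))"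
    using joint by simp
  also have "\<dots> = (\<integral>\<^sup>+x. (\<integral>\<^sup>+s. \<phi> (x, s) \<partial>distr M T Y) \<partial>distr M S X)"
    by (rule T.nn_integral_fst[symmetric]) simp
  also have "\<dots> = (\<integral>\<^sup>+w. (\<integral>\<^sup>+s. \<phi> (X w, s) \<partial>distr M T Y) \<partial>M)"
    by (subst nn_integral_distr) auto
  finally show ?thesis .
qed

lemma product_law_fubini:
  fixes \<phi> :: "_ \<Rightarrow> real"
  assumes X[measurable]: "X \<in> measurable M S" and Y[measurable]: "Y \<in> measurable M T"
    and joint: "distr M S X \<Otimes>\<^sub>M distr M T Y = distr M (S \<Otimes>\<^sub>M T) (\<lambda>w. (X w, Y w))" and \<phi>[measurable]: "\<phi> \<in> borel_measurable (S \<Otimes>\<^sub>M T)"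
    and int: "integrable M (\<lambda>w. \<phi> (X w, Y w))"
  shows "(\<integral>w. \<phi> (X w, Y w) \<partial>M) = (\<integral>w. (\<integral>s. \<phi> (X w, s) \<partial>distr M T Y) \<partial>M)"
proof -
  interpret T: prob_space "distr M T Y" by (rule prob_space_distr) measurable
  interpret S: prob_space "distr M S X" by (rule prob_space_distr) measurable
  interpret ST: pair_sigma_finite "distr M S X" "distr M T Y" ..
  have int': "integrable (distr M S X \<Otimes>\<^sub>M distr M T Y) \<phi>"
    using joint int by (simp add: integrable_distr_eq)
  have "(\<integral>w. \<phi> (X w, Y w) \<partial>M) = (\<integral>z. \<phi> z \<partial>distr M (S \<Otimes>\<^sub>M T) (\<lambda>w. (X w, Y w)))"
    by (subst integral_distr) auto
  also have "\<dots> = (\<integral>z. \<phi> z \<partial>(distr M S X \<Otimes>\<^sub>M distr M T Y))"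
    using joint by simp
  also have "\<dots> = (\<integral>x. (\<integral>s. \<phi> (x, s) \<partial>distr M T Y) \<partial>distr M S X)"
    by (rule ST.integral_fst'[symmetric, OF int'])
  also have "\<dots> = (\<integral>w. (\<integral>s. \<phi> (X w, s) \<partial>distr M T Y) \<partial>M)"
    by (subst integral_distr) auto
  finally show ?thesis .
qed

lemma expectation_norm_sum_orthogonal:
  fixes v :: "'i \<Rightarrow> 'a \<Rightarrow> 'b::euclidean_space"
  assumes fin: "finite I" and v: "\<And>a. a \<in> I \<Longrightarrow> sq_int M (v a)"
    and orth: "\<And>a b. a \<in> I \<Longrightarrow> b \<in> I \<Longrightarrow> a \<noteq> b \<Longrightarrow> (\<integral>w. inner (v a w) (v b w) \<partial>M) = 0"
  shows "(\<integral>w. (norm (\<Sum>a\<in>I. v a w))\<^sup>2 \<partial>M) = (\<Sum>a\<in>I. \<integral>w. (norm (v a w))\<^sup>2 \<partial>M)"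
proof -
  have int: "integrable M (\<lambda>w. inner (v a w) (v b w))" if "a \<in> I" "b \<in> I" for a b
    using v that by (intro sq_int_inner)
  have "(\<integral>w. (norm (\<Sum>a\<in>I. v a w))\<^sup>2 \<partial>M) = (\<integral>w. (\<Sum>a\<in>I. \<Sum>b\<in>I. inner (v b w) (v a w)) \<partial>M)"
    unfolding power2_norm_eq_inner inner_sum_left inner_sum_right ..
  also have "\<dots> = (\<Sum>a\<in>I. \<Sum>b\<in>I. \<integral>w. inner (v b w) (v a w) \<partial>M)"
    using int by (simp add: Bochner_Integration.integral_sum Bochner_Integration.integrable_sum)
  also have "\<dots> = (\<Sum>a\<in>I. \<Sum>b\<in>I. if b = a then \<integral>w. (norm (v a w))\<^sup>2 \<partial>M else 0)"
    using orth by (intro sum.cong refl) (auto simp: power2_norm_eq_inner)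
  also have "\<dots> = (\<Sum>a\<in>I. \<integral>w. (norm (v a w))\<^sup>2 \<partial>M)"
    using fin by simp
  finally show ?thesis .
qed

end

locale sampled_problem = stochastic_problem D ff Lxi mu L sigma xs
  for D :: "'n::finite \<Rightarrow> 's measure" and ff :: "'n \<Rightarrow> real^'d \<Rightarrow> 's \<Rightarrow> real"
    and Lxi mu L sigma xs +
  fixes M :: "'w measure" and \<xi> :: "nat \<Rightarrow> 'n \<Rightarrow> nat \<Rightarrow> 'w \<Rightarrow> 's" and r :: nat
  assumes samples: "independent_samples M D \<xi>" and r_pos: "0 < r"
begin

sublocale prob_space M
  using samples by (simp add: independent_samples_def)

definition "law = (\<lambda>(k::nat, i, l::nat). D i)"
definition "sample = (\<lambda>(k, i, l). \<xi> k i l)"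
definition "history J w = restrict (\<lambda>a. sample a w) J"

text \<open>Dependence on the samples with index in \<open>J\<close> is expressed by a \<open>\<sigma>\<close>-algebra on \<open>space M\<close> and
  not by functions of the history, so that the measurability rules apply to the iterates.\<close>

definition "info J = vimage_algebra (space M) (history J) (PiM J law)"

definition "past k = {a :: nat \<times> 'n \<times> nat. fst a < k}"

lemma indep_samples: "indep_vars law sample UNIV"
  using samples by (simp add: independent_samples_def law_def sample_def)

lemma sample_measurable: "sample a \<in> measurable M (law a)"
  using indep_samples unfolding indep_vars_def by blast

lemma distr_sample: "distr M (D i) (\<xi> k i l) = D i"
  using samples by (simp add: independent_samples_def)

lemma history_measurable: "history J \<in> measurable M (PiM J law)"
  unfolding history_def by (intro measurable_restrict sample_measurable)

lemma space_info: "space (info J) = space M"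
  by (simp add: info_def)

lemma id_measurable_info: "(\<lambda>w. w) \<in> measurable M (info J)"
  unfolding info_def by (rule measurable_vimage_algebra2) (auto intro: history_measurable)

lemma measurable_info_imp: "f \<in> measurable (info J) N \<Longrightarrow> f \<in> measurable M N"
  by (rule measurable_compose[OF id_measurable_info[of J], where g = f and L = N])

lemma history_measurable_info: "history J \<in> measurable (info J) (PiM J law)"
  unfolding info_def
  by (rule measurable_vimage_algebra1) (use history_measurable[of J] in \<open>auto simp: measurable_def\<close>)

lemma sample_measurable_info:
  assumes "a \<in> J" shows "sample a \<in> measurable (info J) (law a)"
proof -
  have "(\<lambda>w. history J w a) \<in> measurable (info J) (law a)"
    using history_measurable_info measurable_component_singleton[OF assms] by (rule measurable_compose)
  then show ?thesis using assms by (simp add: history_def)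
qed

lemma info_mono:
  assumes "J \<subseteq> J'" shows "f \<in> measurable (info J) N \<Longrightarrow> f \<in> measurable (info J') N"
proof -
  have H: "history J \<in> measurable (info J') (PiM J law)"
    unfolding history_def by (rule measurable_restrict) (rule sample_measurable_info, use assms in blast)
  have id: "(\<lambda>w. w) \<in> measurable (info J') (info J)"
    unfolding info_def[of J]
    by (rule measurable_vimage_algebra2) (use H in \<open>auto simp: space_info\<close>)
  assume "f \<in> measurable (info J) N"
  then show "f \<in> measurable (info J') N" by (rule measurable_compose[OF id])
qed

lemma \<xi>_measurable_info: "(k, i, l) \<in> J \<Longrightarrow> \<xi> k i l \<in> measurable (info J) (D i)"
  using sample_measurable_info[of "(k, i, l)" J] by (simp add: sample_def law_def)

lemma \<xi>_measurable: "\<xi> k i l \<in> measurable M (D i)"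
  using sample_measurable[of "(k, i, l)"] by (simp add: sample_def law_def)

text \<open>The identity map into \<open>info J\<close> represents the whole history as one random
  element. Rectangles determine the joint law; on them the claim is the independence of the history
  over \<open>J\<close> from a sample outside \<open>J\<close>.\<close>

lemma joint_law_sample:
  assumes "(k, i, l) \<notin> J"
  shows "distr M (info J) (\<lambda>w. w) \<Otimes>\<^sub>M distr M (D i) (\<xi> k i l)
    = distr M (info J \<Otimes>\<^sub>M D i) (\<lambda>w. (w, \<xi> k i l w))"
proof -
  let ?a = "(k, i, l)" 
  have ind: "indep_var (PiM J law) (history J) (PiM {?a} law) (history {?a})"
    unfolding history_def by (rule indep_var_restrict[OF indep_samples]) (use assms in auto)
  have H: "history J \<in> space M \<rightarrow> space (PiM J law)"
    using history_measurable[of J] by (auto simp: measurable_def)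
  interpret X: prob_space "distr M (info J) (\<lambda>w. w)" by (rule prob_space_distr) (rule id_measurable_info)
  interpret Y: prob_space "distr M (D i) (\<xi> k i l)" by (rule prob_space_distr) (rule \<xi>_measurable)
  have pair: "(\<lambda>w. (w, \<xi> k i l w)) \<in> measurable M (info J \<Otimes>\<^sub>M D i)"
    using id_measurable_info \<xi>_measurable by measurable
  show ?thesis
  proof (rule pair_measure_eqI)
    fix A B assume "A \<in> sets (distr M (info J) (\<lambda>w. w))" "B \<in> sets (distr M (D i) (\<xi> k i l))"
    then have A: "A \<in> sets (info J)" and B: "B \<in> sets (D i)" by simp_all
    from A obtain A' where A': "A' \<in> sets (PiM J law)" "A = history J -` A' \<inter> space M"
      unfolding info_def sets_vimage_algebra2[OF H] by auto
    \<comment> \<open>\<open>indep_var_restrict\<close> treats the single sample as a history over a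
      singleton, so \<open>B\<close> is transported to a set of functions on that singleton.\<close>
    define B' where "B' = (\<lambda>p. p ?a) -` B \<inter> space (PiM {?a} law)"
    have "(\<lambda>p. p ?a) \<in> measurable (PiM {?a} law) (law ?a)"
      by (rule measurable_component_singleton) simp
    then have B': "B' \<in> sets (PiM {?a} law)"
      unfolding B'_def by (rule measurable_sets) (use B in \<open>simp add: law_def\<close>)
    have hist: "history {?a} w \<in> B' \<longleftrightarrow> \<xi> k i l w \<in> B" if "w \<in> space M" for w
      using measurable_space[OF history_measurable that, of "{?a}"]
      by (simp add: B'_def history_def sample_def)
    have "emeasure (distr M (info J) (\<lambda>w. w)) A * emeasure (distr M (D i) (\<xi> k i l)) B
        = emeasure M (history J -` A' \<inter> space M) * emeasure M (history {?a} -` B' \<inter> space M)"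
    proof -
      have "(\<lambda>w. w) -` A \<inter> space M = history J -` A' \<inter> space M" using A'(2) by auto
      moreover have "\<xi> k i l -` B \<inter> space M = history {?a} -` B' \<inter> space M" using hist by auto
      ultimately show ?thesis
        using A B id_measurable_info \<xi>_measurable by (simp add: emeasure_distr)
    qed
    also have "\<dots> = emeasure M ((\<lambda>w. (history J w, history {?a} w)) -` (A' \<times> B') \<inter> space M)"
      using indep_varD[OF ind A'(1) B'] by (simp add: emeasure_eq_measure ennreal_mult)
    also have "(\<lambda>w. (history J w, history {?a} w)) -` (A' \<times> B') \<inter> space M
        = (\<lambda>w. (w, \<xi> k i l w)) -` (A \<times> B) \<inter> space M"
      unfolding A'(2) using hist by auto
    also have "emeasure M \<dots> = emeasure (distr M (info J \<Otimes>\<^sub>M D i) (\<lambda>w. (w, \<xi> k i l w))) (A \<times> B)"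
      by (subst emeasure_distr[OF pair]) (use A B in auto)
    finally show "emeasure (distr M (info J) (\<lambda>w. w)) A * emeasure (distr M (D i) (\<xi> k i l)) B
        = emeasure (distr M (info J \<Otimes>\<^sub>M D i) (\<lambda>w. (w, \<xi> k i l w))) (A \<times> B)" .
  qed (simp_all add: X.sigma_finite_measure_axioms Y.sigma_finite_measure_axioms cong: sets_pair_measure_cong)
qed

section \<open>Sampling noise relative to the past\<close>

definition "noise i x s = G i x s - g i x"

lemma gradient_local_measurable [measurable]: "g i \<in> borel_measurable borel"
  by (intro borel_measurable_continuous_onI lipschitz_on_continuous_on[OF gradient_local_lipschitz])

lemma sampled_gradient_pair_measurable:
  assumes "Y \<in> borel_measurable N"
  shows "(\<lambda>(w, s). G i (Y w) s) \<in> borel_measurable (N \<Otimes>\<^sub>M D i)"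
proof -
  have "(\<lambda>(w, s). (Y w, s)) \<in> measurable (N \<Otimes>\<^sub>M D i) (borel \<Otimes>\<^sub>M D i)"
    using assms by measurable
  from measurable_compose[OF this gradient_measurable[of i]] show ?thesis
    by (simp add: case_prod_beta')
qed

lemma noise_pair_measurable:
  assumes [measurable]: "Y \<in> borel_measurable N"
  shows "(\<lambda>(w, s). noise i (Y w) s) \<in> borel_measurable (N \<Otimes>\<^sub>M D i)"
proof -
  have "(\<lambda>z. (case z of (w, s) \<Rightarrow> G i (Y w) s) - g i (Y (fst z))) \<in> borel_measurable (N \<Otimes>\<^sub>M D i)"
    by (intro borel_measurable_diff sampled_gradient_pair_measurable) measurable
  then show ?thesis by (simp add: noise_def case_prod_beta')
qed

lemma sampled_gradient_measurable:
  assumes "Y \<in> borel_measurable N" "\<xi> k i l \<in> measurable N (D i)"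
  shows "(\<lambda>w. G i (Y w) (\<xi> k i l w)) \<in> borel_measurable N"
    and "(\<lambda>w. noise i (Y w) (\<xi> k i l w)) \<in> borel_measurable N"
proof -
  have "(\<lambda>w. (w, \<xi> k i l w)) \<in> measurable N (N \<Otimes>\<^sub>M D i)"
    using assms(2) by measurable
  from measurable_compose[OF this sampled_gradient_pair_measurable[OF assms(1)]]
    measurable_compose[OF this noise_pair_measurable[OF assms(1)]]
  show "(\<lambda>w. G i (Y w) (\<xi> k i l w)) \<in> borel_measurable N"
    "(\<lambda>w. noise i (Y w) (\<xi> k i l w)) \<in> borel_measurable N"
    by simp_all
qed

text \<open>By Tonelli the new sample is averaged out with \<open>w\<close> frozen. Working with
  nonnegative integrals yields square integrability together with the bound, so neither has to be
  known in advance.\<close>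

lemma expectation_sq_le:
  fixes \<phi> :: "'w \<Rightarrow> 's \<Rightarrow> real^'d"
  assumes new: "(k, i, l) \<notin> J" and meas: "(\<lambda>(w, s). \<phi> w s) \<in> borel_measurable (info J \<Otimes>\<^sub>M D i)"
    and bd: "\<And>w. w \<in> space M \<Longrightarrow> (\<integral>\<^sup>+s. ennreal ((norm (\<phi> w s))\<^sup>2) \<partial>D i) \<le> ennreal (h w)"
    and h: "integrable M h" "\<And>w. 0 \<le> h w"
  shows "sq_int M (\<lambda>w. \<phi> w (\<xi> k i l w))"
    and "(\<integral>w. (norm (\<phi> w (\<xi> k i l w)))\<^sup>2 \<partial>M) \<le> (\<integral>w. h w \<partial>M)"
proof -
  have "(\<lambda>w. (w, \<xi> k i l w)) \<in> measurable M (info J \<Otimes>\<^sub>M D i)"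
    using id_measurable_info \<xi>_measurable by measurable
  from measurable_compose[OF this meas]
  have m: "(\<lambda>w. \<phi> w (\<xi> k i l w)) \<in> borel_measurable M" by simp
  have "(\<integral>\<^sup>+w. ennreal ((norm (\<phi> w (\<xi> k i l w)))\<^sup>2) \<partial>M)
      = (\<integral>\<^sup>+w. (\<lambda>z. ennreal ((norm (case_prod \<phi> z))\<^sup>2)) (w, \<xi> k i l w) \<partial>M)" by simp
  also have "\<dots> = (\<integral>\<^sup>+w. (\<integral>\<^sup>+s. (\<lambda>z. ennreal ((norm (case_prod \<phi> z))\<^sup>2)) (w, s) \<partial>distr M (D i) (\<xi> k i l)) \<partial>M)"
    by (rule product_law_nn_fubini[OF id_measurable_info \<xi>_measurable joint_law_sample[OF new]]) (use meas in measurable)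
  also have "\<dots> \<le> (\<integral>\<^sup>+w. ennreal (h w) \<partial>M)"
    unfolding distr_sample by (intro nn_integral_mono) (use bd in auto)
  also have "\<dots> = ennreal (\<integral>w. h w \<partial>M)"
    using h by (intro nn_integral_eq_integral) auto
  finally have le: "(\<integral>\<^sup>+w. ennreal ((norm (\<phi> w (\<xi> k i l w)))\<^sup>2) \<partial>M) \<le> ennreal (\<integral>w. h w \<partial>M)" .
  have int: "integrable M (\<lambda>w. (norm (\<phi> w (\<xi> k i l w)))\<^sup>2)"
  proof (rule integrableI_bounded)
    show "(\<integral>\<^sup>+w. ennreal (norm ((norm (\<phi> w (\<xi> k i l w)))\<^sup>2)) \<partial>M) < \<infinity>"
      using le by (simp add: le_less_trans)
  qed (use m in measurable)
  with m show "sq_int M (\<lambda>w. \<phi> w (\<xi> k i l w))" by (simp add: sq_int_def)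
  have "ennreal (\<integral>w. (norm (\<phi> w (\<xi> k i l w)))\<^sup>2 \<partial>M) \<le> ennreal (\<integral>w. h w \<partial>M)"
    using le nn_integral_eq_integral[OF int] by simp
  then show "(\<integral>w. (norm (\<phi> w (\<xi> k i l w)))\<^sup>2 \<partial>M) \<le> (\<integral>w. h w \<partial>M)"
    using h by (simp add: integral_nonneg_AE)
qed

lemma noise_second_moment:
  assumes new: "(k, i, l) \<notin> J" and Y: "Y \<in> borel_measurable (info J)"
  shows "sq_int M (\<lambda>w. noise i (Y w) (\<xi> k i l w))"
    and "(\<integral>w. (norm (noise i (Y w) (\<xi> k i l w)))\<^sup>2 \<partial>M) \<le> (sigma i)\<^sup>2"
  using expectation_sq_le[OF new noise_pair_measurable[OF Y], of "\<lambda>_. (sigma i)\<^sup>2"] variance_nn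
  by (auto simp: noise_def prob_space)

text \<open>Given the samples in \<open>J\<close>, both \<open>Y\<close> and \<open>Z\<close> are
  fixed, and the average over the fresh sample vanishes by \<open>unbiased\<close>.\<close>

lemma noise_orthogonal:
  assumes new: "(k, i, l) \<notin> J" and Y: "Y \<in> borel_measurable (info J)"
    and Z: "Z \<in> borel_measurable (info J)" "sq_int M Z"
  shows "(\<integral>w. inner (noise i (Y w) (\<xi> k i l w)) (Z w) \<partial>M) = 0"
proof -
  define \<phi> where "\<phi> z = inner (case z of (w, s) \<Rightarrow> noise i (Y w) s) (Z (fst z))" for z
  have "\<phi> \<in> borel_measurable (info J \<Otimes>\<^sub>M D i)"
    unfolding \<phi>_def using noise_pair_measurable[OF Y, of i] Z(1) by measurable
  moreover have "integrable M (\<lambda>w. \<phi> (w, \<xi> k i l w))"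
    using sq_int_inner[OF noise_second_moment(1)[OF new Y] Z(2)] by (simp add: \<phi>_def)
  ultimately have "(\<integral>w. \<phi> (w, \<xi> k i l w) \<partial>M) = (\<integral>w. (\<integral>s. \<phi> (w, s) \<partial>distr M (D i) (\<xi> k i l)) \<partial>M)"
    by (rule product_law_fubini[OF id_measurable_info \<xi>_measurable joint_law_sample[OF new]])
  also have "\<dots> = 0"
  proof -
    interpret Di: prob_space "D i" by (rule prob)
    have "(\<integral>s. \<phi> (w, s) \<partial>D i) = 0" for w
      unfolding \<phi>_def noise_def
      by (simp add: integral_inner_left gradient_section_integrable unbiased Di.prob_space)
    then show ?thesis unfolding distr_sample by simp
  qed
  finally show ?thesis by (simp add: \<phi>_def)
qed

text \<open>The sample is independent of \<open>Y\<close>, so the root mean square bound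
  \<open>L i\<close> of the random Lipschitz constant suffices.\<close>

lemma sampled_gradient_lipschitz:
  assumes new: "(k, i, l) \<notin> J" and Y: "Y \<in> borel_measurable (info J)" "sq_int M Y"
  shows "sq_int M (\<lambda>w. G i (Y w) (\<xi> k i l w) - G i xs (\<xi> k i l w))"
    and "(\<integral>w. (norm (G i (Y w) (\<xi> k i l w) - G i xs (\<xi> k i l w)))\<^sup>2 \<partial>M)
      \<le> (L i)\<^sup>2 * (\<integral>w. (norm (Y w - xs))\<^sup>2 \<partial>M)"
proof -
  have int: "integrable M (\<lambda>w. (norm (Y w - xs))\<^sup>2)"
    using sq_int_diff[OF Y(2) sq_int_const[OF finite_measure_axioms]] by (rule sq_intD)
  have meas: "(\<lambda>(w, s). G i (Y w) s - G i xs s) \<in> borel_measurable (info J \<Otimes>\<^sub>M D i)"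
    using sampled_gradient_pair_measurable[OF Y(1), of i]
      sampled_gradient_pair_measurable[of "\<lambda>_. xs" "info J" i]
    by (simp add: case_prod_beta')
  note * = expectation_sq_le[OF new meas, of "\<lambda>w. (L i)\<^sup>2 * (norm (Y w - xs))\<^sup>2"]
  show "sq_int M (\<lambda>w. G i (Y w) (\<xi> k i l w) - G i xs (\<xi> k i l w))"
    by (rule *(1)) (use gradient_second_moment_nn int in auto)
  show "(\<integral>w. (norm (G i (Y w) (\<xi> k i l w) - G i xs (\<xi> k i l w)))\<^sup>2 \<partial>M)
      \<le> (L i)\<^sup>2 * (\<integral>w. (norm (Y w - xs))\<^sup>2 \<partial>M)"
    using *(2)[OF gradient_second_moment_nn] int by simp
qed

end

section \<open>Averages and mixing\<close>

lemma linear_row_mean: "linear row_mean"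
  by (rule linearI) (simp_all add: row_mean_def sum.distrib scaleR_sum_right scaleR_add_right mult.commute)

lemma linear_mean_matrix: "linear mean_matrix"
  by (rule linearI)
    (simp_all add: mean_matrix_def vec_eq_iff linear_add[OF linear_row_mean] linear_scale[OF linear_row_mean])

lemma row_mean_mean_matrix [simp]: "row_mean (mean_matrix X) = row_mean X"
  unfolding row_mean_def[of "mean_matrix X"] by (simp add: mean_matrix_def sum_constant_scaleR del: sum_constant)

lemma matrix_mult_row: "(W ** X) $ i = (\<Sum>j\<in>UNIV. W $ i $ j *\<^sub>R X $ j)" for X :: "real^'d^'n"
  by (simp add: matrix_matrix_mult_def vec_eq_iff)

lemma linear_matrix_mult: "linear (\<lambda>X :: real^'d^'n. W ** X)"
  by (rule linearI)
    (simp_all add: matrix_add_ldistrib vec_eq_iff matrix_mult_row scaleR_sum_right sum_distrib_left mult_ac)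

lemma row_mean_matrix_mult:
  fixes X :: "real^'d^'n" and W :: "real^'n^'n"
  assumes "1 v* W = 1"
  shows "row_mean (W ** X) = row_mean X"
proof -
  have col: "(\<Sum>i\<in>UNIV. W $ i $ j) = 1" for j
  proof -
    have "(1 v* W) $ j = 1" using assms by simp
    then show ?thesis by (simp add: vector_matrix_mult_def)
  qed
  have "(\<Sum>i\<in>UNIV. (W ** X) $ i) = (\<Sum>j\<in>UNIV. (\<Sum>i\<in>UNIV. W $ i $ j) *\<^sub>R X $ j)"
    unfolding matrix_mult_row scaleR_sum_left by (rule sum.swap)
  then show ?thesis by (simp add: row_mean_def col)
qed

lemma matrix_mult_mean_matrix:
  fixes X :: "real^'d^'n" and W :: "real^'n^'n"
  assumes "W *v 1 = 1"
  shows "W ** mean_matrix X = mean_matrix X"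
proof -
  have row: "(\<Sum>j\<in>UNIV. W $ i $ j) = 1" for i
  proof -
    have "(W *v 1) $ i = 1" using assms by simp
    then show ?thesis by (simp add: matrix_vector_mult_def)
  qed
  have "(W ** mean_matrix X) $ i = mean_matrix X $ i" for i
    unfolding matrix_mult_row by (simp add: mean_matrix_def scaleR_sum_left[symmetric] row)
  then show ?thesis by (simp add: vec_eq_iff)
qed

subsection \<open>Time-varying networks\<close>

lemma linear_fold_mixing: "linear (fold (\<lambda>t Y. W t ** Y) ts :: real^'d^'n \<Rightarrow> real^'d^'n)"
proof (induction ts)
  case Nil
  then show ?case by (simp add: linear_id[unfolded id_def] id_def)
next
  case (Cons t ts)
  have "linear (fold (\<lambda>t Y. W t ** Y) ts \<circ> (\<lambda>Y :: real^'d^'n. W t ** Y))"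
    by (rule linear_compose[OF linear_matrix_mult Cons])
  then show ?case by (simp only: fold_simps comp_def fold.simps)
qed

lemma row_mean_fold_mixing:
  fixes X :: "real^'d^'n"
  assumes "\<And>t. 1 v* W t = 1"
  shows "row_mean (fold (\<lambda>t Y. W t ** Y) ts X) = row_mean X"
  by (induction ts arbitrary: X) (simp_all add: row_mean_matrix_mult[OF assms])

lemma mixing_blocks:
  fixes X :: "real^'d^'n"
  assumes mix: "mixing_matrices TYPE('d) E W \<tau> lam"
  shows "norm (fold (\<lambda>t Y. W t ** Y) [a..<a + \<tau> * m] X - mean_matrix X)
    \<le> (1 - lam) ^ m * norm (X - mean_matrix X)"
proof (induction m)
  case (Suc m)
  let ?F = "\<lambda>ts. fold (\<lambda>t Y. W t ** Y) ts :: real^'d^'n \<Rightarrow> _"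
  define Z where "Z = ?F [a..<a + \<tau> * m] X"
  have \<tau>: "1 \<le> \<tau>" and lam: "lam < 1"
    and col: "\<And>t. 1 v* W t = 1" using mix by (auto simp: mixing_matrices_def)
  have mZ: "mean_matrix Z = mean_matrix X"
    unfolding Z_def mean_matrix_def row_mean_fold_mixing[OF col] ..
  \<comment> \<open>The last round of the next block. Since \<open>1 \<le> \<tau>\<close>, the
    truncated differences in the mixing assumption are exact for this index.\<close>
  define k where "k = a + \<tau> * m + \<tau> - 1"
  have k: "\<tau> - 1 \<le> k" "k + 1 - \<tau> = a + \<tau> * m" "k + 1 = a + \<tau> * Suc m"
    using \<tau> by (auto simp: k_def)
  have "[a..<a + \<tau> * Suc m] = [a..<a + \<tau> * m] @ [a + \<tau> * m..<a + \<tau> * Suc m]"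
    using upt_add_eq_append[of a "a + \<tau> * m" \<tau>] by (simp add: algebra_simps)
  moreover have "[k + 1 - \<tau>..<k + 1] = [a + \<tau> * m..<a + \<tau> * Suc m]"
    by (rule arg_cong2[where f = upt]) (rule k)+
  ultimately have "?F [a..<a + \<tau> * Suc m] X = ?F [k + 1 - \<tau>..<k + 1] Z"
    by (simp only: fold_append comp_def Z_def)
  also have "norm (\<dots> - mean_matrix X) \<le> (1 - lam) * norm (Z - mean_matrix X)"
    using mix k(1) unfolding mixing_matrices_def mZ[symmetric] by blast
  also have "\<dots> \<le> (1 - lam) * ((1 - lam) ^ m * norm (X - mean_matrix X))"
    using Suc lam unfolding Z_def by (intro mult_left_mono) auto
  finally show ?case by (simp add: mult.assoc)
qed simp

text \<open>The bound concerns squared norms, so \<open>m\<close> blocks contribute the exponent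
  \<open>2 * m\<close>. This is the 2 in \<open>\<tau> / (2 * lam)\<close>.\<close>

lemma time_varying_contraction:
  fixes X :: "real^'d^'n"
  assumes mix: "mixing_matrices TYPE('d) E W \<tau> lam" and dvd: "\<tau> dvd T"
    and T: "real T = real \<tau> / (2 * lam) * ln Q" and Q: "0 < Q"
  shows "(norm (time_varying_consensus W T k X - mean_matrix X))\<^sup>2 \<le> (norm (X - mean_matrix X))\<^sup>2 / Q"
proof -
  obtain m where m: "T = \<tau> * m" using dvd by blast
  have \<tau>: "1 \<le> \<tau>" and lam: "0 < lam" "lam < 1" using mix by (auto simp: mixing_matrices_def)
  have lnQ: "2 * lam * real m = ln Q"
    using T \<tau> lam unfolding m by (simp add: field_simps)
  have "norm (time_varying_consensus W T k X - mean_matrix X) \<le> (1 - lam) ^ m * norm (X - mean_matrix X)"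
    unfolding time_varying_consensus_def m by (rule mixing_blocks[OF mix])
  then have "(norm (time_varying_consensus W T k X - mean_matrix X))\<^sup>2
      \<le> ((1 - lam) ^ m * norm (X - mean_matrix X))\<^sup>2"
    by (rule power_mono) simp
  also have "\<dots> = (1 - lam) ^ (2 * m) * (norm (X - mean_matrix X))\<^sup>2"
    by (simp add: power_mult_distrib power_mult[symmetric] mult.commute)
  also have "\<dots> \<le> exp (- ln Q) * (norm (X - mean_matrix X))\<^sup>2"
  proof (rule mult_right_mono)
    have "(1 - lam) ^ (2 * m) \<le> exp (- lam) ^ (2 * m)"
      using exp_ge_add_one_self[of "- lam"] lam by (intro power_mono) auto
    also have "\<dots> = exp (real (2 * m) * (- lam))" by (rule exp_of_nat_mult[symmetric])
    also have "\<dots> = exp (- ln Q)" unfolding lnQ[symmetric] by simp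
    finally show "(1 - lam) ^ (2 * m) \<le> exp (- ln Q)" .
  qed simp
  finally show ?thesis using Q by (simp add: exp_minus divide_inverse mult.commute)
qed

lemma time_varying_linear: "linear (time_varying_consensus W T k)"
  unfolding time_varying_consensus_def by (rule linear_fold_mixing)

lemma time_varying_row_mean:
  "mixing_matrices TYPE('d) E W \<tau> lam \<Longrightarrow> row_mean (time_varying_consensus W T k X) = row_mean X"
  for X :: "real^'d^'n"
  unfolding time_varying_consensus_def by (rule row_mean_fold_mixing) (simp add: mixing_matrices_def)

section \<open>The spectral theorem for self-adjoint operators\<close>

text \<open>A maximizer \<open>v\<close> of the Rayleigh quotient on the unit sphere of
  \<open>S\<close> is an eigenvector: otherwise moving \<open>v\<close> along the residual
  \<open>f v - l v\<close> would increase the quotient to first order.\<close>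

lemma self_adjoint_has_eigenvector:
  fixes f :: "'a::euclidean_space \<Rightarrow> 'a"
  assumes lin: "linear f" and sa: "\<And>x y. inner (f x) y = inner x (f y)"
    and S: "subspace S" "f ` S \<subseteq> S" "S \<noteq> {0}"
  obtains v l where "v \<in> S" "norm v = 1" "f v = l *\<^sub>R v"
proof -
  have "0 \<in> S" using S(1) by (rule subspace_0)
  with S(3) obtain z where z: "z \<in> S" "z \<noteq> 0" by blast
  have "(1 / norm z) *\<^sub>R z \<in> S \<inter> sphere 0 1"
    using z S(1) by (simp add: subspace_scale)
  then have ne: "S \<inter> sphere 0 1 \<noteq> {}" by blast
  have comp: "compact (S \<inter> sphere 0 1)"
    by (rule closed_Int_compact[OF closed_subspace[OF S(1)]]) simp
  have cont: "continuous_on (S \<inter> sphere 0 1) (\<lambda>x. inner (f x) x)"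
    using lin by (intro continuous_intros linear_continuous_on) (simp add: linear_conv_bounded_linear)
  obtain v where v: "v \<in> S \<inter> sphere 0 1" and max: "\<And>x. x \<in> S \<inter> sphere 0 1 \<Longrightarrow> inner (f x) x \<le> inner (f v) v"
    using continuous_attains_sup[OF comp ne cont] by blast
  define l where "l = inner (f v) v"
  have nv: "norm v = 1" and vS: "v \<in> S" using v by auto
  have vv: "inner v v = 1" using nv by (simp add: norm_eq_1)
  have Q: "inner (f x) x \<le> l * inner x x" if "x \<in> S" for x
  proof (cases "x = 0")
    case False
    have "(1 / norm x) *\<^sub>R x \<in> S \<inter> sphere 0 1"
      using False that S(1) by (simp add: subspace_scale)
    from max[OF this] have "inner (f x) x / (norm x)\<^sup>2 \<le> l"
      by (simp add: linear_scale[OF lin] l_def power2_eq_square)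
    then show ?thesis using False by (simp add: divide_le_eq power2_norm_eq_inner)
  qed (simp add: linear_0[OF lin])
  define w where "w = f v - l *\<^sub>R v"
  have wS: "w \<in> S" using vS S by (auto simp: w_def intro!: subspace_diff subspace_scale)
  define c where "c = inner (f w) w - l * inner w w"
  have ww: "inner w w = inner (f v) w - l * inner v w"
  proof -
    have "inner w w = inner (f v - l *\<^sub>R v) w" using w_def by simp
    then show ?thesis by (simp add: inner_diff_left)
  qed
  have key: "2 * t * inner w w + t\<^sup>2 * c \<le> 0" for t
  proof -
    have "inner (f (v + t *\<^sub>R w)) (v + t *\<^sub>R w) \<le> l * inner (v + t *\<^sub>R w) (v + t *\<^sub>R w)"
      using vS wS S(1) by (intro Q subspace_add subspace_scale)
    moreover have "inner (f (v + t *\<^sub>R w)) (v + t *\<^sub>R w)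
        = l + t * inner (f v) w + t * inner (f w) v + t\<^sup>2 * inner (f w) w"
      by (simp add: linear_add[OF lin] linear_scale[OF lin] inner_add_left inner_add_right
        l_def power2_eq_square algebra_simps)
    moreover have "inner (f w) v = inner (f v) w" using sa[of w v] by (simp add: inner_commute)
    moreover have "inner (v + t *\<^sub>R w) (v + t *\<^sub>R w) = 1 + 2 * t * inner v w + t\<^sup>2 * inner w w"
    proof -
      have "inner (v + t *\<^sub>R w) (v + t *\<^sub>R w) = inner v v + t * inner v w + t * inner w v + t\<^sup>2 * inner w w"
        by (simp add: inner_add_left inner_add_right power2_eq_square algebra_simps)
      then show ?thesis using vv by (simp add: inner_commute)
    qed
    ultimately have "l + 2 * t * inner (f v) w + t\<^sup>2 * inner (f w) w
        \<le> l * (1 + 2 * t * inner v w + t\<^sup>2 * inner w w)" by simp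
    moreover have "2 * t * inner w w = 2 * t * inner (f v) w - 2 * t * (l * inner v w)"
      unfolding ww by (simp add: right_diff_distrib)
    ultimately show ?thesis by (simp add: c_def right_diff_distrib distrib_left mult_ac)
  qed
  have "inner w w = 0"
  proof (rule ccontr)
    assume "inner w w \<noteq> 0"
    then have pos: "0 < inner w w" by (metis inner_ge_zero less_eq_real_def)
    \<comment> \<open>Small enough that the second-order term \<open>t^2 * c\<close> cannot outweigh
      \<open>2 * t * inner w w\<close>; the summand 1 avoids a division by zero.\<close>
    define t where "t = inner w w / (\<bar>c\<bar> + 1)"
    have t: "0 < t" using pos by (simp add: t_def add_nonneg_pos)
    have "t * \<bar>c\<bar> \<le> t * (\<bar>c\<bar> + 1)" using t by simp
    also have "\<dots> = inner w w" by (simp add: t_def add_nonneg_eq_0_iff)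
    finally have "t * (- c) \<le> inner w w"
      using t by (smt (verit) mult_left_mono)
    then have "0 < 2 * inner w w + t * c" using pos by linarith
    then have "0 < t * (2 * inner w w + t * c)" using t by simp
    then show False using key[of t] by (simp add: power2_eq_square algebra_simps)
  qed
  then have "f v = l *\<^sub>R v" by (simp add: w_def)
  with vS nv that show ?thesis by blast
qed

text \<open>One eigenvector is split off; its complement in \<open>S\<close> is again invariant by
  self-adjointness. The form with an invariant subspace serves both the whole space and the
  hyperplane orthogonal to the constant vectors.\<close>

lemma self_adjoint_eigenbasis:
  fixes f :: "'a::euclidean_space \<Rightarrow> 'a"
  assumes lin: "linear f" and sa: "\<And>x y. inner (f x) y = inner x (f y)"
  shows "subspace S \<Longrightarrow> f ` S \<subseteq> S \<Longrightarrow>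
    \<exists>B. finite B \<and> B \<subseteq> S \<and> span B = S \<and> pairwise orthogonal B \<and>
      (\<forall>b\<in>B. norm b = 1 \<and> (\<exists>l. f b = l *\<^sub>R b))"
proof (induction "dim S" arbitrary: S rule: less_induct)
  case less
  show ?case
  proof (cases "S = {0}")
    case True
    then show ?thesis by (intro exI[of _ "{}"]) auto
  next
    case False
    obtain v l where v: "v \<in> S" "norm v = 1" "f v = l *\<^sub>R v"
      using self_adjoint_has_eigenvector[OF lin sa less.prems False] by blast
    define S' where "S' = S \<inter> {x. inner v x = 0}"
    have sub': "subspace S'"
      unfolding S'_def by (intro subspace_inter less.prems subspace_hyperplane)
    have inv': "f ` S' \<subseteq> S'"
      using less.prems(2) sa[of v] v(3) by (auto simp: S'_def) (metis inner_scaleR_left mult_zero_right)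
    have vv: "inner v v = 1" using v(2) by (simp add: norm_eq_1)
    have "v \<notin> S'" using vv by (simp add: S'_def)
    moreover have "S' \<subseteq> S" by (simp add: S'_def)
    ultimately have "S' \<subset> S" using v(1) by blast
    then have "dim S' < dim S"
      using sub' less.prems(1) by (metis dim_psubset span_eq_iff)
    from less.hyps[OF this sub' inv'] obtain B where
      B: "finite B" "B \<subseteq> S'" "span B = S'" "pairwise orthogonal B"
        "\<forall>b\<in>B. norm b = 1 \<and> (\<exists>l. f b = l *\<^sub>R b)" by blast
    have "span (insert v B) = S"
    proof
      show "span (insert v B) \<subseteq> S"
        using v(1) B(2) less.prems(1) by (intro span_minimal) (auto simp: S'_def)
      show "S \<subseteq> span (insert v B)"
      proof
        fix x assume x: "x \<in> S"
        have "x - inner v x *\<^sub>R v \<in> S'"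
          using x v(1) less.prems(1) vv by (auto simp: S'_def inner_diff_right intro!: subspace_diff subspace_scale)
        then have "x - inner v x *\<^sub>R v \<in> span (insert v B)"
          using B(3) span_mono[of B "insert v B"] by blast
        then have "(x - inner v x *\<^sub>R v) + inner v x *\<^sub>R v \<in> span (insert v B)"
          by (rule span_add) (intro span_scale span_base, simp)
        then show "x \<in> span (insert v B)" by simp
      qed
    qed
    moreover have "pairwise orthogonal (insert v B)"
      using B(2,4) by (auto simp: pairwise_insert S'_def orthogonal_def inner_commute)
    ultimately show ?thesis
      using B v by (intro exI[of _ "insert v B"]) (auto simp: S'_def)
  qed
qed

section \<open>Polynomials of a symmetric matrix\<close>

lemma inner_symmetric_matrix:
  fixes W :: "real^'n^'n"
  assumes "\<And>i j. W $ i $ j = W $ j $ i"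
  shows "inner (W *v x) y = inner x (W *v y)"
proof -
  have "inner (W *v x) y = (\<Sum>i\<in>UNIV. \<Sum>j\<in>UNIV. W $ i $ j * x $ j * y $ i)"
    by (simp add: inner_vec_def matrix_vector_mult_def sum_distrib_right)
  also have "\<dots> = (\<Sum>j\<in>UNIV. \<Sum>i\<in>UNIV. W $ i $ j * x $ j * y $ i)" by (rule sum.swap)
  also have "\<dots> = (\<Sum>j\<in>UNIV. \<Sum>i\<in>UNIV. W $ j $ i * x $ j * y $ i)"
    using assms by simp
  also have "\<dots> = inner x (W *v y)"
    by (simp add: inner_vec_def matrix_vector_mult_def sum_distrib_left mult_ac)
  finally show ?thesis .
qed

text \<open>Multiplication by \<open>W\<close> acts on every column of the stacked matrix
  separately, and the squared Frobenius norm is the sum over the columns. Contraction thus reduces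
  to this vector version.\<close>

definition poly_apply_vec :: "real poly \<Rightarrow> real^'n^'n \<Rightarrow> real^'n \<Rightarrow> real^'n" where
  "poly_apply_vec p W x = (\<Sum>j\<le>degree p. coeff p j *\<^sub>R ((\<lambda>y. W *v y) ^^ j) x)"

lemma column_matrix_mult: "column j (W ** X) = W *v column j X"
  by (simp add: column_def matrix_matrix_mult_def matrix_vector_mult_def vec_eq_iff)

lemma column_iterate:
  fixes W :: "real^'n^'n"
  shows "column j (((\<lambda>Y. W ** Y) ^^ k) X) = ((\<lambda>y. W *v y) ^^ k) (column j X)"
  by (induction k) (simp_all add: column_matrix_mult)

lemma column_sum: "column j (\<Sum>k\<in>K. X k) = (\<Sum>k\<in>K. column j (X k))"
  by (simp add: column_def vec_eq_iff)

lemma column_scaleR: "column j (c *\<^sub>R X) = c *\<^sub>R column j X" for X :: "real^'d^'n"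
  by (simp add: column_def vec_eq_iff)

lemma column_poly_apply: "column j (poly_apply p W X) = poly_apply_vec p W (column j X)"
  by (simp add: poly_apply_def poly_apply_vec_def column_sum column_scaleR column_iterate)

lemma norm_sq_columns: "(norm X)\<^sup>2 = (\<Sum>j\<in>UNIV. (norm (column j X))\<^sup>2)" for X :: "real^'d^'n"
proof -
  have "(norm X)\<^sup>2 = (\<Sum>i\<in>UNIV. \<Sum>j\<in>UNIV. (X $ i $ j)\<^sup>2)"
    by (simp add: norm_vec_def L2_set_def sum_nonneg)
  also have "\<dots> = (\<Sum>j\<in>UNIV. \<Sum>i\<in>UNIV. (X $ i $ j)\<^sup>2)" by (rule sum.swap)
  finally show ?thesis by (simp add: norm_vec_def L2_set_def sum_nonneg column_def)
qed

lemma linear_iterate: "linear f \<Longrightarrow> linear (f ^^ k)" for f :: "'a::real_vector \<Rightarrow> 'a"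
  by (induction k) (auto intro: linear_compose linear_id[unfolded id_def] simp: id_def)

lemma linear_poly_apply_vec: "linear (poly_apply_vec p W)"
  unfolding poly_apply_vec_def
  by (intro linear_compose_sum ballI linear_compose_scale_right linear_iterate matrix_vector_mul_linear)

lemma linear_poly_apply: "linear (poly_apply p W)"
  unfolding poly_apply_def
  by (intro linear_compose_sum ballI linear_compose_scale_right linear_iterate linear_matrix_mult)

lemma poly_apply_vec_eigenvector:
  assumes "W *v x = l *\<^sub>R x"
  shows "poly_apply_vec p W x = poly p l *\<^sub>R x"
proof -
  have "((\<lambda>y. W *v y) ^^ k) x = l ^ k *\<^sub>R x" for k
    by (induction k) (simp_all add: assms linear_scale[OF matrix_vector_mul_linear] mult.commute)
  then show ?thesis
    by (simp add: poly_apply_vec_def poly_altdef scaleR_sum_left)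
qed

text \<open>Parseval in the eigenbasis \<open>B\<close>: the coordinate along \<open>b\<close> is
  multiplied by \<open>poly p (l b)\<close>.\<close>

lemma poly_apply_vec_bound:
  fixes W :: "real^'n^'n"
  assumes B: "finite B" "pairwise orthogonal B" "\<And>b. b \<in> B \<Longrightarrow> norm b = 1"
    and eig: "\<And>b. b \<in> B \<Longrightarrow> W *v b = l b *\<^sub>R b"
    and c: "\<And>b. b \<in> B \<Longrightarrow> \<bar>poly p (l b)\<bar> \<le> c" and x: "x \<in> span B"
  shows "(norm (poly_apply_vec p W x))\<^sup>2 \<le> c\<^sup>2 * (norm x)\<^sup>2"
proof -
  have ex: "(\<Sum>b\<in>B. inner x b *\<^sub>R b) = x"
    by (rule orthonormal_basis_expand[OF B(2,3) x B(1)])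
  have pyth: "(norm (\<Sum>b\<in>B. a b *\<^sub>R b))\<^sup>2 = (\<Sum>b\<in>B. (a b)\<^sup>2)" for a
  proof -
    have "(norm (\<Sum>b\<in>B. a b *\<^sub>R b))\<^sup>2 = (\<Sum>b\<in>B. (norm (a b *\<^sub>R b))\<^sup>2)"
      by (rule norm_sum_Pythagorean[OF B(1)])
        (use B(2) in \<open>auto simp: pairwise_def orthogonal_def\<close>)
    also have "\<dots> = (\<Sum>b\<in>B. (a b)\<^sup>2)" using B(3) by (intro sum.cong) auto
    finally show ?thesis .
  qed
  have "poly_apply_vec p W x = poly_apply_vec p W (\<Sum>b\<in>B. inner x b *\<^sub>R b)" by (simp add: ex)
  also have "\<dots> = (\<Sum>b\<in>B. inner x b *\<^sub>R poly_apply_vec p W b)"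
    by (simp add: linear_sum[OF linear_poly_apply_vec] linear_scale[OF linear_poly_apply_vec])
  also have "\<dots> = (\<Sum>b\<in>B. (inner x b * poly p (l b)) *\<^sub>R b)"
    using poly_apply_vec_eigenvector[OF eig] by (intro sum.cong) auto
  finally have "(norm (poly_apply_vec p W x))\<^sup>2 = (\<Sum>b\<in>B. (inner x b * poly p (l b))\<^sup>2)"
    by (simp add: pyth)
  also have "\<dots> \<le> (\<Sum>b\<in>B. c\<^sup>2 * (inner x b)\<^sup>2)"
  proof (rule sum_mono)
    fix b assume "b \<in> B"
    from c[OF this] have "(poly p (l b))\<^sup>2 \<le> c\<^sup>2"
      by (metis abs_ge_zero order_trans abs_of_nonneg power2_abs power_mono)
    then show "(inner x b * poly p (l b))\<^sup>2 \<le> c\<^sup>2 * (inner x b)\<^sup>2"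
      using mult_right_mono[of "(poly p (l b))\<^sup>2" "c\<^sup>2" "(inner x b)\<^sup>2"]
      by (simp add: power_mult_distrib mult.commute)
  qed
  also have "\<dots> = c\<^sup>2 * (norm (\<Sum>b\<in>B. inner x b *\<^sub>R b))\<^sup>2"
    by (simp add: pyth sum_distrib_left)
  finally show ?thesis by (simp add: ex)
qed

section \<open>Metropolis weights\<close>

lemma metropolis_facts:
  fixes G :: "('n::finite \<times> 'n) set"
  assumes "sym G" "irrefl G"
  shows "metropolis G $ i $ j = metropolis G $ j $ i"
    and "0 \<le> metropolis G $ i $ j"
    and "(\<Sum>j\<in>UNIV. metropolis G $ i $ j) = 1"
proof -
  define w where "w i j = (if (i, j) \<in> G then 1 / (1 + real (max (degree_in G i) (degree_in G j))) else 0)" for i j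
  have M: "metropolis G $ i $ j = (if i = j then 1 - (\<Sum>k\<in>UNIV - {i}. w i k) else w i j)" for i j
    by (cases "i = j") (simp_all add: metropolis_def w_def Let_def)
  have w_sym: "w i j = w j i" for i j
    using assms(1) by (auto simp: w_def sym_def max.commute)
  show "metropolis G $ i $ j = metropolis G $ j $ i"
    by (cases "i = j") (simp_all add: M w_sym[of i j])
  \<comment> \<open>Each weight in row \<open>i\<close> is at most 1 / (1 + d), with
    \<open>d\<close> the degree of \<open>i\<close>, and at most \<open>d\<close> of them are
    nonzero. Hence the diagonal entry is nonnegative.\<close>
  have "(\<Sum>k\<in>UNIV - {i}. w i k) \<le> (\<Sum>k\<in>UNIV - {i}. if (i, k) \<in> G then 1 / (1 + real (degree_in G i)) else 0)" for i
    by (intro sum_mono) (auto simp: w_def intro!: divide_left_mono mult_pos_pos)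
  also have "\<dots> i = real (card {k \<in> UNIV - {i}. (i, k) \<in> G}) * (1 / (1 + real (degree_in G i)))" for i
    by (simp add: sum.If_cases Int_def conj_commute)
  also have "\<dots> i \<le> real (degree_in G i) * (1 / (1 + real (degree_in G i)))" for i
    unfolding degree_in_def by (intro mult_right_mono of_nat_mono card_mono) auto
  also have "\<dots> i \<le> 1" for i by simp
  finally have "(\<Sum>k\<in>UNIV - {i}. w i k) \<le> 1" for i .
  moreover have "0 \<le> w i j" for i j by (simp add: w_def)
  ultimately show "0 \<le> metropolis G $ i $ j" by (simp add: M)
  have "(\<Sum>j\<in>UNIV. metropolis G $ i $ j) = metropolis G $ i $ i + (\<Sum>j\<in>UNIV - {i}. metropolis G $ i $ j)"
    by (simp add: sum.remove)
  also have "(\<Sum>j\<in>UNIV - {i}. metropolis G $ i $ j) = (\<Sum>j\<in>UNIV - {i}. w i j)"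
    by (intro sum.cong) (auto simp: M)
  finally show "(\<Sum>j\<in>UNIV. metropolis G $ i $ j) = 1" by (simp add: M)
qed

locale gossip_matrix =
  fixes W :: "real^'n^'n"
  assumes symmetric: "W $ i $ j = W $ j $ i" and nonneg: "0 \<le> W $ i $ j"
    and row_sum: "(\<Sum>j\<in>UNIV. W $ i $ j) = 1"
    and two: "2 \<le> CARD('n)" and gap: "second_eigenvalue W < 1"
begin

section \<open>Spectrum of a gossip matrix\<close>

lemma W_one: "W *v 1 = 1"
  by (simp add: vec_eq_iff matrix_vector_mult_def row_sum)

lemma one_W: "1 v* W = 1"
  using row_sum symmetric by (simp add: vec_eq_iff vector_matrix_mult_def)

text \<open>At a coordinate of largest modulus the eigenvalue equation compares that modulus with a
  convex combination of smaller or equal ones.\<close>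

lemma eigenvalue_abs_le_1:
  assumes "x \<noteq> 0" "W *v x = l *\<^sub>R x"
  shows "\<bar>l\<bar> \<le> 1"
proof -
  obtain i where i: "\<And>j. \<bar>x $ j\<bar> \<le> \<bar>x $ i\<bar>"
  proof -
    have "Max (range (\<lambda>j. \<bar>x $ j\<bar>)) \<in> range (\<lambda>j. \<bar>x $ j\<bar>)" by (rule Max_in) auto
    then obtain i where "Max (range (\<lambda>j. \<bar>x $ j\<bar>)) = \<bar>x $ i\<bar>" by blast
    then have "\<bar>x $ j\<bar> \<le> \<bar>x $ i\<bar>" for j by (metis Max_ge finite_imageI finite rangeI)
    then show ?thesis using that by blast
  qed
  have xi: "0 < \<bar>x $ i\<bar>"
  proof (rule ccontr)
    assume "\<not> ?thesis"
    then have "x $ j = 0" for j using i[of j] by simp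
    then show False using assms(1) by (simp add: vec_eq_iff)
  qed
  have "l * x $ i = (\<Sum>j\<in>UNIV. W $ i $ j * x $ j)"
    using arg_cong[OF assms(2), of "\<lambda>y. y $ i"] by (simp add: matrix_vector_mult_def)
  then have "\<bar>l\<bar> * \<bar>x $ i\<bar> = \<bar>\<Sum>j\<in>UNIV. W $ i $ j * x $ j\<bar>" by (metis abs_mult)
  also have "\<dots> \<le> (\<Sum>j\<in>UNIV. W $ i $ j * \<bar>x $ i\<bar>)"
    by (rule order_trans[OF sum_abs]) (auto intro!: sum_mono mult_left_mono simp: abs_mult nonneg i)
  also have "\<dots> = 1 * \<bar>x $ i\<bar>" by (simp add: sum_distrib_right[symmetric] row_sum)
  finally show ?thesis using xi by (simp add: mult_le_cancel_right)
qed

lemma self_adjoint: "inner (W *v x) y = inner x (W *v y)"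
  by (rule inner_symmetric_matrix[OF symmetric])

text \<open>An eigenvector is not orthogonal to the whole eigenbasis, and by self-adjointness it
  shares its eigenvalue with any basis vector it is not orthogonal to. Finiteness gives
  \<open>Min\<close> and \<open>Max\<close> over eigenvalues their meaning.\<close>

lemma finite_eigenvalues: "finite (eigenvalues W)"
proof -
  obtain B where B: "finite B" "span B = UNIV" "\<forall>b\<in>B. \<exists>l. W *v b = l *\<^sub>R b"
    using self_adjoint_eigenbasis[OF matrix_vector_mul_linear self_adjoint, of UNIV] by auto
  then obtain l where l: "\<And>b. b \<in> B \<Longrightarrow> W *v b = l b *\<^sub>R b" by metis
  have "eigenvalues W \<subseteq> l ` B"
  proof
    fix m assume "m \<in> eigenvalues W"
    then obtain x where x: "x \<noteq> 0" "W *v x = m *\<^sub>R x" by (auto simp: eigenvalues_def)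
    have "\<exists>b\<in>B. inner x b \<noteq> 0"
    proof (rule ccontr)
      assume "\<not> ?thesis"
      then have "orthogonal x b" if "b \<in> B" for b using that by (simp add: orthogonal_def)
      then have "orthogonal x y" if "y \<in> span B" for y
        using orthogonal_to_span[OF that] by blast
      then show False using B(2) x(1) by (metis UNIV_I orthogonal_self)
    qed
    then obtain b where b: "b \<in> B" "inner x b \<noteq> 0" by blast
    have "m * inner x b = l b * inner x b"
      using self_adjoint[of x b] x(2) l[OF b(1)] by simp
    with b show "m \<in> l ` B" by auto
  qed
  with B(1) show ?thesis by (meson finite_imageI finite_subset)
qed

lemma dim_eigenspace_pos:
  assumes "m \<in> eigenvalues W" shows "1 \<le> dim {x. W *v x = m *\<^sub>R x}"
proof -
  obtain x where "x \<noteq> 0" "W *v x = m *\<^sub>R x" using assms by (auto simp: eigenvalues_def)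
  then have "\<not> {x. W *v x = m *\<^sub>R x} \<subseteq> {0}" by blast
  then have "dim {x. W *v x = m *\<^sub>R x} \<noteq> 0" unfolding dim_eq_0 .
  then show ?thesis by linarith
qed

lemma one_eigenvalue: "1 \<in> eigenvalues W"
  unfolding eigenvalues_def using W_one by (auto intro!: exI[of _ 1] simp: vec_eq_iff)

definition "second_set =
  {l \<in> eigenvalues W. 2 \<le> (\<Sum>m | m \<in> eigenvalues W \<and> l \<le> m. dim {x. W *v x = m *\<^sub>R x})}"

lemma second_eigenvalue_Max: "second_eigenvalue W = Max second_set"
  by (simp add: second_eigenvalue_def second_set_def)

text \<open>The constant vector always supplies one dimension at the eigenvalue 1. A second one
  comes from \<open>x\<close>: in the same eigenspace if \<open>l = 1\<close>, and from the
  eigenspace of \<open>l\<close> otherwise.\<close>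

lemma orthogonal_eigenvalue_in_second_set:
  assumes x: "x \<noteq> 0" "inner 1 x = 0" "W *v x = l *\<^sub>R x"
  shows "l \<in> second_set"
proof -
  let ?K = "{m. m \<in> eigenvalues W \<and> l \<le> m}"
  have l: "l \<in> eigenvalues W" using x by (auto simp: eigenvalues_def)
  have l1: "l \<le> 1" using eigenvalue_abs_le_1[OF x(1,3)] by simp
  have fin: "finite ?K" using finite_eigenvalues by simp
  have "2 \<le> (\<Sum>m\<in>?K. dim {x. W *v x = m *\<^sub>R x})"
  proof (cases "l = 1")
    case True
    have "independent {1, x}"
      by (rule pairwise_orthogonal_independent)
        (use x in \<open>auto simp: pairwise_def orthogonal_def inner_commute vec_eq_iff\<close>)
    moreover have "{1, x} \<subseteq> {x. W *v x = 1 *\<^sub>R x}" using x W_one True by auto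
    ultimately have "card {1, x} \<le> dim {x. W *v x = 1 *\<^sub>R x}"
      by (intro independent_card_le_dim)
    moreover have "x \<noteq> 1" using x by auto
    ultimately have "2 \<le> dim {x. W *v x = 1 *\<^sub>R x}" by (simp add: card_insert_if)
    also have "\<dots> \<le> (\<Sum>m\<in>?K. dim {x. W *v x = m *\<^sub>R x})"
      using fin l1 one_eigenvalue by (intro member_le_sum[of 1 ?K "\<lambda>m. dim {x. W *v x = m *\<^sub>R x}"]) auto
    finally show ?thesis .
  next
    case False
    have "2 \<le> (\<Sum>m\<in>{l, 1}. dim {x. W *v x = m *\<^sub>R x})"
      using False dim_eigenspace_pos[OF l] dim_eigenspace_pos[OF one_eigenvalue] by simp
    also have "\<dots> \<le> (\<Sum>m\<in>?K. dim {x. W *v x = m *\<^sub>R x})"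
      using fin l l1 one_eigenvalue by (intro sum_mono2) auto
    finally show ?thesis .
  qed
  with l show ?thesis by (simp add: second_set_def)
qed

lemma orthogonal_eigenvalue_bounds:
  assumes "x \<noteq> 0" "inner 1 x = 0" "W *v x = l *\<^sub>R x"
  shows "Min (eigenvalues W) \<le> l" "l \<le> second_eigenvalue W"
proof -
  have "l \<in> second_set" by (rule orthogonal_eigenvalue_in_second_set[OF assms])
  then show "Min (eigenvalues W) \<le> l" "l \<le> second_eigenvalue W"
    using finite_eigenvalues unfolding second_eigenvalue_Max
    by (auto simp: second_set_def intro!: Min_le Max_ge)
qed

lemma orthogonal_eigenbasis:
  "\<exists>B l. finite B \<and> span B = {x. inner 1 x = 0} \<and> pairwise orthogonal B \<and>
    (\<forall>b\<in>B. norm b = 1 \<and> W *v b = l b *\<^sub>R b)"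
proof -
  let ?S = "{x::real^'n. inner 1 x = 0}"
  have "inner 1 (W *v x) = inner 1 x" for x
    using self_adjoint[of 1 x] by (simp add: W_one)
  then have inv: "(\<lambda>x. W *v x) ` ?S \<subseteq> ?S" by auto
  obtain B where B: "finite B" "span B = ?S" "pairwise orthogonal B"
    "\<forall>b\<in>B. norm b = 1 \<and> (\<exists>l. W *v b = l *\<^sub>R b)"
    using self_adjoint_eigenbasis[OF matrix_vector_mul_linear self_adjoint subspace_hyperplane inv] by blast
  from B(4) obtain l where "\<forall>b\<in>B. norm b = 1 \<and> W *v b = l b *\<^sub>R b" by metis
  with B show ?thesis by blast
qed

lemma eigenvalue_range: "-1 \<le> Min (eigenvalues W)" "Min (eigenvalues W) \<le> second_eigenvalue W"
proof -
  have "Min (eigenvalues W) \<in> eigenvalues W"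
    using finite_eigenvalues one_eigenvalue by (intro Min_in) auto
  then show "-1 \<le> Min (eigenvalues W)"
    using eigenvalue_abs_le_1 by (fastforce simp: eigenvalues_def)
  obtain i j :: 'n where ij: "i \<noteq> j"
  proof -
    have "\<not> (\<forall>i j :: 'n. i = j)"
    proof
      assume "\<forall>i j :: 'n. i = j"
      then have "(UNIV :: 'n set) = {undefined}" by auto
      then have "CARD('n) = 1" by (metis card_1_singleton_iff One_nat_def)
      with two show False by simp
    qed
    then show ?thesis using that by blast
  qed
  obtain B l where B: "finite B" "span B = {x. inner 1 x = 0}"
    "\<forall>b\<in>B. norm b = 1 \<and> W *v b = l b *\<^sub>R b" using orthogonal_eigenbasis by blast
  \<comment> \<open>Two distinct nodes provide a nonzero vector orthogonal to the constants, so the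
    eigenbasis of the hyperplane is not empty.\<close>
  have "inner 1 (axis i 1 - axis j 1 :: real^'n) = 0"
    by (simp add: inner_diff_right inner_axis)
  then have "(axis i 1 - axis j 1 :: real^'n) \<in> span B" using B(2) by simp
  moreover have "(axis i 1 - axis j 1 :: real^'n) \<noteq> 0"
    using ij by (auto simp: vec_eq_iff axis_def intro!: exI[of _ i])
  ultimately have "B \<noteq> {}" by auto
  then obtain b where b: "b \<in> B" by blast
  then have "inner 1 b = 0" using B(2) span_base[OF b] by auto
  moreover have "b \<noteq> 0" using B(3) b by force
  ultimately show "Min (eigenvalues W) \<le> second_eigenvalue W"
    using orthogonal_eigenvalue_bounds[of b "l b"] B(3) b by force
qed

lemma poly_apply_mean:
  fixes X :: "real^'d^'n"
  assumes "poly p 1 = 1"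
  shows "row_mean (poly_apply p W X) = row_mean X"
    and "poly_apply p W (mean_matrix X) = mean_matrix X"
proof -
  have coeffs: "(\<Sum>j\<le>degree p. coeff p j) = 1" using assms by (simp add: poly_altdef)
  have "row_mean (((\<lambda>Y. W ** Y) ^^ k) X) = row_mean X" for k
    by (induction k) (simp_all add: row_mean_matrix_mult[OF one_W])
  then show "row_mean (poly_apply p W X) = row_mean X"
    by (simp add: poly_apply_def linear_sum[OF linear_row_mean] linear_scale[OF linear_row_mean]
        scaleR_sum_left[symmetric] coeffs)
  have "((\<lambda>Y. W ** Y) ^^ k) (mean_matrix X) = mean_matrix X" for k
    by (induction k) (simp_all add: matrix_mult_mean_matrix[OF W_one])
  then show "poly_apply p W (mean_matrix X) = mean_matrix X"
    by (simp add: poly_apply_def scaleR_sum_left[symmetric] coeffs)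
qed

lemma poly_apply_contraction:
  fixes X :: "real^'d^'n"
  assumes p1: "poly p 1 = 1"
    and c: "\<And>l. Min (eigenvalues W) \<le> l \<Longrightarrow> l \<le> second_eigenvalue W \<Longrightarrow> \<bar>poly p l\<bar> \<le> c"
  shows "(norm (poly_apply p W X - mean_matrix X))\<^sup>2 \<le> c\<^sup>2 * (norm (X - mean_matrix X))\<^sup>2"
proof -
  define Z where "Z = X - mean_matrix X"
  obtain B l where B: "finite B" "span B = {x. inner 1 x = 0}" "pairwise orthogonal B"
    "\<forall>b\<in>B. norm b = 1 \<and> W *v b = l b *\<^sub>R b" using orthogonal_eigenbasis by blast
  have bd: "\<bar>poly p (l b)\<bar> \<le> c" if "b \<in> B" for b
  proof (rule c)
    have "inner 1 b = 0" using B(2) span_base[OF that] by auto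
    moreover have "b \<noteq> 0" using B(4) that by force
    ultimately show "Min (eigenvalues W) \<le> l b" "l b \<le> second_eigenvalue W"
      using orthogonal_eigenvalue_bounds[of b "l b"] B(4) that by auto
  qed
  have "inner 1 (column j Z) = 0" for j
  proof -
    have "row_mean Z = 0" by (simp add: Z_def linear_diff[OF linear_row_mean])
    then have "(\<Sum>i\<in>UNIV. Z $ i) = 0" by (simp add: row_mean_def)
    then have "(\<Sum>i\<in>UNIV. Z $ i) $ j = 0" by simp
    then show ?thesis by (simp add: inner_vec_def column_def)
  qed
  then have col: "column j Z \<in> span B" for j using B(2) by simp
  have "poly_apply p W X - mean_matrix X = poly_apply p W Z"
    by (simp add: Z_def linear_diff[OF linear_poly_apply] poly_apply_mean(2)[OF p1])
  then have "(norm (poly_apply p W X - mean_matrix X))\<^sup>2 = (\<Sum>j\<in>UNIV. (norm (poly_apply_vec p W (column j Z)))\<^sup>2)"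
    by (simp add: norm_sq_columns column_poly_apply)
  also have "\<dots> \<le> (\<Sum>j\<in>UNIV. c\<^sup>2 * (norm (column j Z))\<^sup>2)"
    using B bd col by (intro sum_mono poly_apply_vec_bound[where B = B and l = l]) auto
  also have "\<dots> = c\<^sup>2 * (norm Z)\<^sup>2" by (simp add: norm_sq_columns sum_distrib_left)
  finally show ?thesis by (simp add: Z_def)
qed

end

section \<open>Chebyshev polynomials\<close>

lemma chebyshev_cos: "poly (chebyshev T) (cos t) = cos (real T * t)"
proof (induction T rule: chebyshev.induct)
  case (3 k)
  have "cos (real (Suc (Suc k)) * t) + cos (real k * t) = 2 * cos t * cos (real (Suc k) * t)"
    using cos_times_cos[of t "real (Suc k) * t"] cos_minus[of "real k * t"]
    by (simp add: algebra_simps)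
  then show ?case using 3 by (simp add: algebra_simps)
qed simp_all

lemma chebyshev_abs_le_1: "\<bar>y\<bar> \<le> 1 \<Longrightarrow> \<bar>poly (chebyshev T) y\<bar> \<le> 1"
  using chebyshev_cos[of T "arccos y"] by (simp add: cos_arccos_abs)

text \<open>The closed form outside the interval [-1, 1], where the cosine formula no longer
  applies.\<close>

lemma chebyshev_Joukowski:
  assumes w: "w \<noteq> 0" and z: "2 * z = w + 1 / w"
  shows "2 * poly (chebyshev T) z = w ^ T + 1 / w ^ T"
proof (induction T rule: chebyshev.induct)
  case (3 k)
  have "2 * poly (chebyshev (Suc (Suc k))) z
      = (2 * z) * (2 * poly (chebyshev (Suc k)) z) - 2 * poly (chebyshev k) z"
    by (simp add: algebra_simps)
  also have "\<dots> = (w + 1 / w) * (w ^ Suc k + 1 / w ^ Suc k) - (w ^ k + 1 / w ^ k)"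
    using 3 z by simp
  also have "\<dots> = w ^ Suc (Suc k) + 1 / w ^ Suc (Suc k)"
    using w by (simp add: field_simps)
  finally show ?case .
qed (use z in simp_all)

text \<open>For \<open>y = sqrt g\<close> the right-hand side is a lower bound of
  \<open>z + sqrt (z^2 - 1)\<close> when \<open>z \<ge> 1 + g\<close>. The range
  \<open>y^2 \<le> 2\<close> admits every spectral gap of eigenvalues in [-1, 1]. Halving the
  argument brings it below 1, as \<open>exp_bound\<close> demands.\<close>

lemma exp_le_sqrt2_quadratic:
  assumes "0 \<le> y" "y\<^sup>2 \<le> (2::real)"
  shows "exp y \<le> 1 + y\<^sup>2 + sqrt 2 * y"
proof -
  have "y \<le> 142 / 100"
  proof (rule power2_le_imp_le)
    show "y\<^sup>2 \<le> (142 / 100)\<^sup>2" using assms(2) by (simp add: power2_eq_square)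
  qed simp
  have "exp (y / 2) \<le> 1 + y / 2 + (y / 2)\<^sup>2"
    by (rule exp_bound) (use assms \<open>y \<le> 142 / 100\<close> in auto)
  then have "exp (y / 2) ^ 2 \<le> (1 + y / 2 + (y / 2)\<^sup>2) ^ 2" by (rule power_mono) simp
  moreover have "exp (y / 2) ^ 2 = exp y" by (simp add: power2_eq_square exp_add[symmetric])
  moreover have "(1 + y / 2 + (y / 2)\<^sup>2) ^ 2 = 1 + y\<^sup>2 + y - y\<^sup>2 / 4 + y * (y\<^sup>2 / 4) + y\<^sup>2 * (y\<^sup>2 / 16)"
    by (simp add: power2_eq_square algebra_simps)
  moreover have "y\<^sup>2 * (y\<^sup>2 / 16) \<le> 2 * (y\<^sup>2 / 16)" using assms(2) by (intro mult_right_mono) auto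
  moreover have "y * (y\<^sup>2 / 4) + 2 * (y\<^sup>2 / 16) - y\<^sup>2 / 4 \<le> 4 / 10 * y"
  proof -
    have "y\<^sup>2 / 4 - y / 8 \<le> 4 / 10"
    proof -
      have "y * y \<le> 142 / 100 * y" using assms(1) \<open>y \<le> 142 / 100\<close> by (rule mult_right_mono[rotated])
      then show ?thesis using \<open>y \<le> 142 / 100\<close> by (simp add: power2_eq_square)
    qed
    then have "y * (y\<^sup>2 / 4 - y / 8) \<le> y * (4 / 10)" using assms(1) by (rule mult_left_mono)
    then show ?thesis by (simp add: power2_eq_square algebra_simps)
  qed
  moreover have "14 / 10 * y \<le> sqrt 2 * y"
    using assms(1) by (intro mult_right_mono real_le_rsqrt) (auto simp: power2_eq_square)
  ultimately show ?thesis by linarith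
qed

lemma chebyshev_growth:
  assumes g: "0 < g" "g \<le> 2" and z: "1 + g \<le> z"
  shows "exp (real T * sqrt g) / 2 \<le> poly (chebyshev T) z"
proof -
  define w where "w = z + sqrt (z\<^sup>2 - 1)"
  have z2: "2 * g + g\<^sup>2 \<le> z\<^sup>2 - 1"
    using power_mono[OF z, of 2] g by (simp add: power2_eq_square algebra_simps)
  have "sqrt 2 * sqrt g = sqrt (2 * g)" by (simp add: real_sqrt_mult)
  also have "\<dots> \<le> sqrt (z\<^sup>2 - 1)" using z2 by (intro real_sqrt_le_mono) (smt (verit) zero_le_power2)
  finally have w_ge: "exp (sqrt g) \<le> w"
    using exp_le_sqrt2_quadratic[of "sqrt g"] g z by (simp add: w_def)
  have w0: "0 < w" by (rule less_le_trans[OF _ w_ge]) simp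
  have "w * (z - sqrt (z\<^sup>2 - 1)) = z\<^sup>2 - (sqrt (z\<^sup>2 - 1))\<^sup>2"
    unfolding w_def by (simp add: power2_eq_square algebra_simps)
  also have "\<dots> = 1" 
  proof -
    have "0 \<le> 2 * g + g\<^sup>2" using g by simp
    then show ?thesis using z2 by simp
  qed
  finally have "z - sqrt (z\<^sup>2 - 1) = 1 / w" using w0 by (simp add: field_simps)
  then have "2 * z = w + 1 / w" by (simp add: w_def)
  then have "2 * poly (chebyshev T) z = w ^ T + 1 / w ^ T"
    using w0 by (intro chebyshev_Joukowski) auto
  moreover have "exp (real T * sqrt g) \<le> w ^ T"
    unfolding exp_of_nat_mult using w_ge by (intro power_mono) auto
  moreover have "0 \<le> 1 / w ^ T" using w0 by simp
  ultimately show ?thesis by linarith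
qed

text \<open>The affine map to [-1, 1] sends 1 to \<open>1 + 2 * (1 - b) / (b - a)\<close>. As
  \<open>b - a \<le> 2\<close>, this is at least \<open>1 + (1 - b)\<close>, so
  \<open>chebyshev_growth\<close> applies with \<open>g = 1 - b\<close>.\<close>

lemma scaled_chebyshev_bounds:
  assumes ab: "-1 \<le> a" "a \<le> b" "b < 1" and T: "0 < T"
  shows "poly (scaled_chebyshev a b T) 1 = 1"
    and "a \<le> l \<Longrightarrow> l \<le> b \<Longrightarrow> \<bar>poly (scaled_chebyshev a b T) l\<bar> \<le> 2 / exp (real T * sqrt (1 - b))"
proof -
  define p where "p = (if a < b then chebyshev T \<circ>\<^sub>p [: - (a + b) / (b - a), 2 / (b - a) :] else [: -b, 1 :] ^ T)"
  have S: "scaled_chebyshev a b T = smult (1 / poly p 1) p"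
    by (simp add: scaled_chebyshev_def p_def Let_def)
  have p1: "exp (real T * sqrt (1 - b)) / 2 \<le> poly p 1" if "a < b"
  proof -
    define z where "z = - (a + b) / (b - a) + 2 / (b - a)"
    have "(b - a) * (1 - b) \<le> 2 * (1 - b)" using ab by (intro mult_right_mono) auto
    then have "(1 + (1 - b)) * (b - a) \<le> 2 - (a + b)" by (simp add: algebra_simps)
    then have "1 + (1 - b) \<le> (2 - (a + b)) / (b - a)" using that by (simp add: pos_le_divide_eq)
    also have "\<dots> = z" unfolding z_def by (simp add: diff_divide_distrib add_divide_distrib)
    finally have "1 + (1 - b) \<le> z" .
    then have "exp (real T * sqrt (1 - b)) / 2 \<le> poly (chebyshev T) z"
      using ab by (intro chebyshev_growth) auto
    then show ?thesis using that by (simp add: p_def poly_pcompose z_def)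
  qed
  have pos: "poly p 1 \<noteq> 0"
  proof (cases "a < b")
    case True
    have "0 < exp (real T * sqrt (1 - b)) / 2" by simp
    with p1[OF True] show ?thesis by linarith
  next
    case False
    then show ?thesis using ab by (simp add: p_def poly_power)
  qed
  then show "poly (scaled_chebyshev a b T) 1 = 1" by (simp add: S)
  assume l: "a \<le> l" "l \<le> b"
  show "\<bar>poly (scaled_chebyshev a b T) l\<bar> \<le> 2 / exp (real T * sqrt (1 - b))"
  proof (cases "a < b")
    case True
    have "\<bar>- (a + b) / (b - a) + 2 / (b - a) * l\<bar> = \<bar>2 * l - (a + b)\<bar> / (b - a)"
    proof -
      have "- (a + b) / (b - a) + 2 / (b - a) * l = (2 * l - (a + b)) / (b - a)"
        by (simp add: diff_divide_distrib add_divide_distrib)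
      then show ?thesis using True by simp
    qed
    also have "\<dots> \<le> 1" using l True by (simp add: abs_le_iff)
    finally have "\<bar>poly p l\<bar> \<le> 1"
      using True by (simp add: p_def poly_pcompose chebyshev_abs_le_1 mult.commute)
    moreover have e: "0 < exp (real T * sqrt (1 - b)) / 2" by simp
    ultimately have "\<bar>poly p l\<bar> / \<bar>poly p 1\<bar> \<le> 1 / (exp (real T * sqrt (1 - b)) / 2)"
      using p1[OF True] by (intro frac_le) auto
    then show ?thesis by (simp add: S abs_mult)
  next
    \<comment> \<open>A one-point interval: the polynomial is a power of \<open>x - b\<close> and
      vanishes there, since \<open>T\<close> is positive.\<close>
    case False
    then have "l = b" using l ab by simp
    then have "poly p l = 0" using False T by (simp add: p_def poly_power)
    then show ?thesis by (simp add: S)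
  qed
qed

context gossip_matrix
begin

text \<open>The norm contracts by \<open>2 / Q\<close>, and the square of this is at most
  \<open>1 / Q\<close> as soon as \<open>Q \<ge> 4\<close>. Squaring absorbs the factor 2 of the
  Chebyshev bound.\<close>

lemma static_consensus_facts:
  fixes X :: "real^'d^'n"
  assumes T: "0 < T" "real T = sqrt (chi W) * ln Q" and Q: "4 \<le> Q"
  shows "row_mean (static_consensus W T k X) = row_mean X"
    and "(norm (static_consensus W T k X - mean_matrix X))\<^sup>2 \<le> (norm (X - mean_matrix X))\<^sup>2 / Q"
proof -
  note bounds = scaled_chebyshev_bounds[OF eigenvalue_range gap T(1)]
  show "row_mean (static_consensus W T k X) = row_mean X"
    unfolding static_consensus_def by (rule poly_apply_mean(1)[OF bounds(1)])
  have "real T * sqrt (1 - second_eigenvalue W) = ln Q"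
    using T(2) gap by (simp add: chi_def real_sqrt_divide)
  then have e: "exp (real T * sqrt (1 - second_eigenvalue W)) = Q" using Q by simp
  have "(norm (static_consensus W T k X - mean_matrix X))\<^sup>2 \<le> (2 / Q)\<^sup>2 * (norm (X - mean_matrix X))\<^sup>2"
    unfolding static_consensus_def
    by (rule poly_apply_contraction[OF bounds(1)]) (use bounds(2) in \<open>simp add: e\<close>)
  also have "\<dots> \<le> 1 / Q * (norm (X - mean_matrix X))\<^sup>2"
    using Q by (intro mult_right_mono) (simp_all add: power2_eq_square field_simps)
  finally show "(norm (static_consensus W T k X - mean_matrix X))\<^sup>2 \<le> (norm (X - mean_matrix X))\<^sup>2 / Q" by simp
qed

end

lemma static_consensus_linear: "linear (static_consensus W T k)"
  unfolding static_consensus_def by (rule linear_poly_apply)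

lemma metropolis_gossip:
  fixes G :: "('n::finite \<times> 'n) set"
  assumes "static_graph G"
  shows "gossip_matrix (metropolis G)"
proof -
  have "sym G" "irrefl G" using assms by (auto simp: static_graph_def)
  then show ?thesis
    using assms by unfold_locales (auto simp: static_graph_def metropolis_facts intro: metropolis_facts(1))
qed

section \<open>Stacked random vectors\<close>

lemma component_measurable:
  "X \<in> borel_measurable N \<Longrightarrow> (\<lambda>w. (X w :: real^'d^'n) $ i) \<in> borel_measurable N"
  by (rule measurable_compose[where g = "\<lambda>x. x $ i" and L = borel and N = borel])
    (auto intro!: borel_measurable_continuous_onI linear_continuous_on bounded_linear_vec_nth)

lemma stacked_measurable:
  fixes X :: "'w \<Rightarrow> real^'d^'n"
  assumes "\<And>i. (\<lambda>w. X w $ i) \<in> borel_measurable N"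
  shows "X \<in> borel_measurable N"
proof -
  have "(\<lambda>w. inner (X w) b) \<in> borel_measurable N" if "b \<in> Basis" for b
  proof -
    from that obtain i u where "b = axis i u" by (auto simp: Basis_vec_def)
    then have eq: "(\<lambda>w. inner (X w) b) = (\<lambda>w. inner (X w $ i) u)" by (simp add: inner_axis)
    show ?thesis unfolding eq by (rule borel_measurable_inner[OF assms borel_measurable_const])
  qed
  then show ?thesis by (subst borel_measurable_euclidean_space) blast
qed

lemma sq_int_component: "sq_int M X \<Longrightarrow> sq_int M (\<lambda>w. (X w :: real^'d^'n) $ i)"
  by (erule sq_int_linear[of M X "\<lambda>x. x $ i"]) (rule bounded_linear_vec_nth)

lemma sq_int_stacked:
  fixes X :: "'w \<Rightarrow> real^'d^'n"
  assumes "\<And>i. sq_int M (\<lambda>w. X w $ i)"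
  shows "sq_int M X"
proof -
  have "X \<in> borel_measurable M"
    by (rule stacked_measurable) (rule sq_intD(1)[OF assms])
  moreover have "integrable M (\<lambda>w. (norm (X w))\<^sup>2)"
    unfolding norm_vec_sq by (rule Bochner_Integration.integrable_sum) (rule sq_intD(2)[OF assms])
  ultimately show ?thesis by (simp add: sq_int_def)
qed

lemma bounded_linear_row_mean: "bounded_linear (row_mean :: real^'d^'n \<Rightarrow> real^'d)"
  using linear_row_mean by (simp add: linear_conv_bounded_linear)

lemma bounded_linear_mean_matrix: "bounded_linear (mean_matrix :: real^'d^'n \<Rightarrow> _)"
  using linear_mean_matrix by (simp add: linear_conv_bounded_linear)

text \<open>Subtracting the mean is an orthogonal projection.\<close>

lemma norm_deviation_le: "norm (X - mean_matrix X) \<le> norm X" for X :: "real^'d^'n"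
proof (rule power2_le_imp_le)
  let ?n = "real CARD('n)"
  have s: "(\<Sum>i\<in>UNIV. X $ i) = ?n *\<^sub>R row_mean X" by (simp add: row_mean_def)
  have "(norm (X - mean_matrix X))\<^sup>2
      = (\<Sum>i\<in>UNIV. (norm (X $ i))\<^sup>2 - 2 * inner (X $ i) (row_mean X) + (norm (row_mean X))\<^sup>2)"
    unfolding norm_vec_sq
    by (intro sum.cong refl) (simp add: mean_matrix_def power2_norm_eq_inner inner_diff_left
        inner_diff_right inner_commute)
  also have "\<dots> = (norm X)\<^sup>2 - 2 * inner (\<Sum>i\<in>UNIV. X $ i) (row_mean X) + ?n * (norm (row_mean X))\<^sup>2"
    unfolding norm_vec_sq sum.distrib sum_subtractf inner_sum_left sum_distrib_left by simp
  also have "\<dots> = (norm X)\<^sup>2 - ?n * (norm (row_mean X))\<^sup>2"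
    unfolding s by (simp add: power2_norm_eq_inner)
  finally show "(norm (X - mean_matrix X))\<^sup>2 \<le> (norm X)\<^sup>2" by simp
qed simp

lemma expectation_convex_le:
  assumes X: "sq_int M X" "(\<integral>w. (norm (X w))\<^sup>2 \<partial>M) \<le> C" and Y: "sq_int M Y" "(\<integral>w. (norm (Y w))\<^sup>2 \<partial>M) \<le> C"
    and ab: "0 \<le> a" "0 \<le> b" "a + b = 1"
  shows "(\<integral>w. (norm (a *\<^sub>R X w + b *\<^sub>R Y w))\<^sup>2 \<partial>M) \<le> C"
proof -
  have "(\<integral>w. (norm (a *\<^sub>R X w + b *\<^sub>R Y w))\<^sup>2 \<partial>M)
      \<le> (\<integral>w. a * (norm (X w))\<^sup>2 + b * (norm (Y w))\<^sup>2 \<partial>M)"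
  proof (rule integral_mono)
    show "integrable M (\<lambda>w. (norm (a *\<^sub>R X w + b *\<^sub>R Y w))\<^sup>2)"
      by (rule sq_intD) (intro sq_int_add sq_int_scaleR X Y)
    show "integrable M (\<lambda>w. a * (norm (X w))\<^sup>2 + b * (norm (Y w))\<^sup>2)"
      using sq_intD(2)[OF X(1)] sq_intD(2)[OF Y(1)] by simp
  qed (rule norm_convex_sq[OF ab])
  also have "\<dots> = a * (\<integral>w. (norm (X w))\<^sup>2 \<partial>M) + b * (\<integral>w. (norm (Y w))\<^sup>2 \<partial>M)"
    using sq_intD(2)[OF X(1)] sq_intD(2)[OF Y(1)] by simp
  also have "\<dots> \<le> a * C + b * C" using ab X Y by (intro add_mono mult_left_mono)
  also have "\<dots> = C" using ab by (simp add: distrib_right[symmetric])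
  finally show ?thesis .
qed

section \<open>The batched stochastic gradient\<close>

context sampled_problem
begin

lemma past_info:
  "f \<in> measurable (info (past k)) N \<Longrightarrow> past k \<subseteq> J \<Longrightarrow> f \<in> measurable (info J) N"
  by (rule info_mono)

definition "mean_noise k Y w = (1 / (real CARD('n) * real r)) *\<^sub>R
  (\<Sum>(i, l)\<in>UNIV \<times> {..<r}. noise i (Y w $ i) (\<xi> k i l w))"

definition "mean_gradient Y = (1 / real CARD('n)) *\<^sub>R (\<Sum>i\<in>UNIV. g i (Y $ i))"

abbreviation "oracle k w \<equiv> batch_gradient ff r (\<lambda>i l. \<xi> k i l w)"

lemma row_mean_oracle: "row_mean (oracle k w (Y w)) = mean_gradient (Y w) + mean_noise k Y w"
proof -
  have "oracle k w (Y w) $ i = g i (Y w $ i) + (1 / real r) *\<^sub>R (\<Sum>l<r. noise i (Y w $ i) (\<xi> k i l w))" for i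
    using r_pos by (simp add: batch_gradient_def noise_def sum_subtractf scaleR_diff_right sum_constant_scaleR
        del: sum_constant)
  then show ?thesis
    by (simp add: row_mean_def mean_gradient_def mean_noise_def sum.cartesian_product[symmetric] sum.distrib
        scaleR_add_right scaleR_sum_right)
qed

text \<open>The noises of all nodes and all batch positions are pairwise orthogonal, so averaging
  divides the variance by \<open>n * r\<close>.\<close>

lemma mean_noise_facts:
  assumes Y: "Y \<in> borel_measurable (info (past k))"
  shows "sq_int M (mean_noise k Y)"
    and "(\<integral>w. (norm (mean_noise k Y w))\<^sup>2 \<partial>M) \<le> avg (\<lambda>i. (sigma i)\<^sup>2) / (real CARD('n) * real r)"
    and "Z \<in> borel_measurable (info (past k)) \<Longrightarrow> sq_int M Z \<Longrightarrow> (\<integral>w. inner (mean_noise k Y w) (Z w) \<partial>M) = 0"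
proof -
  let ?I = "(UNIV :: 'n set) \<times> {..<r}"
  let ?c = "1 / (real CARD('n) * real r)"
  define v where "v = (\<lambda>(i, l) w. noise i (Y w $ i) (\<xi> k i l w))"
  have mn: "mean_noise k Y w = ?c *\<^sub>R (\<Sum>a\<in>?I. v a w)" for w
    by (simp add: mean_noise_def v_def case_prod_beta')
  have new: "(k, i, l) \<notin> past k" for i l by (simp add: past_def)
  have Yi: "(\<lambda>w. Y w $ i) \<in> borel_measurable (info (past k))" for i by (rule component_measurable[OF Y])
  have sq: "sq_int M (v a)" for a
    using noise_second_moment(1)[OF new Yi] by (cases a) (simp add: v_def)
  show "sq_int M (mean_noise k Y)"
    unfolding mn by (intro sq_int_scaleR sq_int_sum finite_measure_axioms sq)
  have orth: "(\<integral>w. inner (v a w) (v b w) \<partial>M) = 0" if "a \<noteq> b" for a b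
  proof -
    obtain i l i' l' where ab: "a = (i, l)" "b = (i', l')" by (metis surj_pair)
    \<comment> \<open>The index of the other sample is added to the past: \<open>v b\<close> becomes
      known, while the sample behind \<open>v a\<close> stays fresh.\<close>
    let ?J = "insert (k, i', l') (past k)"
    have "(k, i, l) \<notin> ?J" using that ab new by auto
    moreover have "(\<lambda>w. Y w $ i) \<in> borel_measurable (info ?J)" for i
      by (rule past_info[OF Yi]) blast
    moreover have "v b \<in> borel_measurable (info ?J)"
      unfolding ab v_def prod.case
      by (rule sampled_gradient_measurable) (rule past_info[OF Yi], blast, rule \<xi>_measurable_info, simp)
    ultimately show ?thesis
      using noise_orthogonal[of k i l ?J "\<lambda>w. Y w $ i" "v b"] sq[of b] by (simp add: ab(1) v_def)
  qed
  have "(\<integral>w. (norm (mean_noise k Y w))\<^sup>2 \<partial>M) = ?c\<^sup>2 * (\<integral>w. (norm (\<Sum>a\<in>?I. v a w))\<^sup>2 \<partial>M)"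
    unfolding mn norm_scaleR power_mult_distrib by simp
  also have "(\<integral>w. (norm (\<Sum>a\<in>?I. v a w))\<^sup>2 \<partial>M) = (\<Sum>a\<in>?I. \<integral>w. (norm (v a w))\<^sup>2 \<partial>M)"
    by (rule expectation_norm_sum_orthogonal) (use sq orth in auto)
  also have "\<dots> \<le> (\<Sum>a\<in>?I. (sigma (fst a))\<^sup>2)"
  proof (rule sum_mono)
    fix a show "(\<integral>w. (norm (v a w))\<^sup>2 \<partial>M) \<le> (sigma (fst a))\<^sup>2"
      using noise_second_moment(2)[OF new Yi] by (cases a) (simp add: v_def)
  qed
  also have "\<dots> = real r * (\<Sum>i\<in>UNIV. (sigma i)\<^sup>2)"
  proof -
    have "(\<Sum>a\<in>?I. (sigma (fst a))\<^sup>2) = (\<Sum>i\<in>UNIV. \<Sum>l<r. (sigma i)\<^sup>2)"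
      unfolding sum.cartesian_product by (intro sum.cong) auto
    then show ?thesis by (simp add: sum_distrib_left)
  qed
  finally have "(\<integral>w. (norm (mean_noise k Y w))\<^sup>2 \<partial>M) \<le> ?c\<^sup>2 * (real r * (\<Sum>i\<in>UNIV. (sigma i)\<^sup>2))"
    by (simp add: mult_left_mono)
  also have "\<dots> = avg (\<lambda>i. (sigma i)\<^sup>2) / (real CARD('n) * real r)"
    using r_pos by (simp add: avg_def power2_eq_square)
  finally show "(\<integral>w. (norm (mean_noise k Y w))\<^sup>2 \<partial>M) \<le> avg (\<lambda>i. (sigma i)\<^sup>2) / (real CARD('n) * real r)" .
  assume Z: "Z \<in> borel_measurable (info (past k))" "sq_int M Z"
  have zero: "(\<integral>w. inner (v a w) (Z w) \<partial>M) = 0" for a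
    using noise_orthogonal[OF new Yi Z] by (cases a) (simp add: v_def)
  have "(\<integral>w. inner (mean_noise k Y w) (Z w) \<partial>M) = ?c * (\<integral>w. (\<Sum>a\<in>?I. inner (v a w) (Z w)) \<partial>M)"
    unfolding mn by (simp add: inner_sum_left)
  also have "(\<integral>w. (\<Sum>a\<in>?I. inner (v a w) (Z w)) \<partial>M) = (\<Sum>a\<in>?I. \<integral>w. inner (v a w) (Z w) \<partial>M)"
    by (rule Bochner_Integration.integral_sum) (rule sq_int_inner[OF sq Z(2)])
  finally show "(\<integral>w. inner (mean_noise k Y w) (Z w) \<partial>M) = 0" by (simp add: zero)
qed

section \<open>Second moment of the oracle\<close>

lemma oracle_measurable:
  assumes "Y \<in> borel_measurable (info (past k))"
  shows "(\<lambda>w. oracle k w (Y w)) \<in> borel_measurable (info (past (Suc k)))"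
proof (rule stacked_measurable)
  fix i
  have "past k \<subseteq> past (Suc k)" by (auto simp: past_def)
  then have Yi: "(\<lambda>w. Y w $ i) \<in> borel_measurable (info (past (Suc k)))"
    by (rule past_info[OF component_measurable[OF assms]])
  have "(\<lambda>w. G i (Y w $ i) (\<xi> k i l w)) \<in> borel_measurable (info (past (Suc k)))" for l
    by (rule sampled_gradient_measurable(1)[OF Yi]) (rule \<xi>_measurable_info, simp add: past_def)
  then have "(\<lambda>w. (1 / real r) *\<^sub>R (\<Sum>l<r. G i (Y w $ i) (\<xi> k i l w))) \<in> borel_measurable (info (past (Suc k)))"
    by (intro borel_measurable_scaleR[OF borel_measurable_const] borel_measurable_sum)
  then show "(\<lambda>w. oracle k w (Y w) $ i) \<in> borel_measurable (info (past (Suc k)))"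
    by (simp add: batch_gradient_def)
qed

abbreviation "XS \<equiv> (\<chi> i. xs) :: real^'d^'n"

lemma oracle_at_minimizer:
  assumes "w \<in> space M"
  shows "(norm (oracle k w XS))\<^sup>2 \<le> (sqrt (real CARD('n)) * M_xi D ff xs)\<^sup>2"
proof -
  have "norm (oracle k w XS $ i) \<le> M_xi D ff xs" for i
  proof -
    have "norm (\<Sum>l<r. G i xs (\<xi> k i l w)) \<le> (\<Sum>l<r. M_xi D ff xs)"
      using measurable_space[OF \<xi>_measurable assms] gradient_at_minimizer_le
      by (intro sum_norm_le) blast
    then show ?thesis using r_pos by (simp add: batch_gradient_def divide_le_eq mult.commute)
  qed
  then have "(norm (oracle k w XS))\<^sup>2 \<le> (\<Sum>i\<in>(UNIV::'n set). (M_xi D ff xs)\<^sup>2)"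
    unfolding norm_vec_sq by (intro sum_mono power_mono) auto
  also have "\<dots> = (sqrt (real CARD('n)) * M_xi D ff xs)\<^sup>2" by (simp add: power_mult_distrib)
  finally show ?thesis .
qed

lemma oracle_difference:
  assumes Y: "Y \<in> borel_measurable (info (past k))" "sq_int M Y"
  shows "sq_int M (\<lambda>w. oracle k w (Y w) - oracle k w XS)"
    and "(\<integral>w. (norm (oracle k w (Y w) - oracle k w XS))\<^sup>2 \<partial>M)
      \<le> (Max (range L))\<^sup>2 * (\<integral>w. (norm (Y w - XS))\<^sup>2 \<partial>M)"
proof -
  let ?d = "\<lambda>i l w. G i (Y w $ i) (\<xi> k i l w) - G i xs (\<xi> k i l w)"
  have comp: "(oracle k w (Y w) - oracle k w XS) $ i = (1 / real r) *\<^sub>R (\<Sum>l<r. ?d i l w)" for i w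
    by (simp add: batch_gradient_def sum_subtractf scaleR_diff_right)
  have new: "(k, i, l) \<notin> past k" for i l by (simp add: past_def)
  note lip = sampled_gradient_lipschitz[OF new component_measurable[OF Y(1)] sq_int_component[OF Y(2)]]
  have sqc: "sq_int M (\<lambda>w. (oracle k w (Y w) - oracle k w XS) $ i)" for i
    unfolding comp by (intro sq_int_scaleR sq_int_sum finite_measure_axioms lip(1))
  show sq: "sq_int M (\<lambda>w. oracle k w (Y w) - oracle k w XS)"
    by (rule sq_int_stacked) (rule sqc)
  have sqY: "sq_int M (\<lambda>w. Y w $ i - xs)" for i
    by (intro sq_int_diff sq_int_component Y sq_int_const finite_measure_axioms)
  have row: "(\<integral>w. (norm ((oracle k w (Y w) - oracle k w XS) $ i))\<^sup>2 \<partial>M)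
      \<le> (Max (range L))\<^sup>2 * (\<integral>w. (norm (Y w $ i - xs))\<^sup>2 \<partial>M)" for i
  proof -
    have "(\<integral>w. (norm ((oracle k w (Y w) - oracle k w XS) $ i))\<^sup>2 \<partial>M)
        \<le> (\<integral>w. (1 / real r) * (\<Sum>l<r. (norm (?d i l w))\<^sup>2) \<partial>M)"
    proof (rule integral_mono)
      show "integrable M (\<lambda>w. (norm ((oracle k w (Y w) - oracle k w XS) $ i))\<^sup>2)"
        by (rule sq_intD(2)[OF sqc])
      show "integrable M (\<lambda>w. (1 / real r) * (\<Sum>l<r. (norm (?d i l w))\<^sup>2))"
        by (intro integrable_mult_right Bochner_Integration.integrable_sum sq_intD(2)[OF lip(1)])
      show "(norm ((oracle k w (Y w) - oracle k w XS) $ i))\<^sup>2 \<le> (1 / real r) * (\<Sum>l<r. (norm (?d i l w))\<^sup>2)" for w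
        unfolding comp by (rule norm_mean_sq_le[OF r_pos])
    qed
    also have "\<dots> = (1 / real r) * (\<Sum>l<r. \<integral>w. (norm (?d i l w))\<^sup>2 \<partial>M)"
      by (simp add: Bochner_Integration.integral_sum[OF sq_intD(2)[OF lip(1)]])
    also have "\<dots> \<le> (1 / real r) * (\<Sum>l<r. (L i)\<^sup>2 * (\<integral>w. (norm (Y w $ i - xs))\<^sup>2 \<partial>M))"
      by (intro mult_left_mono sum_mono lip(2)) simp
    also have "\<dots> = (L i)\<^sup>2 * (\<integral>w. (norm (Y w $ i - xs))\<^sup>2 \<partial>M)" using r_pos by simp
    also have "\<dots> \<le> (Max (range L))\<^sup>2 * (\<integral>w. (norm (Y w $ i - xs))\<^sup>2 \<partial>M)"
      by (intro mult_right_mono power_mono L_nonneg) (auto intro: integral_nonneg_AE)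
    finally show ?thesis .
  qed
  have "(\<integral>w. (norm (oracle k w (Y w) - oracle k w XS))\<^sup>2 \<partial>M)
      = (\<Sum>i\<in>UNIV. \<integral>w. (norm ((oracle k w (Y w) - oracle k w XS) $ i))\<^sup>2 \<partial>M)"
    unfolding norm_vec_sq by (rule Bochner_Integration.integral_sum) (rule sq_intD(2)[OF sqc])
  also have "\<dots> \<le> (\<Sum>i\<in>UNIV. (Max (range L))\<^sup>2 * (\<integral>w. (norm (Y w $ i - xs))\<^sup>2 \<partial>M))"
    by (intro sum_mono row)
  also have "\<dots> = (Max (range L))\<^sup>2 * (\<integral>w. (\<Sum>i\<in>UNIV. (norm (Y w $ i - xs))\<^sup>2) \<partial>M)"
    by (simp add: sum_distrib_left Bochner_Integration.integral_sum[OF sq_intD(2)[OF sqY]])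
  also have "(\<lambda>w. \<Sum>i\<in>UNIV. (norm (Y w $ i - xs))\<^sup>2) = (\<lambda>w. (norm (Y w - XS))\<^sup>2)"
    by (simp add: norm_vec_sq)
  finally show "(\<integral>w. (norm (oracle k w (Y w) - oracle k w XS))\<^sup>2 \<partial>M)
      \<le> (Max (range L))\<^sup>2 * (\<integral>w. (norm (Y w - XS))\<^sup>2 \<partial>M)" .
qed

lemma oracle_XS_sq_int:
  "sq_int M (\<lambda>w. oracle k w XS)"
  "(\<integral>w. (norm (oracle k w XS))\<^sup>2 \<partial>M) \<le> (sqrt (real CARD('n)) * M_xi D ff xs)\<^sup>2"
proof -
  have meas: "(\<lambda>w. oracle k w XS) \<in> borel_measurable M"
    by (rule measurable_info_imp[OF oracle_measurable]) simp
  have int: "integrable M (\<lambda>w. (norm (oracle k w XS))\<^sup>2)"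
  proof (rule integrable_const_bound)
    show "AE w in M. norm ((norm (oracle k w XS))\<^sup>2) \<le> (sqrt (real CARD('n)) * M_xi D ff xs)\<^sup>2"
      by (rule AE_I2) (use oracle_at_minimizer in simp)
  qed (use meas in measurable)
  with meas show "sq_int M (\<lambda>w. oracle k w XS)" by (simp add: sq_int_def)
  have "(\<integral>w. (norm (oracle k w XS))\<^sup>2 \<partial>M) \<le> (\<integral>w. (sqrt (real CARD('n)) * M_xi D ff xs)\<^sup>2 \<partial>M)"
    by (rule integral_mono[OF int]) (use oracle_at_minimizer in auto)
  then show "(\<integral>w. (norm (oracle k w XS))\<^sup>2 \<partial>M) \<le> (sqrt (real CARD('n)) * M_xi D ff xs)\<^sup>2"
    by (simp add: prob_space)
qed

lemma oracle_sq_int: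
  assumes Y: "Y \<in> borel_measurable (info (past k))" "sq_int M Y"
  shows "sq_int M (\<lambda>w. oracle k w (Y w))"
  using sq_int_add[OF oracle_difference(1)[OF Y] oracle_XS_sq_int(1)[of k]] by simp

text \<open>The oracle is compared with its value on the same samples at the stacked minimizer,
  where \<open>M_xi\<close> bounds it. The difference is Lipschitz in mean square.\<close>

lemma oracle_second_moment:
  assumes Y: "Y \<in> borel_measurable (info (past k))" "sq_int M Y"
    and b: "(\<integral>w. (norm (Y w - XS))\<^sup>2 \<partial>M) \<le> b\<^sup>2" "0 \<le> b"
  shows "(\<integral>w. (norm (oracle k w (Y w)))\<^sup>2 \<partial>M)
    \<le> (Max (range L) * b + sqrt (real CARD('n)) * M_xi D ff xs)\<^sup>2"
proof -
  have L0: "0 \<le> Max (range L)"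
    using L_nonneg[of undefined] by (rule order_trans) simp
  have "(Max (range L))\<^sup>2 * (\<integral>w. (norm (Y w - XS))\<^sup>2 \<partial>M) \<le> (Max (range L))\<^sup>2 * b\<^sup>2"
    using b(1) by (intro mult_left_mono) auto
  then have "(\<integral>w. (norm (oracle k w (Y w) - oracle k w XS))\<^sup>2 \<partial>M) \<le> (Max (range L) * b)\<^sup>2"
    using oracle_difference(2)[OF Y] by (simp add: power_mult_distrib)
  from minkowski[OF oracle_difference(1)[OF Y] this _ oracle_XS_sq_int[of k]]
  show ?thesis using L0 b M_xi_nonneg by simp
qed

subsection \<open>Consensus error of the gradient\<close>

lemma gradient_local_affine:
  assumes "Y \<in> borel_measurable N"
  shows "(\<lambda>w. g i (Y w)) \<in> borel_measurable N"
    and "sq_int M Z \<Longrightarrow> sq_int M (\<lambda>w. g i (Z w))"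
proof -
  show "(\<lambda>w. g i (Y w)) \<in> borel_measurable N"
    by (rule measurable_compose[OF assms gradient_local_measurable])
  assume Z: "sq_int M Z"
  have "norm (g i x - g i 0) \<le> L i * norm x" for x
    using lipschitz_on_normD[OF gradient_local_lipschitz, of x 0] by simp
  moreover have "(\<lambda>x. g i x - g i 0) \<in> borel_measurable borel"
    by (intro borel_measurable_diff gradient_local_measurable borel_measurable_const)
  ultimately have "sq_int M (\<lambda>w. g i (Z w) - g i 0)" by (intro sq_int_lipschitz[OF Z])
  from sq_int_add[OF this sq_int_const[OF finite_measure_axioms, of "g i 0"]]
  show "sq_int M (\<lambda>w. g i (Z w))" by simp
qed

definition "gradient_error Y = grad_global (row_mean Y) - mean_gradient Y"

text \<open>Cauchy-Schwarz over the nodes: the average of \<open>n\<close> errors costs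
  \<open>1 / n\<close> times the sum of their squares.\<close>

lemma gradient_error_bound:
  "(norm (gradient_error Y))\<^sup>2 \<le> (Max (range L))\<^sup>2 / real CARD('n) * (norm (Y - mean_matrix Y))\<^sup>2"
proof -
  let ?n = "real CARD('n)"
  let ?v = "\<lambda>i. g i (row_mean Y) - g i (Y $ i)"
  have eq: "gradient_error Y = (1 / ?n) *\<^sub>R (\<Sum>i\<in>UNIV. ?v i)"
    by (simp add: gradient_error_def grad_global_def mean_gradient_def sum_subtractf scaleR_diff_right)
  have "(norm (\<Sum>i\<in>UNIV. ?v i))\<^sup>2 \<le> (\<Sum>i\<in>UNIV. norm (?v i))\<^sup>2"
    by (intro power_mono norm_sum) simp
  also have "\<dots> \<le> (\<Sum>i\<in>UNIV. (norm (?v i))\<^sup>2) * ?n"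
    using sum_squared_le_sum_of_squares[of "\<lambda>i. norm (?v i)" UNIV] by simp
  also have "\<dots> \<le> (\<Sum>i\<in>UNIV. (Max (range L))\<^sup>2 * (norm (Y $ i - row_mean Y))\<^sup>2) * ?n"
  proof (intro mult_right_mono sum_mono)
    fix i
    have "norm (?v i) \<le> L i * norm (row_mean Y - Y $ i)"
      by (rule lipschitz_on_normD[OF gradient_local_lipschitz]) auto
    also have "\<dots> \<le> Max (range L) * norm (Y $ i - row_mean Y)"
      unfolding norm_minus_commute[of "row_mean Y"] by (intro mult_right_mono) auto
    finally have "(norm (?v i))\<^sup>2 \<le> (Max (range L) * norm (Y $ i - row_mean Y))\<^sup>2"
      by (rule power_mono) simp
    then show "(norm (?v i))\<^sup>2 \<le> (Max (range L))\<^sup>2 * (norm (Y $ i - row_mean Y))\<^sup>2"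
      by (simp add: power_mult_distrib)
  qed simp
  also have "\<dots> = (Max (range L))\<^sup>2 * (norm (Y - mean_matrix Y))\<^sup>2 * ?n"
    by (simp add: norm_vec_sq mean_matrix_def sum_distrib_left)
  finally have "(norm (\<Sum>i\<in>UNIV. ?v i))\<^sup>2 / ?n\<^sup>2 \<le> (Max (range L))\<^sup>2 * (norm (Y - mean_matrix Y))\<^sup>2 * ?n / ?n\<^sup>2"
    by (rule divide_right_mono) simp
  then show ?thesis unfolding eq by (simp add: power_mult_distrib power_divide power2_eq_square)
qed

text \<open>Completing the square: half of the strong convexity absorbs the inner product with the
  gradient error and leaves its square divided by \<open>mu_g\<close>. This is why the algorithm
  works with \<open>mu_g / 2\<close>.\<close>

lemma global_lower_inexact:
  "global_obj D ff (row_mean Y) + inner (mean_gradient Y) (z - row_mean Y)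
    + avg mu / 4 * (norm (z - row_mean Y))\<^sup>2 - (norm (gradient_error Y))\<^sup>2 / avg mu \<le> global_obj D ff z"
proof -
  let ?h = "z - row_mean Y" and ?e = "gradient_error Y" and ?m = "avg mu"
  have m: "0 < ?m" by (rule avg_mu_pos)
  have "0 \<le> (norm (?e + (?m / 2) *\<^sub>R ?h))\<^sup>2" by simp
  also have "\<dots> = (norm ?e)\<^sup>2 + ?m * inner ?e ?h + ?m\<^sup>2 / 4 * (norm ?h)\<^sup>2"
    unfolding power2_norm_eq_inner
    by (simp add: inner_add_left inner_add_right inner_commute power2_eq_square algebra_simps)
  finally have "0 \<le> ((norm ?e)\<^sup>2 + ?m * inner ?e ?h + ?m\<^sup>2 / 4 * (norm ?h)\<^sup>2) / ?m"
    using m by (intro divide_nonneg_pos)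
  also have "\<dots> = (norm ?e)\<^sup>2 / ?m + inner ?e ?h + ?m / 4 * (norm ?h)\<^sup>2"
    using m by (simp add: add_divide_distrib power2_eq_square)
  finally have "- (norm ?e)\<^sup>2 / ?m - ?m / 4 * (norm ?h)\<^sup>2 \<le> inner ?e ?h" by simp
  moreover have "inner (grad_global (row_mean Y)) ?h = inner (mean_gradient Y) ?h + inner ?e ?h"
    by (simp add: gradient_error_def inner_diff_left)
  ultimately show ?thesis using global_lower[of "row_mean Y" z] by simp
qed

lemma global_obj_measurable: "global_obj D ff \<in> borel_measurable borel"
proof (rule borel_measurable_continuous_onI)
  have "continuous_on UNIV (local_obj D ff i)" for i
    unfolding continuous_on_eq_continuous_at[OF open_UNIV]
    by (intro ballI has_derivative_continuous[OF local_obj_GDERIV[unfolded gderiv_def]])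
  then show "continuous_on UNIV (global_obj D ff)"
    unfolding global_obj_def avg_def by (intro continuous_intros) auto
qed

text \<open>The objective lies between its minimum and a quadratic model at \<open>xs\<close>, and
  the latter is integrable along square-integrable points.\<close>

lemma global_obj_integrable:
  assumes X: "sq_int M X"
  shows "integrable M (\<lambda>w. global_obj D ff (X w))"
proof -
  let ?f = "global_obj D ff"
  have Xd: "sq_int M (\<lambda>w. X w - xs)"
    by (intro sq_int_diff X sq_int_const finite_measure_axioms)
  have "integrable M (\<lambda>w. ?f (X w) - ?f xs)"
  proof (rule Bochner_Integration.integrable_bound)
    show "integrable M (\<lambda>w. inner (grad_global xs) (X w - xs) + avg L / 2 * (norm (X w - xs))\<^sup>2)"
      by (intro Bochner_Integration.integrable_add integrable_mult_right sq_intD(2)[OF Xd]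
          sq_int_inner sq_int_const finite_measure_axioms Xd)
    show "(\<lambda>w. ?f (X w) - ?f xs) \<in> borel_measurable M"
      by (intro borel_measurable_diff borel_measurable_const
          measurable_compose[OF sq_intD(1)[OF X] global_obj_measurable])
    show "AE w in M. norm (?f (X w) - ?f xs)
        \<le> norm (inner (grad_global xs) (X w - xs) + avg L / 2 * (norm (X w - xs))\<^sup>2)"
    proof (rule AE_I2)
      fix w
      show "norm (?f (X w) - ?f xs)
        \<le> norm (inner (grad_global xs) (X w - xs) + avg L / 2 * (norm (X w - xs))\<^sup>2)"
        using minimizer_le[of "X w"] global_upper[of "X w" xs] by simp
    qed
  qed
  then have "integrable M (\<lambda>w. (?f (X w) - ?f xs) + ?f xs)"
    by (rule Bochner_Integration.integrable_add) simp
  then show ?thesis by simp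
qed

end

section \<open>The run of the algorithm\<close>

text \<open>Consensus enters only as a linear, mean-preserving map with a given contraction, so both
  kinds of network are instances. \<open>S\<close> bounds the root mean square disagreement before
  consensus and \<open>tol\<close> the mean square afterwards. \<open>N_le\<close> expresses that
  the run is not too long for its initial distance.\<close>

locale dsagd_run = sampled_problem D ff Lxi mu L sigma xs M \<xi> r
  for D :: "'n::finite \<Rightarrow> 's measure" and ff :: "'n \<Rightarrow> real^'d \<Rightarrow> 's \<Rightarrow> real"
    and Lxi mu L sigma xs and M :: "'w measure" and \<xi> r +
  fixes cons :: "nat \<Rightarrow> real^'d^'n \<Rightarrow> real^'d^'n" and x0 :: "real^'d^'n"
    and tol S \<epsilon> R :: real and N :: nat
  assumes cons_linear: "linear (cons k)"
    and cons_mean: "row_mean (cons k Z) = row_mean Z"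
    and cons_contract: "(norm (cons k Z - mean_matrix Z))\<^sup>2 \<le> (norm (Z - mean_matrix Z))\<^sup>2 / (S\<^sup>2 / tol)"
    and start: "consensual x0"
    and R_def: "R = (norm (row_mean x0 - xs))\<^sup>2"
    and tol_pos: "0 < tol" and S_pos: "0 < S" and \<epsilon>_pos: "0 < \<epsilon>"
    and noise_budget: "avg (\<lambda>i. (sigma i)\<^sup>2) / (real CARD('n) * real r)
      \<le> \<epsilon> * avg L * sqrt (avg mu / avg L) / 2"
    and tol_budget: "1 / (2 * real CARD('n)) * ((Max (range L))\<^sup>2 / avg L + 2 * (Max (range L))\<^sup>2 / avg mu) * tol
      \<le> 3 / 64 * \<epsilon> * sqrt (avg mu / avg L)"
    and S_ge: "sqrt tol + 1 / sqrt (avg L * avg mu) *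
      (Max (range L) * (sqrt tol + sqrt (real CARD('n)) * sqrt (4 * avg L / avg mu * R))
        + sqrt (real CARD('n)) * M_xi D ff xs) \<le> S"
    and N_le: "exp (real N * sqrt (avg mu / avg L) / 3) \<le> 4 * avg L * R / \<epsilon>"
begin

sublocale agd_coefficients "avg mu" "avg L"
  using avg_mu_pos avg_mu_le_avg_L by unfold_locales

definition "state k w = dsagd (avg mu) (avg L) cons (\<lambda>k. oracle k w) x0 k"
definition "X k w = fst (state k w)"
definition "U k w = snd (state k w)"
definition "Y k w = (1 / A (Suc k)) *\<^sub>R (\<alpha> k *\<^sub>R U k w + A k *\<^sub>R X k w)"
definition "V k w = (1 / c (Suc k)) *\<^sub>R
  ((\<alpha> k * avg mu / 2) *\<^sub>R Y k w + c k *\<^sub>R U k w - \<alpha> k *\<^sub>R oracle k w (Y k w))"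

lemma X_0: "X 0 w = x0" and U_0: "U 0 w = x0"
  by (simp_all add: X_def U_def state_def)

lemma U_Suc: "U (Suc k) w = cons k (V k w)"
  and X_Suc: "X (Suc k) w = (1 / A (Suc k)) *\<^sub>R (\<alpha> k *\<^sub>R U (Suc k) w + A k *\<^sub>R X k w)"
  by (simp_all add: X_def U_def V_def Y_def state_def Let_def split_beta c_def \<alpha>_def)

section \<open>Measurability and square integrability of the iterates\<close>

definition "adapted k Z \<longleftrightarrow> Z \<in> borel_measurable (info (past k)) \<and> sq_int M Z"

lemma adaptedD:
  "adapted k Z \<Longrightarrow> Z \<in> borel_measurable (info (past k))" "adapted k Z \<Longrightarrow> sq_int M Z"
  by (auto simp: adapted_def)

lemma adapted_add: "adapted k Z \<Longrightarrow> adapted k Z' \<Longrightarrow> adapted k (\<lambda>w. Z w + Z' w)"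
  unfolding adapted_def using borel_measurable_add sq_int_add by blast

lemma adapted_diff: "adapted k Z \<Longrightarrow> adapted k Z' \<Longrightarrow> adapted k (\<lambda>w. Z w - Z' w)"
  unfolding adapted_def using borel_measurable_diff sq_int_diff by blast

lemma adapted_scaleR: "adapted k Z \<Longrightarrow> adapted k (\<lambda>w. t *\<^sub>R Z w)"
  unfolding adapted_def using borel_measurable_scaleR[OF borel_measurable_const] sq_int_scaleR by blast

lemma adapted_const: "adapted k (\<lambda>_. z)"
  unfolding adapted_def using sq_int_const[OF finite_measure_axioms] by simp

lemma adapted_sum:
  assumes "\<And>i. i \<in> I \<Longrightarrow> adapted k (Z i)"
  shows "adapted k (\<lambda>w. \<Sum>i\<in>I. Z i w)"
  unfolding adapted_def
  by (intro conjI borel_measurable_sum sq_int_sum finite_measure_axioms adaptedD(1) adaptedD(2)) (auto intro: assms)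

lemma adapted_linear:
  assumes "adapted k Z" "bounded_linear f"
  shows "adapted k (\<lambda>w. f (Z w))"
  unfolding adapted_def
proof
  have "f \<in> borel_measurable borel"
    by (rule borel_measurable_continuous_onI) (rule linear_continuous_on[OF assms(2)])
  then show "(\<lambda>w. f (Z w)) \<in> borel_measurable (info (past k))"
    by (rule measurable_compose[OF adaptedD(1)[OF assms(1)]])
  show "sq_int M (\<lambda>w. f (Z w))" by (rule sq_int_linear[OF adaptedD(2)[OF assms(1)] assms(2)])
qed

lemma adapted_gradient: "adapted k Z \<Longrightarrow> adapted k (\<lambda>w. g i (Z w))"
  unfolding adapted_def using gradient_local_affine by blast

lemma adapted_row_mean: "adapted k Z \<Longrightarrow> adapted k (\<lambda>w. row_mean (Z w))"
  by (rule adapted_linear[OF _ bounded_linear_row_mean])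

lemma adapted_Suc: "adapted k Z \<Longrightarrow> adapted (Suc k) Z"
proof -
  have "past k \<subseteq> past (Suc k)" by (auto simp: past_def)
  then show "adapted k Z \<Longrightarrow> adapted (Suc k) Z"
    unfolding adapted_def using past_info by blast
qed

lemma adapted_XU: "adapted k (X k) \<and> adapted k (U k)"
proof (induction k)
  case 0
  have "X 0 = (\<lambda>_. x0)" "U 0 = (\<lambda>_. x0)" using X_0 U_0 by auto
  then show ?case by (simp add: adapted_const)
next
  case (Suc k)
  then have X: "adapted k (X k)" and U: "adapted k (U k)" by blast+
  have Y: "adapted k (Y k)"
    unfolding Y_def by (intro adapted_scaleR adapted_add X U)
  have O: "adapted (Suc k) (\<lambda>w. oracle k w (Y k w))"
    unfolding adapted_def using oracle_measurable oracle_sq_int adaptedD[OF Y] by blast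
  have V: "adapted (Suc k) (V k)"
    unfolding V_def by (intro adapted_scaleR adapted_add adapted_diff adapted_Suc[OF Y] adapted_Suc[OF U] O)
  have "bounded_linear (cons k)" using cons_linear by (simp add: linear_conv_bounded_linear)
  then have U': "adapted (Suc k) (U (Suc k))"
    unfolding U_Suc by (rule adapted_linear[OF V])
  have "adapted (Suc k) (X (Suc k))"
    unfolding X_Suc by (intro adapted_scaleR adapted_add U' adapted_Suc[OF X])
  with U' show ?case by blast
qed

lemma adapted_X: "adapted k (X k)" and adapted_U: "adapted k (U k)"
  using adapted_XU by auto

lemma adapted_Y: "adapted k (Y k)"
  unfolding Y_def by (intro adapted_scaleR adapted_add adapted_X adapted_U)

lemma sq_int_V: "sq_int M (V k)"
  unfolding V_def by (intro sq_int_scaleR sq_int_add sq_int_diff oracle_sq_int[OF adaptedD[OF adapted_Y]]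
      adaptedD(2)[OF adapted_Y] adaptedD(2)[OF adapted_U])

section \<open>Recursion of the row averages\<close>

definition "u k w = row_mean (U k w)"
definition "x k w = row_mean (X k w)"
definition "y k w = row_mean (Y k w)"
definition "\<eta> k w = mean_noise k (Y k) w"
definition "gm k w = mean_gradient (Y k w)"
definition "err k w = gradient_error (Y k w)"
text \<open>The update of the averaged \<open>u\<close> with the noise removed. It depends on the
  samples before step \<open>k\<close> only.\<close>

definition "u0 k w = (1 / c (Suc k)) *\<^sub>R ((\<alpha> k * avg mu / 2) *\<^sub>R y k w + c k *\<^sub>R u k w - \<alpha> k *\<^sub>R gm k w)"
definition "dir k w = (\<alpha> k / A (Suc k)) *\<^sub>R (u0 k w - u k w)"
definition "Zn k w = noise_dir k (u0 k w) (dir k w) (gm k w) (err k w) xs"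

lemmas row_mean_lin = linear_add[OF linear_row_mean] linear_diff[OF linear_row_mean] linear_scale[OF linear_row_mean]

lemma y_eq: "y k w = (1 / A (Suc k)) *\<^sub>R (\<alpha> k *\<^sub>R u k w + A k *\<^sub>R x k w)"
  by (simp add: y_def Y_def u_def x_def row_mean_lin)

lemma x_Suc: "x (Suc k) w = (1 / A (Suc k)) *\<^sub>R (\<alpha> k *\<^sub>R u (Suc k) w + A k *\<^sub>R x k w)"
  by (simp add: x_def X_Suc u_def row_mean_lin)

lemma u_Suc: "u (Suc k) w = (1 / c (Suc k)) *\<^sub>R
    ((\<alpha> k * avg mu / 2) *\<^sub>R y k w + c k *\<^sub>R u k w - \<alpha> k *\<^sub>R (gm k w + \<eta> k w))"
  by (simp add: u_def U_Suc cons_mean V_def row_mean_lin row_mean_oracle y_def gm_def \<eta>_def)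

lemma adapted_u: "adapted k (u k)" and adapted_x: "adapted k (x k)" and adapted_y: "adapted k (y k)"
  unfolding u_def x_def y_def
  by (rule adapted_row_mean[OF adapted_U], rule adapted_row_mean[OF adapted_X], rule adapted_row_mean[OF adapted_Y])

lemma adapted_gm: "adapted k (gm k)"
  unfolding gm_def mean_gradient_def
  by (intro adapted_scaleR adapted_sum) (rule adapted_gradient[OF adapted_linear[OF adapted_Y bounded_linear_vec_nth]])

lemma adapted_err: "adapted k (err k)"
proof -
  have "adapted k (\<lambda>w. grad_global (y k w) - gm k w)"
    unfolding grad_global_def
    by (intro adapted_diff adapted_scaleR adapted_sum adapted_gradient[OF adapted_y] adapted_gm)
  then show ?thesis by (simp add: err_def[abs_def] gradient_error_def y_def gm_def)
qed

lemma adapted_u0: "adapted k (u0 k)"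
  unfolding u0_def by (intro adapted_scaleR adapted_add adapted_diff adapted_y adapted_u adapted_gm)

lemma adapted_Zn: "adapted k (Zn k)"
  unfolding Zn_def noise_dir_def dir_def
  by (intro adapted_scaleR adapted_add adapted_diff adapted_u adapted_u0 adapted_gm adapted_err adapted_const)

section \<open>Expected growth of the potential\<close>

abbreviation "f \<equiv> global_obj D ff"

definition "\<Phi> k w = A k * (f (x k w) - f xs) + c k / 2 * (norm (u k w - xs))\<^sup>2"

text \<open>The gradient error is charged twice: with \<open>1 / (2 * avg L)\<close> by Young's
  inequality in \<open>noisy_step\<close>, and with \<open>1 / avg mu\<close> by the inexact lower
  models.\<close>

definition "K = 1 / (2 * real CARD('n)) * ((Max (range L))\<^sup>2 / avg L + 2 * (Max (range L))\<^sup>2 / avg mu)"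

lemma K_nonneg: "0 \<le> K"
  unfolding K_def using L_pos m_pos by (intro mult_nonneg_nonneg add_nonneg_nonneg divide_nonneg_pos) auto

lemma potential_step:
  "\<Phi> (Suc k) w \<le> \<Phi> k w + A (Suc k) * (K * (norm (Y k w - mean_matrix (Y k w)))\<^sup>2)
    + inner (\<eta> k w) (Zn k w) + 3 * A (Suc k) / (8 * avg L) * (norm (\<eta> k w))\<^sup>2"
proof -
  let ?e2 = "(norm (err k w))\<^sup>2"
  have lower: "f (y k w) + inner (gm k w) (z - y k w) + avg mu / 4 * (norm (z - y k w))\<^sup>2 - ?e2 / avg mu \<le> f z" for z
    using global_lower_inexact[of "Y k w" z] by (simp add: y_def gm_def err_def)
  have lower': "f (y k w) + inner (gm k w) (z - y k w) - ?e2 / avg mu \<le> f z" for z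
  proof -
    have "0 \<le> avg mu / 4 * (norm (z - y k w))\<^sup>2" using m_pos by simp
    with lower[of z] show ?thesis by linarith
  qed
  have upper: "f z \<le> f (y k w) + inner (gm k w + err k w) (z - y k w) + avg L / 2 * (norm (z - y k w))\<^sup>2" for z
    using global_upper[of z "y k w"] by (simp add: gm_def err_def gradient_error_def y_def)
  have "\<Phi> (Suc k) w \<le> \<Phi> k w + A (Suc k) * (?e2 / (2 * avg L) + ?e2 / avg mu)
    + inner (\<eta> k w) (Zn k w) + 3 * A (Suc k) / (8 * avg L) * (norm (\<eta> k w))\<^sup>2"
    unfolding \<Phi>_def Zn_def
    by (rule noisy_step[OF y_eq u0_def dir_def u_Suc x_Suc lower' lower upper order_refl])
  also have "A (Suc k) * (?e2 / (2 * avg L) + ?e2 / avg mu)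
      \<le> A (Suc k) * (K * (norm (Y k w - mean_matrix (Y k w)))\<^sup>2)"
  proof (rule mult_left_mono)
    have "?e2 / (2 * avg L) + ?e2 / avg mu = (1 / (2 * avg L) + 1 / avg mu) * ?e2"
      by (simp add: distrib_right)
    also have "\<dots> \<le> (1 / (2 * avg L) + 1 / avg mu) *
        ((Max (range L))\<^sup>2 / real CARD('n) * (norm (Y k w - mean_matrix (Y k w)))\<^sup>2)"
      unfolding err_def using L_pos m_pos by (intro mult_left_mono gradient_error_bound) simp
    also have "(1 / (2 * avg L) + 1 / avg mu) * ((Max (range L))\<^sup>2 / real CARD('n) * z) = K * z" for z
      unfolding K_def using L_pos m_pos by (simp add: field_simps)
    finally show "?e2 / (2 * avg L) + ?e2 / avg mu \<le> K * (norm (Y k w - mean_matrix (Y k w)))\<^sup>2" .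
  qed (rule A_nonneg)
  finally show ?thesis by simp
qed

lemma deviation_sq_int: "sq_int M Z \<Longrightarrow> sq_int M (\<lambda>w. Z w - mean_matrix (Z w))"
  for Z :: "'w \<Rightarrow> real^'d^'n"
  by (rule sq_int_diff, assumption, erule sq_int_linear, rule bounded_linear_mean_matrix)

lemma \<Phi>_integrable: "integrable M (\<Phi> k)"
proof -
  have "sq_int M (\<lambda>w. u k w - xs)"
    by (intro sq_int_diff sq_int_const finite_measure_axioms adaptedD(2)[OF adapted_u])
  from sq_intD(2)[OF this] show ?thesis
    unfolding \<Phi>_def
    by (intro Bochner_Integration.integrable_add integrable_mult_right Bochner_Integration.integrable_diff
        global_obj_integrable[OF adaptedD(2)[OF adapted_x]] integrable_const)
qed

lemma expected_potential_step:
  assumes dev: "(\<integral>w. (norm (Y k w - mean_matrix (Y k w)))\<^sup>2 \<partial>M) \<le> tol"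
  shows "(\<integral>w. \<Phi> (Suc k) w \<partial>M) \<le> (\<integral>w. \<Phi> k w \<partial>M) + 15 / 64 * \<epsilon> * q * A (Suc k)"
proof -
  have Ym: "Y k \<in> borel_measurable (info (past k))" by (rule adaptedD(1)[OF adapted_Y])
  have sq\<eta>: "sq_int M (\<eta> k)" and var: "(\<integral>w. (norm (\<eta> k w))\<^sup>2 \<partial>M)
      \<le> avg (\<lambda>i. (sigma i)\<^sup>2) / (real CARD('n) * real r)"
    and orth: "(\<integral>w. inner (\<eta> k w) (Zn k w) \<partial>M) = 0"
    using mean_noise_facts(1,2)[OF Ym] mean_noise_facts(3)[OF Ym adaptedD[OF adapted_Zn]]
    by (simp_all add: \<eta>_def[abs_def])
  have i1: "integrable M (\<lambda>w. (norm (Y k w - mean_matrix (Y k w)))\<^sup>2)"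
    by (rule sq_intD(2)[OF deviation_sq_int[OF adaptedD(2)[OF adapted_Y]]])
  have i2: "integrable M (\<lambda>w. inner (\<eta> k w) (Zn k w))"
    by (rule sq_int_inner[OF sq\<eta> adaptedD(2)[OF adapted_Zn]])
  have i3: "integrable M (\<lambda>w. (norm (\<eta> k w))\<^sup>2)" by (rule sq_intD(2)[OF sq\<eta>])
  have "(\<integral>w. \<Phi> (Suc k) w \<partial>M) \<le> (\<integral>w. \<Phi> k w + A (Suc k) * (K * (norm (Y k w - mean_matrix (Y k w)))\<^sup>2)
    + inner (\<eta> k w) (Zn k w) + 3 * A (Suc k) / (8 * avg L) * (norm (\<eta> k w))\<^sup>2 \<partial>M)"
    by (rule integral_mono[OF \<Phi>_integrable _ potential_step])
      (intro Bochner_Integration.integrable_add integrable_mult_right i1 i2 i3 \<Phi>_integrable)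
  also have "\<dots> = (\<integral>w. \<Phi> k w \<partial>M) + A (Suc k) * (K * (\<integral>w. (norm (Y k w - mean_matrix (Y k w)))\<^sup>2 \<partial>M))
      + 3 * A (Suc k) / (8 * avg L) * (\<integral>w. (norm (\<eta> k w))\<^sup>2 \<partial>M)"
    using \<Phi>_integrable i1 i2 i3 by (simp add: orth)
  also have "\<dots> \<le> (\<integral>w. \<Phi> k w \<partial>M) + A (Suc k) * (3 / 64 * \<epsilon> * q)
      + 3 * A (Suc k) / (8 * avg L) * (\<epsilon> * avg L * q / 2)"
  proof (intro add_mono mult_left_mono order_refl)
    have "K * (\<integral>w. (norm (Y k w - mean_matrix (Y k w)))\<^sup>2 \<partial>M) \<le> K * tol"
      by (rule mult_left_mono[OF dev K_nonneg])
    moreover have "K * tol \<le> 3 / 64 * \<epsilon> * q"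
      using tol_budget unfolding K_def q_def .
    ultimately show "K * (\<integral>w. (norm (Y k w - mean_matrix (Y k w)))\<^sup>2 \<partial>M) \<le> 3 / 64 * \<epsilon> * q"
      by (rule order_trans)
    show "(\<integral>w. (norm (\<eta> k w))\<^sup>2 \<partial>M) \<le> \<epsilon> * avg L * q / 2"
      using order_trans[OF var noise_budget] by (simp add: q_def)
  qed (use A_nonneg L_pos in auto)
  also have "\<dots> = (\<integral>w. \<Phi> k w \<partial>M) + 15 / 64 * \<epsilon> * q * A (Suc k)"
    using L_pos by (simp add: field_simps)
  finally show ?thesis .
qed

abbreviation "C \<equiv> 4 * avg L / avg mu * R"

lemma distance_from_potential:
  assumes "k < N" and \<Phi>: "(\<integral>w. \<Phi> k w \<partial>M) \<le> R / 2 + 15 / 64 * \<epsilon> * q * (\<Sum>i\<le>k. A i)"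
  shows "(\<integral>w. (norm (u k w - xs))\<^sup>2 \<partial>M) \<le> C"
proof (rule distance_budget[OF assms(1) \<epsilon>_pos])
  show "exp (real N * q / 3) \<le> 4 * avg L * R / \<epsilon>" using N_le by (simp add: q_def)
  have sq: "sq_int M (\<lambda>w. u k w - xs)"
    by (intro sq_int_diff sq_int_const finite_measure_axioms adaptedD(2)[OF adapted_u])
  have "c k / 2 * (\<integral>w. (norm (u k w - xs))\<^sup>2 \<partial>M) = (\<integral>w. c k / 2 * (norm (u k w - xs))\<^sup>2 \<partial>M)" by simp
  also have "\<dots> \<le> (\<integral>w. \<Phi> k w \<partial>M)"
  proof (rule integral_mono[OF _ \<Phi>_integrable])
    show "c k / 2 * (norm (u k w - xs))\<^sup>2 \<le> \<Phi> k w" for w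
      unfolding \<Phi>_def using A_nonneg minimizer_le by simp
  qed (intro integrable_mult_right sq_intD(2)[OF sq])
  finally show "c k / 2 * (\<integral>w. (norm (u k w - xs))\<^sup>2 \<partial>M) \<le> R / 2 + 15 / 64 * \<epsilon> * q * (\<Sum>i\<le>k. A i)"
    using \<Phi> by linarith
qed

section \<open>Control of the disagreement\<close>

lemma weights: "0 \<le> \<alpha> k / A (Suc k)" "0 \<le> A k / A (Suc k)" "\<alpha> k / A (Suc k) + A k / A (Suc k) = 1"
  using \<alpha>_pos[of k] A_nonneg[of k] A_Suc_pos[of k] by (auto simp: add_divide_distrib[symmetric] A_Suc)

lemma convex_step_shift:
  "(1 / A (Suc k)) *\<^sub>R (\<alpha> k *\<^sub>R a + A k *\<^sub>R b) - z
    = (\<alpha> k / A (Suc k)) *\<^sub>R (a - z) + (A k / A (Suc k)) *\<^sub>R (b - z)"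
  for a b z :: "'v::real_vector"
proof -
  have "z = (\<alpha> k / A (Suc k) + A k / A (Suc k)) *\<^sub>R z" by (simp only: weights scaleR_one)
  then have z: "z = (\<alpha> k / A (Suc k)) *\<^sub>R z + (A k / A (Suc k)) *\<^sub>R z" by (simp only: scaleR_add_left)
  show ?thesis by (subst (1) z) (simp add: scaleR_add_right scaleR_diff_right)
qed

lemma deviation_convex:
  "(1 / A (Suc k)) *\<^sub>R (\<alpha> k *\<^sub>R a + A k *\<^sub>R b) - mean_matrix ((1 / A (Suc k)) *\<^sub>R (\<alpha> k *\<^sub>R a + A k *\<^sub>R b))
    = (\<alpha> k / A (Suc k)) *\<^sub>R (a - mean_matrix a) + (A k / A (Suc k)) *\<^sub>R (b - mean_matrix b)"
  by (simp add: linear_add[OF linear_mean_matrix] linear_scale[OF linear_mean_matrix]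
      scaleR_add_right scaleR_diff_right)

text \<open>Up to the oracle term, \<open>V\<close> is a convex combination of \<open>Y\<close> and
  \<open>U\<close>, whose disagreements are within tolerance. The oracle term is bounded by the step
  size times its root second moment, and \<open>S_ge\<close> adds the two contributions.\<close>

lemma V_deviation:
  assumes devU: "(\<integral>w. (norm (U k w - mean_matrix (U k w)))\<^sup>2 \<partial>M) \<le> tol"
    and devY: "(\<integral>w. (norm (Y k w - mean_matrix (Y k w)))\<^sup>2 \<partial>M) \<le> tol"
    and distY: "(\<integral>w. (norm (y k w - xs))\<^sup>2 \<partial>M) \<le> C"
  shows "(\<integral>w. (norm (V k w - mean_matrix (V k w)))\<^sup>2 \<partial>M) \<le> S\<^sup>2"
proof -
  let ?n = "real CARD('n)"
  define b where "b = sqrt tol + sqrt ?n * sqrt C"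
  define \<gamma> where "\<gamma> = Max (range L) * b + sqrt ?n * M_xi D ff xs"
  have R0: "0 \<le> R" by (simp add: R_def)
  have C0: "0 \<le> C" using R0 L_pos m_pos by simp
  have L0: "0 \<le> Max (range L)" using L_nonneg[of undefined] by (rule order_trans) simp
  have b0: "0 \<le> b" using tol_pos C0 by (simp add: b_def)
  have \<gamma>0: "0 \<le> \<gamma>" using L0 b0 M_xi_nonneg by (simp add: \<gamma>_def)
  have sqY: "sq_int M (Y k)" and sqU: "sq_int M (U k)"
    by (rule adaptedD(2)[OF adapted_Y], rule adaptedD(2)[OF adapted_U])
  have "(\<integral>w. (norm ((Y k w - mean_matrix (Y k w)) + (mean_matrix (Y k w) - XS)))\<^sup>2 \<partial>M) \<le> b\<^sup>2"
    unfolding b_def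
  proof (rule minkowski)
    show "sq_int M (\<lambda>w. mean_matrix (Y k w) - XS)"
      by (intro sq_int_diff sq_int_linear[OF sqY bounded_linear_mean_matrix] sq_int_const finite_measure_axioms)
    have "(norm (mean_matrix (Y k w) - XS))\<^sup>2 = ?n * (norm (y k w - xs))\<^sup>2" for w
      by (simp add: norm_vec_sq mean_matrix_def y_def)
    then have "(\<integral>w. (norm (mean_matrix (Y k w) - XS))\<^sup>2 \<partial>M) = ?n * (\<integral>w. (norm (y k w - xs))\<^sup>2 \<partial>M)" by simp
    also have "\<dots> \<le> ?n * C" using distY by (intro mult_left_mono) auto
    also have "\<dots> = (sqrt ?n * sqrt C)\<^sup>2" using C0 by (simp add: power_mult_distrib)
    finally show "(\<integral>w. (norm (mean_matrix (Y k w) - XS))\<^sup>2 \<partial>M) \<le> (sqrt ?n * sqrt C)\<^sup>2" .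
  qed (use deviation_sq_int[OF sqY] devY tol_pos C0 in auto)
  then have "(\<integral>w. (norm (Y k w - XS))\<^sup>2 \<partial>M) \<le> b\<^sup>2" by simp
  from oracle_second_moment[OF adaptedD[OF adapted_Y] this b0]
  have orc: "(\<integral>w. (norm (oracle k w (Y k w)))\<^sup>2 \<partial>M) \<le> \<gamma>\<^sup>2" by (simp add: \<gamma>_def)
  have sqO: "sq_int M (\<lambda>w. oracle k w (Y k w))" by (rule oracle_sq_int[OF adaptedD[OF adapted_Y]])
  define \<beta> where "\<beta> = \<alpha> k / c (Suc k)"
  have \<beta>0: "0 \<le> \<beta>" using \<alpha>_pos[of k] c_pos[of "Suc k"] by (simp add: \<beta>_def)
  define t1 where "t1 = (\<alpha> k * avg mu / 2) / c (Suc k)"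
  define t2 where "t2 = c k / c (Suc k)"
  have "t1 + t2 = c (Suc k) / c (Suc k)"
    unfolding t1_def t2_def add_divide_distrib[symmetric] c_Suc[of k] by (simp only: add.commute)
  then have t: "0 \<le> t1" "0 \<le> t2" "t1 + t2 = 1"
    using \<alpha>_pos[of k] m_pos c_pos[of k] c_pos[of "Suc k"] by (simp_all add: t1_def t2_def)
  let ?P = "\<lambda>w. t1 *\<^sub>R (Y k w - mean_matrix (Y k w)) + t2 *\<^sub>R (U k w - mean_matrix (U k w))"
  let ?O = "\<lambda>w. (- \<beta>) *\<^sub>R (oracle k w (Y k w) - mean_matrix (oracle k w (Y k w)))"
  have eq: "V k w - mean_matrix (V k w) = ?P w + ?O w" for w
    by (simp add: V_def t1_def t2_def \<beta>_def linear_add[OF linear_mean_matrix] linear_diff[OF linear_mean_matrix]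
        linear_scale[OF linear_mean_matrix] scaleR_add_right scaleR_diff_right mult.commute)
  have "(\<integral>w. (norm (?P w + ?O w))\<^sup>2 \<partial>M) \<le> (sqrt tol + \<beta> * \<gamma>)\<^sup>2"
  proof (rule minkowski)
    show "sq_int M ?P" by (intro sq_int_add sq_int_scaleR deviation_sq_int sqY sqU)
    show "(\<integral>w. (norm (?P w))\<^sup>2 \<partial>M) \<le> (sqrt tol)\<^sup>2"
      using expectation_convex_le[OF deviation_sq_int[OF sqY] devY deviation_sq_int[OF sqU] devU t] tol_pos by simp
    show O: "sq_int M ?O" by (intro sq_int_scaleR deviation_sq_int sqO)
    have "(\<integral>w. (norm (?O w))\<^sup>2 \<partial>M) \<le> (\<integral>w. \<beta>\<^sup>2 * (norm (oracle k w (Y k w)))\<^sup>2 \<partial>M)"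
    proof (rule integral_mono)
      show "integrable M (\<lambda>w. (norm (?O w))\<^sup>2)" by (rule sq_intD(2)[OF O])
      show "integrable M (\<lambda>w. \<beta>\<^sup>2 * (norm (oracle k w (Y k w)))\<^sup>2)"
        by (intro integrable_mult_right sq_intD(2)[OF sqO])
      show "(norm (?O w))\<^sup>2 \<le> \<beta>\<^sup>2 * (norm (oracle k w (Y k w)))\<^sup>2" for w
        unfolding norm_scaleR power_mult_distrib
        using \<beta>0 by (intro mult_mono power_mono norm_deviation_le) auto
    qed
    also have "\<dots> = \<beta>\<^sup>2 * (\<integral>w. (norm (oracle k w (Y k w)))\<^sup>2 \<partial>M)" by simp
    also have "\<dots> \<le> (\<beta> * \<gamma>)\<^sup>2"
      unfolding power_mult_distrib using orc by (intro mult_left_mono) auto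
    finally show "(\<integral>w. (norm (?O w))\<^sup>2 \<partial>M) \<le> (\<beta> * \<gamma>)\<^sup>2" .
  qed (use \<beta>0 \<gamma>0 tol_pos in auto)
  also have "\<dots> \<le> S\<^sup>2"
  proof (rule power_mono)
    have "\<beta> * \<gamma> \<le> 1 / sqrt (avg L * avg mu) * \<gamma>"
      unfolding \<beta>_def by (rule mult_right_mono[OF step_le \<gamma>0])
    with S_ge show "sqrt tol + \<beta> * \<gamma> \<le> S" by (simp add: \<gamma>_def b_def)
  qed (use \<beta>0 \<gamma>0 tol_pos in simp)
  finally show ?thesis unfolding eq .
qed

text \<open>The distance of \<open>x\<close> is carried along because \<open>y\<close> mixes
  \<open>x\<close> with \<open>u\<close>. It is claimed only before the end of the run:
  \<open>distance_budget\<close> needs \<open>k < N\<close>, and the last iterate takes no further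
  gradient.\<close>

lemma run_invariant:
  "k \<le> N \<Longrightarrow>
    (\<integral>w. (norm (X k w - mean_matrix (X k w)))\<^sup>2 \<partial>M) \<le> tol \<and>
    (\<integral>w. (norm (U k w - mean_matrix (U k w)))\<^sup>2 \<partial>M) \<le> tol \<and>
    (\<integral>w. \<Phi> k w \<partial>M) \<le> R / 2 + 15 / 64 * \<epsilon> * q * (\<Sum>i\<le>k. A i) \<and>
    (k < N \<longrightarrow> (\<integral>w. (norm (x k w - xs))\<^sup>2 \<partial>M) \<le> C)"
proof (induction k)
  case 0
  have dev: "x0 - mean_matrix x0 = 0"
  proof -
    have "x0 $ i = row_mean x0" for i
    proof -
      have "(\<Sum>j\<in>UNIV. x0 $ j) = (\<Sum>j\<in>(UNIV::'n set). x0 $ i)"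
        using start by (intro sum.cong) (auto simp: consensual_def)
      then show ?thesis by (simp add: row_mean_def sum_constant_scaleR del: sum_constant)
    qed
    then show ?thesis by (simp add: vec_eq_iff mean_matrix_def)
  qed
  have \<Phi>0: "(\<integral>w. \<Phi> 0 w \<partial>M) \<le> R / 2 + 15 / 64 * \<epsilon> * q * (\<Sum>i\<le>0. A i)"
    by (simp add: \<Phi>_def u_def U_0 c_def R_def prob_space)
  have "(\<integral>w. (norm (x 0 w - xs))\<^sup>2 \<partial>M) = (\<integral>w. (norm (u 0 w - xs))\<^sup>2 \<partial>M)"
    by (simp add: x_def u_def X_0 U_0)
  with \<Phi>0 show ?case
    using dev tol_pos distance_from_potential[of 0] by (simp add: X_0 U_0)
next
  case (Suc k)
  then have k: "k < N" and
    devX: "(\<integral>w. (norm (X k w - mean_matrix (X k w)))\<^sup>2 \<partial>M) \<le> tol" and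
    devU: "(\<integral>w. (norm (U k w - mean_matrix (U k w)))\<^sup>2 \<partial>M) \<le> tol" and
    \<Phi>: "(\<integral>w. \<Phi> k w \<partial>M) \<le> R / 2 + 15 / 64 * \<epsilon> * q * (\<Sum>i\<le>k. A i)" and
    distX: "(\<integral>w. (norm (x k w - xs))\<^sup>2 \<partial>M) \<le> C" by auto
  note sq = adaptedD(2)[OF adapted_X] adaptedD(2)[OF adapted_U] adaptedD(2)[OF adapted_x] adaptedD(2)[OF adapted_u]
  have sqd: "sq_int M (\<lambda>w. x j w - xs)" "sq_int M (\<lambda>w. u j w - xs)" for j
    by (intro sq_int_diff sq sq_int_const finite_measure_axioms)+
  have distU: "(\<integral>w. (norm (u k w - xs))\<^sup>2 \<partial>M) \<le> C" by (rule distance_from_potential[OF k \<Phi>])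
  have devY: "(\<integral>w. (norm (Y k w - mean_matrix (Y k w)))\<^sup>2 \<partial>M) \<le> tol"
    unfolding Y_def deviation_convex
    by (rule expectation_convex_le[OF deviation_sq_int devU deviation_sq_int devX weights]) (rule sq)+
  have distY: "(\<integral>w. (norm (y k w - xs))\<^sup>2 \<partial>M) \<le> C"
    unfolding y_eq convex_step_shift
    by (rule expectation_convex_le[OF sqd(2) distU sqd(1) distX weights])
  have V: "(\<integral>w. (norm (V k w - mean_matrix (V k w)))\<^sup>2 \<partial>M) \<le> S\<^sup>2"
    by (rule V_deviation[OF devU devY distY])
  have devU': "(\<integral>w. (norm (U (Suc k) w - mean_matrix (U (Suc k) w)))\<^sup>2 \<partial>M) \<le> tol"
  proof -
    have mean: "mean_matrix (U (Suc k) w) = mean_matrix (V k w)" for w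
      by (simp add: mean_matrix_def U_Suc cons_mean)
    have "(\<integral>w. (norm (U (Suc k) w - mean_matrix (U (Suc k) w)))\<^sup>2 \<partial>M)
        \<le> (\<integral>w. (norm (V k w - mean_matrix (V k w)))\<^sup>2 / (S\<^sup>2 / tol) \<partial>M)"
    proof (rule integral_mono)
      show "integrable M (\<lambda>w. (norm (U (Suc k) w - mean_matrix (U (Suc k) w)))\<^sup>2)"
        by (rule sq_intD(2)[OF deviation_sq_int]) (rule sq)
      show "integrable M (\<lambda>w. (norm (V k w - mean_matrix (V k w)))\<^sup>2 / (S\<^sup>2 / tol))"
        by (intro Bochner_Integration.integrable_divide sq_intD(2)[OF deviation_sq_int[OF sq_int_V]])
      show "(norm (U (Suc k) w - mean_matrix (U (Suc k) w)))\<^sup>2 \<le> (norm (V k w - mean_matrix (V k w)))\<^sup>2 / (S\<^sup>2 / tol)" for w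
        unfolding mean unfolding U_Suc by (rule cons_contract)
    qed
    also have "\<dots> = (\<integral>w. (norm (V k w - mean_matrix (V k w)))\<^sup>2 \<partial>M) / (S\<^sup>2 / tol)" by simp
    also have "\<dots> \<le> S\<^sup>2 / (S\<^sup>2 / tol)" using V tol_pos by (intro divide_right_mono) auto
    also have "\<dots> = tol" using S_pos by simp
    finally show ?thesis .
  qed
  have devX': "(\<integral>w. (norm (X (Suc k) w - mean_matrix (X (Suc k) w)))\<^sup>2 \<partial>M) \<le> tol"
    unfolding X_Suc deviation_convex
    by (rule expectation_convex_le[OF deviation_sq_int devU' deviation_sq_int devX weights]) (rule sq)+
  have \<Phi>': "(\<integral>w. \<Phi> (Suc k) w \<partial>M) \<le> R / 2 + 15 / 64 * \<epsilon> * q * (\<Sum>i\<le>Suc k. A i)"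
    using expected_potential_step[OF devY] \<Phi> by (simp add: distrib_left)
  have "(\<integral>w. (norm (x (Suc k) w - xs))\<^sup>2 \<partial>M) \<le> C" if "Suc k < N"
    unfolding x_Suc convex_step_shift
    by (rule expectation_convex_le[OF sqd(2) distance_from_potential[OF that \<Phi>'] sqd(1) distX weights])
  with devX' devU' \<Phi>' show ?case by blast
qed

lemma final_iterate:
  assumes N: "0 < N" "B < real N + 1" and B: "4 * avg L * R / \<epsilon> = exp (B * sqrt (avg mu / avg L) / 3)"
  shows "integrable M (\<lambda>w. f (row_mean (X N w)))"
    and "(\<integral>w. f (row_mean (X N w)) \<partial>M) - f xs \<le> \<epsilon>"
    and "integrable M (\<lambda>w. (norm (X N w - mean_matrix (X N w)))\<^sup>2)"
    and "(\<integral>w. (norm (X N w - mean_matrix (X N w)))\<^sup>2 \<partial>M) \<le> tol"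
proof -
  note inv = run_invariant[OF order_refl]
  show int: "integrable M (\<lambda>w. f (row_mean (X N w)))"
    using global_obj_integrable[OF adaptedD(2)[OF adapted_x]] by (simp add: x_def)
  show "integrable M (\<lambda>w. (norm (X N w - mean_matrix (X N w)))\<^sup>2)"
    by (rule sq_intD(2)[OF deviation_sq_int[OF adaptedD(2)[OF adapted_X]]])
  show "(\<integral>w. (norm (X N w - mean_matrix (X N w)))\<^sup>2 \<partial>M) \<le> tol" using inv by blast
  have "A N * ((\<integral>w. f (row_mean (X N w)) \<partial>M) - f xs) = (\<integral>w. A N * (f (x N w) - f xs) \<partial>M)"
    using int by (simp add: x_def prob_space)
  also have "\<dots> \<le> (\<integral>w. \<Phi> N w \<partial>M)"
  proof (rule integral_mono[OF _ \<Phi>_integrable])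
    show "integrable M (\<lambda>w. A N * (f (x N w) - f xs))"
      using int by (simp add: x_def)
    show "A N * (f (x N w) - f xs) \<le> \<Phi> N w" for w
      unfolding \<Phi>_def using c_pos[of N] by simp
  qed
  finally have "A N * ((\<integral>w. f (row_mean (X N w)) \<partial>M) - f xs)
      \<le> R / 2 + 15 / 64 * \<epsilon> * q * (\<Sum>i\<le>N. A i)" using inv by linarith
  from final_error[OF N \<epsilon>_pos B[folded q_def] this]
  show "(\<integral>w. f (row_mean (X N w)) \<partial>M) - f xs \<le> \<epsilon>" .
qed

end

section \<open>Parameters\<close>

lemma consensus_tol_bigo: "consensus_tol n m L Ll \<in> O[at_right 0](\<lambda>e. e)"
proof (rule bigoI[where c = "\<bar>real n / 32 * (m powr (3 / 2) / (L powr (1 / 2) * Ll\<^sup>2))\<bar>"], rule always_eventually, rule allI)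
  fix e :: real
  have "consensus_tol n m L Ll e = (real n / 32 * (m powr (3 / 2) / (L powr (1 / 2) * Ll\<^sup>2))) * e"
    by (simp add: consensus_tol_def)
  then show "norm (consensus_tol n m L Ll e)
      \<le> \<bar>real n / 32 * (m powr (3 / 2) / (L powr (1 / 2) * Ll\<^sup>2))\<bar> * norm e"
    by (simp only: real_norm_def abs_mult order_refl)
qed

lemma consensus_tol_sqrt:
  assumes "0 < m" "0 < L"
  shows "consensus_tol n m L Ll \<epsilon> = real n * \<epsilon> / 32 * (m * sqrt m / (sqrt L * Ll\<^sup>2))"
proof -
  have "m powr (3 / 2) = m powr (1 + 1 / 2)" by simp
  also have "\<dots> = m * sqrt m" using assms by (subst powr_add) (simp add: powr_half_sqrt)
  finally show ?thesis using assms by (simp add: consensus_tol_def powr_half_sqrt)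
qed

text \<open>With \<open>t = sqrt (m / L)\<close> the left-hand side is
  \<open>\<epsilon> / 64 * (t ^ 3 + 2 * t)\<close>, and \<open>t \<le> 1\<close>. The powers in
  \<open>consensus_tol\<close> are those that make this homogeneous.\<close>

lemma consensus_tol_budget:
  assumes m: "0 < m" "m \<le> L" and Ll: "0 < Ll" and \<epsilon>: "0 < \<epsilon>" and n: "0 < n"
  shows "1 / (2 * real n) * (Ll\<^sup>2 / L + 2 * Ll\<^sup>2 / m) * consensus_tol n m L Ll \<epsilon>
    \<le> 3 / 64 * \<epsilon> * sqrt (m / L)"
proof -
  have L: "0 < L" using m by simp
  define a b where "a = sqrt m" and "b = sqrt L"
  have ab: "0 < a" "0 < b" "a \<le> b" "m = a\<^sup>2" "L = b\<^sup>2"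
    using m L by (simp_all add: a_def b_def)
  have tol: "consensus_tol n m L Ll \<epsilon> = real n * \<epsilon> / 32 * (a\<^sup>2 * a / (b * Ll\<^sup>2))"
    using consensus_tol_sqrt[OF m(1) L, of n Ll \<epsilon>] ab by (simp add: a_def[symmetric] b_def[symmetric])
  have "1 / (2 * real n) * (Ll\<^sup>2 / L + 2 * Ll\<^sup>2 / m) * consensus_tol n m L Ll \<epsilon>
      = \<epsilon> / 64 * ((a / b) ^ 3 + 2 * (a / b))"
    unfolding tol unfolding ab(4,5) using ab(1,2) Ll n by (simp add: field_simps power2_eq_square power3_eq_cube)
  also have "(a / b) ^ 3 \<le> a / b"
    using power_decreasing[of 1 3 "a / b"] ab by simp
  finally show ?thesis
    using \<epsilon> by (simp add: a_def b_def real_sqrt_divide mult_left_mono)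
qed

text \<open>The left-hand side is \<open>s / n\<close> times the right-hand side, so
  \<open>s = n\<close> exhausts the noise budget exactly and \<open>s = 1\<close> stays within
  it.\<close>

lemma batch_noise:
  assumes m: "0 < m" "0 < L" and \<epsilon>: "0 < \<epsilon>" and n: "0 < n" and s: "s = 1 \<or> s = real n"
    and r: "0 < r" "real r = batch_size s v m L \<epsilon>"
  shows "v / (real n * real r) \<le> \<epsilon> * L * sqrt (m / L) / 2"
proof -
  have s0: "0 < s" and sn: "s \<le> real n" using s n by auto
  have q: "sqrt (L * m) = L * sqrt (m / L)"
  proof -
    have "L * sqrt (m / L) = (L / sqrt L) * sqrt m" by (simp add: real_sqrt_divide)
    also have "\<dots> = sqrt (L * m)" using m by (simp add: real_div_sqrt real_sqrt_mult)
    finally show ?thesis by simp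
  qed
  have "v = real r * (s * \<epsilon> * sqrt (L * m)) / 2"
    using r s0 \<epsilon> m by (simp add: batch_size_def)
  then have "v / (real n * real r) = real r * (s * \<epsilon> * sqrt (L * m)) / 2 / (real n * real r)"
    by (simp only:)
  also have "\<dots> = (s / real n) * (\<epsilon> * sqrt (L * m) / 2)"
    using r(1) n by simp
  also have "\<dots> \<le> 1 * (\<epsilon> * sqrt (L * m) / 2)"
    using sn n \<epsilon> m by (intro mult_right_mono) auto
  finally show ?thesis by (simp add: q)
qed

lemma oracle_calls_eq:
  assumes m: "0 < m" "0 < L"
  shows "3 * sqrt (L / m) * ln (4 * L * R / \<epsilon>) * batch_size s v m L \<epsilon> = oracle_calls s v m L \<epsilon> R"
proof -
  have "sqrt (L / m) / sqrt (L * m) = 1 / m"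
    using m by (simp add: real_sqrt_mult real_sqrt_divide)
  moreover have "3 * sqrt (L / m) * ln (4 * L * R / \<epsilon>) * batch_size s v m L \<epsilon>
      = 6 * v / (s * \<epsilon>) * ln (4 * L * R / \<epsilon>) * (sqrt (L / m) / sqrt (L * m))"
    by (simp add: batch_size_def)
  ultimately show ?thesis by (simp add: oracle_calls_def)
qed

text \<open>The contribution of the distance to the minimizer is matched exactly:
  \<open>sqrt (4 L R / m) / sqrt (L m) = 2 sqrt R / m\<close>.\<close>

lemma deviation_radius:
  assumes m: "0 < m" "0 < L" and Ll: "0 \<le> Ll" and n: "1 \<le> n" and Mx: "0 \<le> Mx" and R: "0 \<le> R"
    and t: "0 \<le> t" and z: "0 \<le> z"
  shows "sqrt t + 1 / sqrt (L * m) * (Ll * (sqrt t + sqrt n * sqrt (4 * L / m * R)) + sqrt n * Mx)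
    \<le> (2 * Ll / sqrt (L * m) + 1) * sqrt t + 2 * n * Mx / sqrt (L * m) + 2 * Ll / m * sqrt n * sqrt (R + z)"
proof -
  let ?h = "1 / sqrt (L * m)"
  have h: "0 \<le> ?h" using m by simp
  have eq: "?h * sqrt (4 * L / m * R) = 2 / m * sqrt R"
    using m by (simp add: real_sqrt_mult real_sqrt_divide)
  have 1: "?h * Ll * sqrt t \<le> 2 * (?h * Ll * sqrt t)"
  proof -
    have "0 \<le> ?h * Ll * sqrt t" by (intro mult_nonneg_nonneg h Ll) (use t in simp)
    then show ?thesis by linarith
  qed
  have "sqrt n \<le> n" using n by (simp add: real_le_lsqrt power2_eq_square mult_le_cancel_left1)
  then have "?h * (sqrt n * Mx) \<le> ?h * (2 * n * Mx)"
    using h Mx n by (intro mult_left_mono mult_right_mono) auto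
  moreover have "Ll * sqrt n * (?h * sqrt (4 * L / m * R)) \<le> Ll * sqrt n * (2 / m * sqrt (R + z))"
    unfolding eq using Ll m n z R by (intro mult_left_mono) auto
  ultimately have "sqrt t + (?h * Ll * sqrt t + Ll * sqrt n * (?h * sqrt (4 * L / m * R)) + ?h * (sqrt n * Mx))
      \<le> sqrt t + (2 * (?h * Ll * sqrt t) + Ll * sqrt n * (2 / m * sqrt (R + z)) + ?h * (2 * n * Mx))"
    using 1 by linarith
  then show ?thesis by (simp add: algebra_simps)
qed

text \<open>The divisibility of \<open>T\<close> by \<open>\<tau>\<close> lets every consensus phase
  consist of whole mixing blocks. The hypothesis \<open>budget\<close> says that the real-valued
  iteration number admits at least one step after rounding down.\<close>

theorem mainTheorem1:
  fixes D :: "'n::finite \<Rightarrow> 's measure"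
    and ff :: "'n \<Rightarrow> real^'d \<Rightarrow> 's \<Rightarrow> real"
    and Lxi :: "'n \<Rightarrow> 's \<Rightarrow> real"
    and mu L sigma :: "'n \<Rightarrow> real"
    and xs :: "real^'d"
    and M :: "'w measure"
    and \<xi> :: "nat \<Rightarrow> 'n \<Rightarrow> nat \<Rightarrow> 'w \<Rightarrow> 's"
    and E :: "nat \<Rightarrow> ('n \<times> 'n) set"
    and W :: "nat \<Rightarrow> real^'n^'n"
    and G :: "('n \<times> 'n) set"
    and cons :: "nat \<Rightarrow> real^'d^'n \<Rightarrow> real^'d^'n"
    and x0 :: "real^'d^'n"
    and \<epsilon> lam \<kappa> s :: real
    and \<tau> T r :: nat
  defines "n \<equiv> real CARD('n)"
    and "mu_l \<equiv> Min (range mu)"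
    and "L_l \<equiv> Max (range L)"
    and "mu_g \<equiv> avg mu"
    and "L_g \<equiv> avg L"
    and "sigma_g2 \<equiv> avg (\<lambda>i. (sigma i)\<^sup>2)"
    and "R2 \<equiv> (norm (row_mean x0 - xs))\<^sup>2"
  defines "\<delta>' \<equiv> consensus_tol CARD('n) mu_g L_g L_l \<epsilon>"
  defines "\<delta> \<equiv> 1 / (2 * n) * (L_l\<^sup>2 / L_g + 2 * L_l\<^sup>2 / mu_g + L_l - mu_l) * \<delta>'"
  defines "sqrt_D \<equiv> (2 * L_l / sqrt (L_g * mu_g) + 1) * sqrt \<delta>'
      + 2 * n * M_xi D ff xs / sqrt (L_g * mu_g)
      + 2 * L_l / mu_g * sqrt n *
          sqrt (R2 + 2 / sqrt (L_g * mu_g) * (sigma_g2 / (4 * n * L_g * (real r)\<^sup>2) + \<delta>))"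
  defines "x \<equiv> (\<lambda>N \<omega>.
      fst (dsagd mu_g L_g cons (\<lambda>k. batch_gradient ff r (\<lambda>i l. \<xi> k i l \<omega>)) x0 N))"
  assumes problem: "stochastic_problem D ff Lxi mu L sigma xs"
    and samples: "independent_samples M D \<xi>"
    and start: "consensual x0"
    and eps: "0 < \<epsilon>"
    and network:
      "mixing_matrices TYPE('d) E W \<tau> lam \<and> \<tau> dvd T \<and>
         \<kappa> = real \<tau> / (2 * lam) \<and> cons = time_varying_consensus W T
       \<or> static_graph G \<and>
         \<kappa> = sqrt (chi (metropolis G)) \<and> cons = static_consensus (metropolis G) T"
    and T: "0 < T" "real T = \<kappa> * ln (sqrt_D\<^sup>2 / \<delta>')"
    and s: "s = 1 \<or> s = n"
    and r: "0 < r" "real r = batch_size s sigma_g2 mu_g L_g \<epsilon>"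
    and budget: "1 \<le> 3 * sqrt (L_g / mu_g) * ln (4 * L_g * R2 / \<epsilon>)"
  shows "(\<exists>N > 0.
      real (N * r) \<le> oracle_calls s sigma_g2 mu_g L_g \<epsilon> R2 \<and>
      real (N * T) \<le> 3 * sqrt (L_g / mu_g) * \<kappa> * ln (4 * L_g * R2 / \<epsilon>) * ln (sqrt_D\<^sup>2 / \<delta>') \<and>
      integrable M (\<lambda>\<omega>. global_obj D ff (row_mean (x N \<omega>))) \<and>
      (\<integral>\<omega>. global_obj D ff (row_mean (x N \<omega>)) \<partial>M) - global_obj D ff xs \<le> \<epsilon> \<and>
      integrable M (\<lambda>\<omega>. (norm (x N \<omega> - mean_matrix (x N \<omega>)))\<^sup>2) \<and>
      (\<integral>\<omega>. (norm (x N \<omega> - mean_matrix (x N \<omega>)))\<^sup>2 \<partial>M) \<le> \<delta>') \<and>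
    consensus_tol CARD('n) mu_g L_g L_l \<in> O[at_right 0](\<lambda>e. e)"
proof -
  interpret stochastic_problem D ff Lxi mu L sigma xs by (rule problem)
  interpret samp: sampled_problem D ff Lxi mu L sigma xs M \<xi> r
    by unfold_locales (use samples r(1) in auto)
  have m: "0 < mu_g" and mL: "mu_g \<le> L_g" and LL: "L_g \<le> L_l"
    unfolding mu_g_def L_g_def L_l_def by (rule avg_mu_pos, rule avg_mu_le_avg_L, rule avg_L_le_Max)
  have L: "0 < L_g" and Ll: "0 < L_l" using m mL LL by auto
  have muLl: "mu_l \<le> L_l" unfolding mu_l_def L_l_def by (rule Min_mu_le_Max_L)
  have n: "1 \<le> n" unfolding n_def by (simp add: Suc_leI)
  have R0: "0 \<le> R2" by (simp add: R2_def)
  have tol: "0 < \<delta>'"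
    unfolding \<delta>'_def consensus_tol_sqrt[OF m L] using m L Ll eps by simp
  have \<delta>0: "0 \<le> \<delta>"
  proof -
    have "0 \<le> L_l\<^sup>2 / L_g" "0 \<le> 2 * L_l\<^sup>2 / mu_g" using m L by simp_all
    then have "0 \<le> L_l\<^sup>2 / L_g + 2 * L_l\<^sup>2 / mu_g + L_l - mu_l" using muLl by linarith
    then show ?thesis unfolding \<delta>_def using n tol by (intro mult_nonneg_nonneg) auto
  qed
  have v0: "0 \<le> sigma_g2" unfolding sigma_g2_def avg_def by (intro divide_nonneg_nonneg sum_nonneg) auto
  have Mx: "0 \<le> M_xi D ff xs" by (rule M_xi_nonneg)
  define z where "z = 2 / sqrt (L_g * mu_g) * (sigma_g2 / (4 * n * L_g * (real r)\<^sup>2) + \<delta>)"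
  have z0: "0 \<le> z"
    unfolding z_def using m L v0 n \<delta>0 by (intro mult_nonneg_nonneg add_nonneg_nonneg divide_nonneg_nonneg) auto
  have S_ge: "sqrt \<delta>' + 1 / sqrt (L_g * mu_g) *
      (L_l * (sqrt \<delta>' + sqrt n * sqrt (4 * L_g / mu_g * R2)) + sqrt n * M_xi D ff xs) \<le> sqrt_D"
    unfolding sqrt_D_def z_def[symmetric]
    by (rule deviation_radius) (use m L Ll n Mx R0 tol z0 in auto)
  \<comment> \<open>Already the first term of \<open>sqrt_D\<close> suffices, because
    \<open>L_l\<close> dominates both \<open>L_g\<close> and \<open>mu_g\<close>. The bound makes
    the contraction factor large enough for the Chebyshev estimate.\<close>
  have S3: "3 * sqrt \<delta>' \<le> sqrt_D"
  proof -
    have "sqrt (L_g * mu_g) \<le> L_l"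
      using m L Ll mL LL by (intro real_le_lsqrt) (auto simp: power2_eq_square intro!: mult_mono)
    then have "1 \<le> L_l / sqrt (L_g * mu_g)" using m L by simp
    then have "3 * sqrt \<delta>' \<le> (2 * L_l / sqrt (L_g * mu_g) + 1) * sqrt \<delta>'"
      using tol by (intro mult_right_mono) auto
    moreover have "0 \<le> 2 * n * M_xi D ff xs / sqrt (L_g * mu_g)" using n Mx m L by simp
    moreover have "0 \<le> 2 * L_l / mu_g * sqrt n * sqrt (R2 + z)" using Ll m n R0 z0 by simp
    ultimately show ?thesis unfolding sqrt_D_def z_def[symmetric] by linarith
  qed
  have S0: "0 < sqrt_D" using S3 tol by (smt (verit) real_sqrt_gt_zero)
  have Q: "4 \<le> sqrt_D\<^sup>2 / \<delta>'"
  proof -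
    have "(3 * sqrt \<delta>')\<^sup>2 \<le> sqrt_D\<^sup>2" by (rule power_mono[OF S3]) (use tol in simp)
    then show ?thesis using tol by (simp add: pos_le_divide_eq power_mult_distrib)
  qed
  have cons: "linear (cons k) \<and> row_mean (cons k Z) = row_mean Z \<and>
      (norm (cons k Z - mean_matrix Z))\<^sup>2 \<le> (norm (Z - mean_matrix Z))\<^sup>2 / (sqrt_D\<^sup>2 / \<delta>')" for k Z
    using network
  proof
    assume A: "mixing_matrices TYPE('d) E W \<tau> lam \<and> \<tau> dvd T \<and>
         \<kappa> = real \<tau> / (2 * lam) \<and> cons = time_varying_consensus W T"
    then show ?thesis
      using time_varying_linear time_varying_row_mean time_varying_contraction[of E W \<tau> lam T "sqrt_D\<^sup>2 / \<delta>'"] T Q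
      by auto
  next
    assume A: "static_graph G \<and> \<kappa> = sqrt (chi (metropolis G)) \<and> cons = static_consensus (metropolis G) T"
    then interpret gossip_matrix "metropolis G" using metropolis_gossip by blast
    show ?thesis
      using static_consensus_linear static_consensus_facts[of T "sqrt_D\<^sup>2 / \<delta>'"] T Q A by auto
  qed
  define B where "B = 3 * sqrt (L_g / mu_g) * ln (4 * L_g * R2 / \<epsilon>)"
  \<comment> \<open>Rounding down keeps \<open>N * r\<close> and \<open>N * T\<close> within the
    stated costs; \<open>final_error\<close> tolerates the lost fraction of a step.\<close>
  define N where "N = nat \<lfloor>B\<rfloor>"
  have B1: "1 \<le> B" using budget by (simp add: B_def)
  have N: "0 < N" "real N \<le> B" "B < real N + 1" using B1 by (auto simp: N_def le_floor_iff)
  have q: "sqrt (L_g / mu_g) * sqrt (mu_g / L_g) = 1"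
    using m L by (simp add: real_sqrt_mult[symmetric])
  have arg: "4 * L_g * R2 / \<epsilon> = exp (B * sqrt (mu_g / L_g) / 3)"
  proof -
    \<comment> \<open>A start at the minimizer is excluded by \<open>budget\<close>:
      \<open>ln 0\<close> is 0 by convention, which would make \<open>B\<close> vanish.\<close>
    have "4 * L_g * R2 / \<epsilon> \<noteq> 0"
    proof
      assume zero: "4 * L_g * R2 / \<epsilon> = 0"
      have "B = 0" unfolding B_def zero by simp
      with B1 show False by simp
    qed
    then have "0 < 4 * L_g * R2 / \<epsilon>" using L R0 eps by simp
    moreover have "B * sqrt (mu_g / L_g) / 3 = (sqrt (L_g / mu_g) * sqrt (mu_g / L_g)) * ln (4 * L_g * R2 / \<epsilon>)"
      by (simp add: B_def)
    ultimately show ?thesis by (simp only: q mult_1_left exp_ln)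
  qed
  interpret run: dsagd_run D ff Lxi mu L sigma xs M \<xi> r cons x0 \<delta>' sqrt_D \<epsilon> R2 N
  proof (rule dsagd_run.intro[OF samp.sampled_problem_axioms], rule dsagd_run_axioms.intro)
    show "linear (cons k)" for k using cons by blast
    show "row_mean (cons k Z) = row_mean Z" for k Z using cons by blast
    show "(norm (cons k Z - mean_matrix Z))\<^sup>2 \<le> (norm (Z - mean_matrix Z))\<^sup>2 / (sqrt_D\<^sup>2 / \<delta>')" for k Z
      using cons by blast
    show "consensual x0" by (rule start)
    show "R2 = (norm (row_mean x0 - xs))\<^sup>2" by (simp only: R2_def)
    show "0 < \<delta>'" "0 < sqrt_D" "0 < \<epsilon>" by (rule tol, rule S0, rule eps)
    show "avg (\<lambda>i. (sigma i)\<^sup>2) / (real CARD('n) * real r) \<le> \<epsilon> * avg L * sqrt (avg mu / avg L) / 2"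
      using batch_noise[OF m L eps _ _ r(1) r(2), of "CARD('n)"] s
      unfolding n_def L_g_def mu_g_def sigma_g2_def by simp
    show "1 / (2 * real CARD('n)) * ((Max (range L))\<^sup>2 / avg L + 2 * (Max (range L))\<^sup>2 / avg mu) * \<delta>'
      \<le> 3 / 64 * \<epsilon> * sqrt (avg mu / avg L)"
      using consensus_tol_budget[OF m mL Ll eps, of "CARD('n)"]
      unfolding \<delta>'_def L_g_def mu_g_def L_l_def by simp
    show "sqrt \<delta>' + 1 / sqrt (avg L * avg mu) * (Max (range L) * (sqrt \<delta>' + sqrt (real CARD('n)) *
        sqrt (4 * avg L / avg mu * R2)) + sqrt (real CARD('n)) * M_xi D ff xs) \<le> sqrt_D"
      using S_ge unfolding n_def L_g_def mu_g_def L_l_def .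
    have "exp (real N * sqrt (mu_g / L_g) / 3) \<le> exp (B * sqrt (mu_g / L_g) / 3)"
      using N(2) m L by (simp add: mult_right_mono)
    then show "exp (real N * sqrt (avg mu / avg L) / 3) \<le> 4 * avg L * R2 / \<epsilon>"
      using arg unfolding L_g_def mu_g_def by simp
  qed
  have x: "x N = run.X N"
    by (simp add: x_def run.X_def run.state_def fun_eq_iff mu_g_def L_g_def)
  note final = run.final_iterate[OF N(1,3) arg[unfolded L_g_def mu_g_def], folded x]
  have calls: "real (N * r) \<le> oracle_calls s sigma_g2 mu_g L_g \<epsilon> R2"
  proof -
    have "real N * real r \<le> B * real r" using N(2) by (rule mult_right_mono) simp
    also have "\<dots> = oracle_calls s sigma_g2 mu_g L_g \<epsilon> R2"
      unfolding r(2) B_def by (rule oracle_calls_eq[OF m L])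
    finally show ?thesis by simp
  qed
  have comm: "real (N * T) \<le> 3 * sqrt (L_g / mu_g) * \<kappa> * ln (4 * L_g * R2 / \<epsilon>) * ln (sqrt_D\<^sup>2 / \<delta>')"
  proof -
    have "real N * real T \<le> B * real T" using N(2) by (rule mult_right_mono) simp
    also have "\<dots> = 3 * sqrt (L_g / mu_g) * \<kappa> * ln (4 * L_g * R2 / \<epsilon>) * ln (sqrt_D\<^sup>2 / \<delta>')"
      unfolding T(2) B_def by (simp only: mult_ac)
    finally show ?thesis by simp
  qed
  show ?thesis
    using N(1) calls comm final consensus_tol_bigo by blast
qed

end
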